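(* Let $\lambda$ be a dominant integral weight and let $\{\beta_i\}_{i\in I}$ be the special (lexicographic) $\lambda$-chain described in the context. The map $J\mapsto\gamma(J)$ is a bijection between the admissible subsets $J\subseteq I$ and the LS chains corresponding to the antidominant weight $-\lambda$.
   Context: Root system. Let $V$ be a finite-dimensional real vector space with a nondegenerate symmetric bilinear form $\langle\cdot,\cdot\rangle$, and let $\Phi\subset V$ be the set of real roots of a complex symmetrizable Kac-Moody algebra, with simple roots $\alpha_1,\ldots,\alpha_r$. Put $\alpha^\vee=2\alpha/\langle\alpha,\alpha\rangle$ for $\alpha\in\Phi$ and $s_\alpha(v)=v-\langle v,\alpha^\vee\rangle\alpha$. Let $W\subset GL(V)$ be the Weyl group generated by the $s_\alpha$, $\alpha\in\Phi$, with length function $\ell$ with respect to the simple reflections $s_p=s_{\alpha_p}$. Thus: $\alpha_1,\dots,\alpha_r$ are linearly independent; $\langle\alpha_p,\alpha_p\rangle>0$; $\langle\alpha_p,\alpha_q^\vee\rangle\in\mathbb{Z}_{\le0}$ for $p\ne q$; and $\Phi=\bigcup_p W\alpha_p$. $\Phi^+$ is the set of roots in the nonnegative span of the simple roots, $\Phi=\Phi^+\sqcup(-\Phi^+)$. In Bruhat order on $W$, $w\lessdot ws_\alpha$ ($\alpha\in\Phi^+$) means $\ell(ws_\alpha)=\ell(w)+1$. Let $\Lambda=\{v\in V\mid\langle v,\alpha_p^\vee\rangle\in\mathbb{Z}\ \forall p\}$ and $\Lambda^+=\{v\in\Lambda\mid\langle v,\alpha^\vee\rangle\ge0\ \forall\alpha\in\Phi^+\}$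 (dominant weights); $-\Lambda^+$ are the antidominant weights. LS chains. For $\pm\nu\in\Lambda^+$, the Bruhat order on the orbit $W\nu$ is the transitive closure of the relations $s_\alpha(\mu)<\mu$ whenever $\langle\mu,\alpha^\vee\rangle>0$ ($\mu\in W\nu$, $\alpha\in\Phi^+$); $\lessdot$ denotes its covering relation. For a real number $b$, the $b$-Bruhat order $<_b$ is the transitive closure of the relations $s_\alpha(\mu)<_b\mu$ whenever $s_\alpha(\mu)\lessdot\mu$ and $b\langle\mu,\alpha^\vee\rangle\in\mathbb{Z}$ ($\mu\in W\nu$, $\alpha\in\Phi^+$). An LS chain (Lakshmibai-Seshadri chain) corresponding to $\nu$ is a pair consisting of a chain $\mu_0<\mu_1<\dots<\mu_l$ in $W\nu$ ($l\ge0$) and rational numbers $0<b_1<\dots<b_l<1$ such that $\mu_0<_{b_1}\mu_1<_{b_2}\cdots<_{b_l}\mu_l$. Special $\lambda$-chain. $I=\{(\alpha,k)\mid\alpha\in\Phi^+,\ k\in\mathbb{Z},\ 0\le k<\langle\lambda,\alpha^\vee\rangle\}$. Fix a total order $\alpha_1<\dots<\alpha_r$ on the simple roots. For $i=(\alpha,k)\in I$ with $\alpha^\vee=c_1\alpha_1^\vee+\dots+c_r\alpha_r^\vee$ put $v_i=\frac{1}{\langle\lambda,\alpha^\vee\rangle}(k,c_1,\dots,c_r)\in\mathbb{Q}^{r+1}$; the map $i\mapsto v_i$ is injective and $I$ is totally ordered by the lexicographic order of the $v_i$. Put $\beta_i=\alpha$, $r_i=s_{\beta_i}$ and $t_i=k/\langle\lambda,\alpha^\vee\rangle\in[0,1)$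 for $i=(\alpha,k)$. Admissible subsets. A finite (possibly empty) subset $J=\{j_1<\dots<j_s\}\subseteq I$ is admissible if $1\lessdot r_{j_1}\lessdot r_{j_1}r_{j_2}\lessdot\cdots\lessdot r_{j_1}\cdots r_{j_s}$. The LS chain $\gamma(J)$. For admissible $J=\{j_1<\dots<j_s\}$, let $\{0=a_0<a_1<\dots<a_l\}=\{t_{j_1}\le\dots\le t_{j_s}\}\cup\{0\}$. Let $0=n_0\le n_1<\dots<n_{l+1}=s$ be such that $t_{j_h}=a_k$ if and only if $n_k<h\le n_{k+1}$. Put $w_k=r_{j_1}\cdots r_{j_{n_{k+1}}}$ and $\mu_k=w_k(\lambda)$ for $k=0,\dots,l$. Then $\gamma(J)$ is the LS chain $-\mu_0<_{a_1}-\mu_1<_{a_2}\cdots<_{a_l}-\mu_l$ in the orbit $W(-\lambda)$. *)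

theory Defs
  imports "HOL-Analysis.Analysis" "HOL-Library.List_Lexorder"
begin

text \<open>
  The ambient space \<open>V\<close> is the type \<open>'v\<close>, the form is \<open>ip\<close>, and the simple roots are
  \<open>simple 0, \<dots>, simple (r - 1)\<close> (indices start at 0). The fixed total order on the simple roots is
  the order of their indices. The first locale only collects definitions; the hypotheses on
  \<open>ip\<close>, \<open>simple\<close> and \<open>r\<close> are those of the locale \<open>kac_moody_roots\<close> below.
\<close>

locale reflection_data =
  fixes ip :: "'v::real_vector \<Rightarrow> 'v \<Rightarrow> real"
    and simple :: "nat \<Rightarrow> 'v"
    and r :: nat
begin

definition coroot :: "'v \<Rightarrow> 'v" where
  "coroot a = (2 / ip a a) *\<^sub>R a"

definition reflect :: "'v \<Rightarrow> 'v \<Rightarrow> 'v" where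
  "reflect a v = v - ip v (coroot a) *\<^sub>R a"

definition refl_prod :: "'v list \<Rightarrow> 'v \<Rightarrow> 'v" where
  "refl_prod as = foldr (\<lambda>a w. reflect a \<circ> w) as id"

text \<open>
  Real roots are the images of simple roots under products of simple reflections.
  Reflections are involutions, so closure under composition makes \<open>weyl\<close> the generated group.
\<close>

definition real_roots :: "'v set" where
  "real_roots = {refl_prod (map simple ps) (simple p) | ps p. set ps \<subseteq> {..<r} \<and> p < r}"

inductive_set weyl :: "('v \<Rightarrow> 'v) set" where
  weyl_id: "id \<in> weyl"
| weyl_refl: "w \<in> weyl \<Longrightarrow> a \<in> real_roots \<Longrightarrow> w \<circ> reflect a \<in> weyl"

definition weyl_length :: "('v \<Rightarrow> 'v) \<Rightarrow> nat" where
  "weyl_length w =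
    (LEAST n. \<exists>ps. length ps = n \<and> set ps \<subseteq> {..<r} \<and> w = refl_prod (map simple ps))"

definition pos_roots :: "'v set" where
  "pos_roots = {a \<in> real_roots. \<exists>c. (\<forall>p<r. 0 \<le> c p) \<and> a = (\<Sum>p<r. c p *\<^sub>R simple p)}"

definition bruhat_cover :: "('v \<Rightarrow> 'v) \<Rightarrow> ('v \<Rightarrow> 'v) \<Rightarrow> bool" where
  "bruhat_cover w w' \<longleftrightarrow>
    w \<in> weyl \<and> (\<exists>a\<in>pos_roots. w' = w \<circ> reflect a \<and> weyl_length w' = weyl_length w + 1)"

definition weights :: "'v set" where
  "weights = {v. \<forall>p<r. ip v (coroot (simple p)) \<in> \<int>}"

definition dominant_weights :: "'v set" where
  "dominant_weights = {v \<in> weights. \<forall>a\<in>pos_roots. 0 \<le> ip v (coroot a)}"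

subsection \<open>LS chains\<close>

definition orbit :: "'v \<Rightarrow> 'v set" where
  "orbit \<nu> = {w \<nu> | w. w \<in> weyl}"

definition orbit_less :: "'v \<Rightarrow> 'v \<Rightarrow> 'v \<Rightarrow> bool" where
  "orbit_less \<nu> =
    (\<lambda>x y. y \<in> orbit \<nu> \<and> (\<exists>a\<in>pos_roots. 0 < ip y (coroot a) \<and> x = reflect a y))\<^sup>+\<^sup>+"

definition orbit_cover :: "'v \<Rightarrow> 'v \<Rightarrow> 'v \<Rightarrow> bool" where
  "orbit_cover \<nu> x y \<longleftrightarrow>
    orbit_less \<nu> x y \<and> \<not> (\<exists>z. orbit_less \<nu> x z \<and> orbit_less \<nu> z y)"

definition orbit_less_at :: "'v \<Rightarrow> real \<Rightarrow> 'v \<Rightarrow> 'v \<Rightarrow> bool" where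
  "orbit_less_at \<nu> b =
    (\<lambda>x y. y \<in> orbit \<nu> \<and>
       (\<exists>a\<in>pos_roots. x = reflect a y \<and> orbit_cover \<nu> x y \<and> b * ip y (coroot a) \<in> \<int>))\<^sup>+\<^sup>+"

text \<open>
  An LS chain is encoded as the pair of lists \<open>[\<mu>\<^sub>0, \<dots>, \<mu>\<^sub>l]\<close> and \<open>[b\<^sub>1, \<dots>, b\<^sub>l]\<close>;
  hence \<open>bs ! i\<close> is the number attached to the step from \<open>\<mu>s ! i\<close> to \<open>\<mu>s ! Suc i\<close>.
\<close>

definition LS_chains :: "'v \<Rightarrow> ('v list \<times> real list) set" where
  "LS_chains \<nu> = {(\<mu>s, bs).
     length \<mu>s = length bs + 1 \<and> set \<mu>s \<subseteq> orbit \<nu> \<and>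
     (\<forall>i<length bs. orbit_less \<nu> (\<mu>s ! i) (\<mu>s ! Suc i)) \<and>
     set bs \<subseteq> \<rat> \<inter> {0<..<1} \<and> sorted_wrt (<) bs \<and>
     (\<forall>i<length bs. orbit_less_at \<nu> (bs ! i) (\<mu>s ! i) (\<mu>s ! Suc i))}"

subsection \<open>The special lam-chain and admissible subsets\<close>

definition chain_index :: "'v \<Rightarrow> ('v \<times> int) set" where
  "chain_index lam = {(a, k). a \<in> pos_roots \<and> 0 \<le> k \<and> real_of_int k < ip lam (coroot a)}"

definition coroot_coeff :: "'v \<Rightarrow> nat \<Rightarrow> real" where
  "coroot_coeff a q =
    representation ((\<lambda>p. coroot (simple p)) ` {..<r}) (coroot a) (coroot (simple q))"

fun chain_vec :: "'v \<Rightarrow> 'v \<times> int \<Rightarrow> real list" where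
  "chain_vec lam (a, k) =
    map (\<lambda>x. x / ip lam (coroot a)) (real_of_int k # map (coroot_coeff a) [0..<r])"

fun chain_t :: "'v \<Rightarrow> 'v \<times> int \<Rightarrow> real" where
  "chain_t lam (a, k) = real_of_int k / ip lam (coroot a)"

text \<open>
  The increasing enumeration \<open>j\<^sub>1 < \<dots> < j\<^sub>s\<close> of a finite \<open>J \<subseteq> I\<close>, sorted by the lexicographic order
  on real lists (\<open>HOL-Library.List_Lexorder\<close>) of the vectors \<open>v\<^sub>i\<close>; see \<open>inj_on_chain_vec\<close> below.
\<close>

definition index_list :: "'v \<Rightarrow> ('v \<times> int) set \<Rightarrow> ('v \<times> int) list" where
  "index_list lam J = sorted_key_list_of_set (chain_vec lam) J"

definition admissible :: "'v \<Rightarrow> ('v \<times> int) set set" where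
  "admissible lam = {J. finite J \<and> J \<subseteq> chain_index lam \<and>
     (let bs = map fst (index_list lam J) in
      \<forall>m<length bs. bruhat_cover (refl_prod (take m bs)) (refl_prod (take (Suc m) bs)))}"

subsection \<open>The LS chain of an admissible subset\<close>

definition jumps :: "'v \<Rightarrow> ('v \<times> int) set \<Rightarrow> real list" where
  "jumps lam J = sorted_list_of_set (insert 0 (chain_t lam ` J))"

text \<open>
  \<open>block_end lam J k\<close> is \<open>n\<^sub>k\<close>. Since \<open>t\<^sub>j\<close> is weakly increasing along the enumeration, \<open>n\<^sub>k\<^sub>+\<^sub>1\<close> is the
  number of \<open>j \<in> J\<close> with \<open>t\<^sub>j \<le> a\<^sub>k\<close>; the defining property is \<open>block_end_iff\<close> below.
\<close>

fun block_end :: "'v \<Rightarrow> ('v \<times> int) set \<Rightarrow> nat \<Rightarrow> nat" where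
  "block_end lam J 0 = 0"
| "block_end lam J (Suc k) = card {j \<in> J. chain_t lam j \<le> jumps lam J ! k}"

definition gamma_w :: "'v \<Rightarrow> ('v \<times> int) set \<Rightarrow> nat \<Rightarrow> 'v \<Rightarrow> 'v" where
  "gamma_w lam J k = refl_prod (map fst (take (block_end lam J (Suc k)) (index_list lam J)))"

definition gamma :: "'v \<Rightarrow> ('v \<times> int) set \<Rightarrow> 'v list \<times> real list" where
  "gamma lam J =
    (map (\<lambda>k. - gamma_w lam J k lam) [0..<length (jumps lam J)], tl (jumps lam J))"

end

lemma (in linorder) sorted_key_list_of_set_props:
  assumes "inj_on f A" "finite A"
  shows "set (sorted_key_list_of_set f A) = A" "length (sorted_key_list_of_set f A) = card A"
    "sorted_wrt (<) (map f (sorted_key_list_of_set f A))"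
proof -
  interpret fk: folding_insort_key "(\<le>)" "(<)" A f
    by unfold_locales (rule assms(1))
  show "set (sorted_key_list_of_set f A) = A" "length (sorted_key_list_of_set f A) = card A"
    "sorted_wrt (<) (map f (sorted_key_list_of_set f A))"
    by (rule fk.set_sorted_key_list_of_set[OF subset_refl assms(2)]
      fk.length_sorted_key_list_of_set[OF subset_refl]
      fk.strict_sorted_key_list_of_set[OF subset_refl])+
qed

subsection \<open>Standing hypotheses\<close>

locale kac_moody_roots = reflection_data ip simple r
  for ip :: "'v::real_vector \<Rightarrow> 'v \<Rightarrow> real" and simple :: "nat \<Rightarrow> 'v" and r :: nat +
  assumes finite_dim: "\<exists>S::'v set. finite S \<and> span S = UNIV"
    and bilinear: "bilinear ip"
    and symmetric: "ip u v = ip v u"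
    and nondegenerate: "(\<And>v. ip u v = 0) \<Longrightarrow> u = 0"
    and simple_inj: "inj_on simple {..<r}"
    and simple_independent: "independent (simple ` {..<r})"
    and simple_pos: "p < r \<Longrightarrow> 0 < ip (simple p) (simple p)"
    and cartan_int: "p < r \<Longrightarrow> q < r \<Longrightarrow> p \<noteq> q \<Longrightarrow>
      ip (simple p) (coroot (simple q)) \<in> \<int> \<and> ip (simple p) (coroot (simple q)) \<le> 0"
    and roots_decomp: "real_roots = pos_roots \<union> uminus ` pos_roots"
      "pos_roots \<inter> uminus ` pos_roots = {}"
begin

lemma ip_simps [simp]:
  "ip (u + v) x = ip u x + ip v x" "ip x (u + v) = ip x u + ip x v"
  "ip (u - v) x = ip u x - ip v x" "ip x (u - v) = ip x u - ip x v"
  "ip (c *\<^sub>R u) x = c * ip u x" "ip x (c *\<^sub>R u) = c * ip x u"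
  "ip 0 x = 0" "ip x 0 = 0" "ip (- u) x = - ip u x" "ip x (- u) = - ip x u"
  using bilinear
  by (auto simp: bilinear_ladd bilinear_radd bilinear_lsub bilinear_rsub bilinear_lmul bilinear_rmul
      bilinear_lzero bilinear_rzero bilinear_lneg bilinear_rneg)

lemma ip_coroot: "ip v (coroot a) = 2 * ip v a / ip a a"
  by (simp add: coroot_def)

lemma refl_isometry: assumes "ip a a \<noteq> 0" shows "ip (reflect a u) (reflect a v) = ip u v"
  using assms symmetric[of a v] by (simp add: reflect_def ip_coroot field_simps)

lemma refl_refl: assumes "ip a a \<noteq> 0" shows "reflect a (reflect a v) = v"
  using assms by (simp add: reflect_def ip_coroot algebra_simps)

lemma linear_refl: "linear (reflect a)"
  by (rule linearI) (simp_all add: reflect_def algebra_simps)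

lemma refl_prod_Nil [simp]: "refl_prod [] = id"
  by (simp add: refl_prod_def)

lemma refl_prod_Cons [simp]: "refl_prod (a # as) = reflect a \<circ> refl_prod as"
  by (simp add: refl_prod_def)

lemma refl_prod_append: "refl_prod (as @ bs) = refl_prod as \<circ> refl_prod bs"
  by (induction as) auto

lemma linear_refl_prod: "linear (refl_prod as)"
proof (induction as)
  case Nil
  show ?case unfolding refl_prod_Nil id_def by (rule linear_ident)
next
  case (Cons a as)
  then show ?case unfolding refl_prod_Cons by (intro linear_compose linear_refl)
qed

abbreviation simple_word :: "nat list \<Rightarrow> 'v \<Rightarrow> 'v" where
  "simple_word ps \<equiv> refl_prod (map simple ps)"

lemma word_isometry: "set ps \<subseteq> {..<r} \<Longrightarrow> ip (simple_word ps u) (simple_word ps v) = ip u v"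
proof (induction ps)
  case (Cons p ps)
  then have "ip (simple p) (simple p) \<noteq> 0" using simple_pos[of p] by auto
  then show ?case using Cons by (simp add: refl_isometry)
qed simp

lemma word_rev: "set ps \<subseteq> {..<r} \<Longrightarrow> simple_word (rev ps) (simple_word ps v) = v"
proof (induction ps arbitrary: v)
  case (Cons p ps)
  then have "ip (simple p) (simple p) \<noteq> 0" using simple_pos[of p] by auto
  then show ?case using Cons by (simp add: refl_prod_append refl_refl)
qed simp

lemma word_rev': "set ps \<subseteq> {..<r} \<Longrightarrow> simple_word ps (simple_word (rev ps) v) = v"
  using word_rev[of "rev ps" v] by simp

lemma refl_word:
  assumes "set ps \<subseteq> {..<r}"
  shows "reflect (simple_word ps a) = simple_word ps \<circ> reflect a \<circ> simple_word (rev ps)"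
proof
  fix v
  have "ip v (simple_word ps a) = ip (simple_word (rev ps) v) a"
    using word_isometry[OF assms, of "simple_word (rev ps) v" a] by (simp add: word_rev'[OF assms])
  then show "reflect (simple_word ps a) v = (simple_word ps \<circ> reflect a \<circ> simple_word (rev ps)) v"
    using linear_refl_prod[of "map simple ps"]
    by (simp add: reflect_def ip_coroot word_isometry[OF assms] word_rev'[OF assms]
        linear_diff linear_scale)
qed

text \<open>The Weyl group is generated by the simple reflections, and the roots are its orbits.\<close>

lemma weyl_eq_words: "weyl = {simple_word ps | ps. set ps \<subseteq> {..<r}}"
proof (intro equalityI subsetI)
  fix w assume "w \<in> weyl"
  then show "w \<in> {simple_word ps | ps. set ps \<subseteq> {..<r}}"
  proof induction
    case weyl_id
    show ?case by (auto intro!: exI[of _ "[]"])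
  next
    case (weyl_refl w a)
    then obtain ps qs p where *: "w = simple_word ps" "set ps \<subseteq> {..<r}"
      "a = simple_word qs (simple p)" "set qs \<subseteq> {..<r}" "p < r"
      by (auto simp: real_roots_def)
    have "w \<circ> reflect a = simple_word (ps @ qs @ [p] @ rev qs)"
      using * by (simp add: refl_word refl_prod_append comp_assoc)
    moreover have "set (ps @ qs @ [p] @ rev qs) \<subseteq> {..<r}" using * by auto
    ultimately show ?case by blast
  qed
next
  fix w assume "w \<in> {simple_word ps | ps. set ps \<subseteq> {..<r}}"
  then obtain ps where ps: "w = simple_word ps" "set ps \<subseteq> {..<r}" by auto
  from ps(2) have "simple_word ps \<in> weyl"
  proof (induction ps rule: rev_induct)
    case (snoc p ps)
    have "simple p \<in> real_roots"
      using snoc by (auto simp: real_roots_def intro!: exI[of _ "[]"] exI[of _ p])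
    then have "simple_word ps \<circ> reflect (simple p) \<in> weyl"
      using snoc weyl.weyl_refl by simp
    then show ?case by (simp only: map_append list.map refl_prod_append refl_prod_Cons
          refl_prod_Nil comp_id)
  qed (use weyl.weyl_id in simp)
  then show "w \<in> weyl" using ps by simp
qed

lemma real_roots_eq_orbits: "real_roots = (\<Union>p<r. {w (simple p) | w. w \<in> weyl})"
  unfolding weyl_eq_words real_roots_def by blast

lemma root_pos: assumes "a \<in> real_roots" shows "0 < ip a a"
  using assms simple_pos by (auto simp: real_roots_def word_isometry)

lemma cartan_int': "p < r \<Longrightarrow> q < r \<Longrightarrow> ip (simple p) (coroot (simple q)) \<in> \<int>"
  using cartan_int[of p q] simple_pos[of p] by (cases "p = q") (auto simp: ip_coroot)

lemma word_int_combination: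
  assumes "set ps \<subseteq> {..<r}" "p < r"
  shows "\<exists>c::nat \<Rightarrow> real. (\<forall>q<r. c q \<in> \<int>) \<and> simple_word ps (simple p) = (\<Sum>q<r. c q *\<^sub>R simple q)"
  using assms(1)
proof (induction ps)
  case Nil
  have "(\<Sum>q<r. (if q = p then 1 else 0) *\<^sub>R simple q) = simple p"
    using assms(2) by (simp add: if_distrib[of "\<lambda>x. x *\<^sub>R _"] sum.delta cong: if_cong)
  then show ?case by (intro exI[of _ "\<lambda>q. if q = p then 1 else 0"]) auto
next
  case (Cons s ps)
  then obtain c :: "nat \<Rightarrow> real" where c: "\<forall>q<r. c q \<in> \<int>"
    "simple_word ps (simple p) = (\<Sum>q<r. c q *\<^sub>R simple q)" by auto
  have s: "s < r" using Cons by auto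
  let ?x = "\<Sum>q<r. c q *\<^sub>R simple q"
  have lin: "linear (\<lambda>v. ip v (coroot (simple s)))"
    using bilinear by (simp add: bilinear_def)
  have "ip ?x (coroot (simple s)) = (\<Sum>q<r. c q * ip (simple q) (coroot (simple s)))"
    by (simp add: linear_sum[OF lin])
  then have int: "ip ?x (coroot (simple s)) \<in> \<int>"
    using c(1) cartan_int'[OF _ s] by (auto intro!: Ints_sum Ints_mult)
  let ?d = "\<lambda>q. c q - (if q = s then ip ?x (coroot (simple s)) else 0)"
  have "(\<Sum>q<r. ?d q *\<^sub>R simple q) = ?x - ip ?x (coroot (simple s)) *\<^sub>R simple s"
    using s by (simp add: scaleR_diff_left sum_subtractf if_distrib[of "\<lambda>x. x *\<^sub>R _"] sum.delta
        cong: if_cong)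
  then have "simple_word (s # ps) (simple p) = (\<Sum>q<r. ?d q *\<^sub>R simple q)"
    using c(2) by (simp add: reflect_def)
  then show ?case using c(1) int by (intro exI[of _ ?d]) auto
qed

lemma root_int_combination:
  assumes "a \<in> real_roots"
  obtains c :: "nat \<Rightarrow> real" where "\<forall>q<r. c q \<in> \<int>" "a = (\<Sum>q<r. c q *\<^sub>R simple q)"
proof -
  obtain ps p where "a = simple_word ps (simple p)" "set ps \<subseteq> {..<r}" "p < r"
    using assms by (auto simp: real_roots_def)
  then show ?thesis using that word_int_combination[of ps p] by blast
qed

lemma simple_sum_eq:
  assumes "(\<Sum>q<r. c q *\<^sub>R simple q) = (\<Sum>q<r. d q *\<^sub>R simple q)" "p < r"
  shows "c p = d p"
proof -
  have "(\<Sum>q<r. (c q - d q) *\<^sub>R simple q) = 0"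
    using assms(1) by (simp add: scaleR_diff_left sum_subtractf)
  then have "(\<Sum>v\<in>simple ` {..<r}. (c (inv_into {..<r} simple v) - d (inv_into {..<r} simple v)) *\<^sub>R v) = 0"
    by (simp add: sum.reindex[OF simple_inj] inv_into_f_f[OF simple_inj])
  from independentD[OF simple_independent _ _ this, of "simple p"]
  show ?thesis using assms(2) by (simp add: inv_into_f_f[OF simple_inj])
qed

lemma scaled_simple_root:
  assumes "c *\<^sub>R simple p \<in> real_roots" "p < r"
  shows "c \<in> \<int>"
proof -
  obtain d :: "nat \<Rightarrow> real" where d: "\<forall>q<r. d q \<in> \<int>"
    "c *\<^sub>R simple p = (\<Sum>q<r. d q *\<^sub>R simple q)"
    using root_int_combination[OF assms(1)] by blast
  have "(\<Sum>q<r. (if q = p then c else 0) *\<^sub>R simple q) = c *\<^sub>R simple p"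
    using assms(2) by (simp add: if_distrib[of "\<lambda>x. x *\<^sub>R _"] sum.delta cong: if_cong)
  with d(2) simple_sum_eq[of "\<lambda>q. if q = p then c else 0" d p] assms(2) have "c = d p"
    by simp
  then show ?thesis using d(1) assms(2) by auto
qed

lemma word_root:
  assumes "a \<in> real_roots" "set ps \<subseteq> {..<r}"
  shows "simple_word ps a \<in> real_roots"
proof -
  obtain qs p where "a = simple_word qs (simple p)" "set qs \<subseteq> {..<r}" "p < r"
    using assms(1) by (auto simp: real_roots_def)
  then show ?thesis using assms(2) unfolding real_roots_def
    by (auto intro!: exI[of _ "ps @ qs"] exI[of _ p] simp: refl_prod_append)
qed

lemma scaled_root_int:
  assumes "a \<in> real_roots" "c *\<^sub>R a \<in> real_roots"
  shows "c \<in> \<int>"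
proof -
  obtain ps p where a: "a = simple_word ps (simple p)" "set ps \<subseteq> {..<r}" "p < r"
    using assms(1) by (auto simp: real_roots_def)
  have "simple_word (rev ps) (c *\<^sub>R a) = c *\<^sub>R simple p"
    using a by (simp add: word_rev linear_scale[OF linear_refl_prod])
  moreover have "simple_word (rev ps) (c *\<^sub>R a) \<in> real_roots"
    using word_root[OF assms(2), of "rev ps"] a by simp
  ultimately show ?thesis using scaled_simple_root a(3) by metis
qed

lemma roots_reduced:
  assumes "a \<in> real_roots" "c *\<^sub>R a \<in> real_roots" "0 < c"
  shows "c = 1"
proof -
  have "inverse c \<in> \<int>"
    using scaled_root_int[of "c *\<^sub>R a" "inverse c"] assms by simp
  moreover have "c \<in> \<int>" using scaled_root_int assms by blast
  ultimately obtain m n :: int where mn: "c = of_int m" "inverse c = of_int n"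
    by (metis Ints_cases)
  then have "of_int (m * n) = (1::real)" using assms(3) by (metis less_irrefl of_int_mult right_inverse)
  then have "m * n = 1" by linarith
  moreover have "0 < m" using mn assms(3) by simp
  ultimately show ?thesis using mn by (simp add: pos_zmult_eq_1_iff)
qed

lemma coroot_in_span:
  assumes "a \<in> real_roots"
  shows "coroot a \<in> span ((\<lambda>p. coroot (simple p)) ` {..<r})"
proof -
  let ?C = "(\<lambda>p. coroot (simple p)) ` {..<r}"
  have "simple q \<in> span ?C" if "q < r" for q
  proof -
    have "simple q = (ip (simple q) (simple q) / 2) *\<^sub>R coroot (simple q)"
      using simple_pos[OF that] by (simp add: coroot_def)
    also have "\<dots> \<in> span ?C"
      using that by (intro span_scale span_base) auto
    finally show ?thesis .
  qed
  moreover obtain d :: "nat \<Rightarrow> real" where "a = (\<Sum>q<r. d q *\<^sub>R simple q)"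
    using root_int_combination[OF assms] by blast
  ultimately have "a \<in> span ?C" by (auto intro!: span_sum span_scale)
  then show ?thesis by (simp add: coroot_def span_scale)
qed

lemma coroot_simple_inj: "inj_on (\<lambda>p. coroot (simple p)) {..<r}"
proof (rule inj_onI)
  fix p q assume pq: "p \<in> {..<r}" "q \<in> {..<r}" and eq: "coroot (simple p) = coroot (simple q)"
  let ?e = "\<lambda>p q. if q = p then 2 / ip (simple p) (simple p) else 0"
  have e: "(\<Sum>i<r. ?e p i *\<^sub>R simple i) = coroot (simple p)" if "p < r" for p
    using that by (simp add: coroot_def if_distrib[of "\<lambda>x. x *\<^sub>R _"] sum.delta cong: if_cong)
  have "?e p p = ?e q p"
    using simple_sum_eq[of "?e p" "?e q" p] e eq pq by simp
  then show "p = q" using simple_pos[of p] pq by (auto split: if_splits)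
qed

lemma independent_coroots: "independent ((\<lambda>p. coroot (simple p)) ` {..<r})"
proof (rule independent_if_scalars_zero)
  let ?C = "\<lambda>p. coroot (simple p)"
  fix f x assume 0: "(\<Sum>x\<in>?C ` {..<r}. f x *\<^sub>R x) = 0" and "x \<in> ?C ` {..<r}"
  then obtain p where p: "p < r" "x = ?C p" by auto
  have "(\<Sum>q<r. (f (?C q) * (2 / ip (simple q) (simple q))) *\<^sub>R simple q) = (\<Sum>q<r. 0 *\<^sub>R simple q)"
    using 0 unfolding sum.reindex[OF coroot_simple_inj] by (simp add: coroot_def)
  from simple_sum_eq[OF this p(1)] show "f x = 0" using p simple_pos[of p] by simp
qed simp

text \<open>The numbers \<open>coroot_coeff a q\<close> are the coefficients \<open>c\<^sub>q\<close> of the coroot of \<open>a\<close>.\<close>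

lemma coroot_eq_sum:
  assumes "a \<in> real_roots"
  shows "coroot a = (\<Sum>q<r. coroot_coeff a q *\<^sub>R coroot (simple q))"
proof -
  have "(\<Sum>b\<in>(\<lambda>p. coroot (simple p)) ` {..<r}.
      representation ((\<lambda>p. coroot (simple p)) ` {..<r}) (coroot a) b *\<^sub>R b) = coroot a"
    by (intro real_vector.sum_representation_eq independent_coroots coroot_in_span assms) auto
  then show ?thesis
    by (simp add: sum.reindex[OF coroot_simple_inj] coroot_coeff_def)
qed

lemma pos_root_real: "a \<in> pos_roots \<Longrightarrow> a \<in> real_roots"
  by (simp add: pos_roots_def)

lemma inj_on_chain_vec: "inj_on (chain_vec lam) (chain_index lam)"
proof (rule inj_onI)
  fix i j assume i: "i \<in> chain_index lam" and j: "j \<in> chain_index lam"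
    and eq: "chain_vec lam i = chain_vec lam j"
  obtain a k b m where ij: "i = (a, k)" "j = (b, m)" by (metis surj_pair)
  let ?A = "ip lam (coroot a)" and ?B = "ip lam (coroot b)"
  have ab: "a \<in> real_roots" "b \<in> real_roots" and AB: "0 < ?A" "0 < ?B"
    using i j ij by (auto simp: chain_index_def pos_root_real)
  have c: "coroot_coeff a q = (?A / ?B) * coroot_coeff b q" if "q < r" for q
    using eq that AB by (auto simp: ij field_simps)
  have "coroot a = (?A / ?B) *\<^sub>R coroot b"
  proof -
    have "coroot a = (\<Sum>q<r. coroot_coeff a q *\<^sub>R coroot (simple q))"
      by (rule coroot_eq_sum[OF ab(1)])
    also have "\<dots> = (\<Sum>q<r. (?A / ?B) *\<^sub>R (coroot_coeff b q *\<^sub>R coroot (simple q)))"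
      using c by (intro sum.cong) simp_all
    also have "\<dots> = (?A / ?B) *\<^sub>R coroot b"
      by (subst coroot_eq_sum[OF ab(2)]) (rule scaleR_sum_right[symmetric])
    finally show ?thesis .
  qed
  then have "(ip a a / 2) *\<^sub>R coroot a = (ip a a / 2 * (?A / ?B) * (2 / ip b b)) *\<^sub>R b"
    by (simp add: coroot_def)
  then have a: "a = (ip a a / 2 * (?A / ?B) * (2 / ip b b)) *\<^sub>R b"
    using root_pos[OF ab(1)] by (simp add: coroot_def)
  then have "ip a a / 2 * (?A / ?B) * (2 / ip b b) = 1"
    using roots_reduced[OF ab(2)] ab(1) AB root_pos[OF ab(1)] root_pos[OF ab(2)]
    by (metis divide_pos_pos mult_pos_pos zero_less_numeral)
  with a have "a = b" by (metis scaleR_one)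
  then show "i = j" using eq AB by (simp add: ij)
qed

text \<open>The enumeration of \<open>J\<close> and the defining property of the numbers \<open>n\<^sub>k\<close>.\<close>

lemma index_list_props:
  assumes "finite J" "J \<subseteq> chain_index lam"
  shows "set (index_list lam J) = J" "length (index_list lam J) = card J"
    "sorted_wrt (\<lambda>i j. chain_vec lam i < chain_vec lam j) (index_list lam J)"
proof -
  have inj: "inj_on (chain_vec lam) J"
    using inj_on_chain_vec assms(2) by (rule inj_on_subset)
  note p = sorted_key_list_of_set_props[OF inj assms(1), folded index_list_def]
  show "set (index_list lam J) = J" "length (index_list lam J) = card J" by (rule p)+
  show "sorted_wrt (\<lambda>i j. chain_vec lam i < chain_vec lam j) (index_list lam J)"
    using p(3) unfolding sorted_wrt_map .
qed

lemma chain_t_mono: "chain_vec lam i < chain_vec lam j \<Longrightarrow> chain_t lam i \<le> chain_t lam j"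
  by (cases i; cases j) (auto simp only: list_less_def chain_vec.simps chain_t.simps list.map
      lexord_cons_cons mem_Collect_eq prod.case order_less_imp_le order_refl)

lemma block_end_iff:
  assumes J: "finite J" "J \<subseteq> chain_index lam"
    and k: "k < length (jumps lam J)" and h: "0 < h" "h \<le> card J"
  shows "chain_t lam (index_list lam J ! (h - 1)) = jumps lam J ! k \<longleftrightarrow>
    block_end lam J k < h \<and> h \<le> block_end lam J (Suc k)"
proof -
  define js as where "js = index_list lam J" and "as = jumps lam J"
  let ?t = "chain_t lam"
  note e = index_list_props[OF J, folded js_def]
  have set_as: "set as = insert 0 (?t ` J)"
    unfolding as_def jumps_def using J(1) by (intro set_sorted_list_of_set) simp
  have as: "sorted_wrt (<) as"
    unfolding as_def jumps_def by (rule strict_sorted_list_of_set)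
  have "sorted_wrt (\<lambda>i j. ?t i \<le> ?t j) js"
    by (rule sorted_wrt_mono_rel[OF _ e(3)]) (auto simp: chain_t_mono)
  then have mono: "?t (js ! x) \<le> ?t (js ! y)" if "x \<le> y" "y < length js" for x y
    using that by (cases "x = y") (auto simp: sorted_wrt_iff_nth_less)
  have "sorted_wrt (\<noteq>) js"
    by (rule sorted_wrt_mono_rel[OF _ e(3)]) auto
  then have dist: "distinct js"
    unfolding sorted_wrt_iff_nth_less distinct_conv_nth by (metis linorder_neqE_nat)
  have cnt: "h \<le> card {j \<in> J. ?t j \<le> x} \<longleftrightarrow> ?t (js ! (h - 1)) \<le> x" for x
  proof -
    have eq: "{j \<in> J. ?t j \<le> x} = (!) js ` {i. i < length js \<and> ?t (js ! i) \<le> x}"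
    proof (intro equalityI subsetI)
      fix j assume j: "j \<in> {j \<in> J. ?t j \<le> x}"
      then obtain i where "i < length js" "j = js ! i" using e(1) by (metis (lifting) in_set_conv_nth mem_Collect_eq)
      then show "j \<in> (!) js ` {i. i < length js \<and> ?t (js ! i) \<le> x}" using j by blast
    next
      fix j assume "j \<in> (!) js ` {i. i < length js \<and> ?t (js ! i) \<le> x}"
      then show "j \<in> {j \<in> J. ?t j \<le> x}" using e(1) by (auto simp: nth_mem)
    qed
    have card: "card {j \<in> J. ?t j \<le> x} = card {i. i < length js \<and> ?t (js ! i) \<le> x}"
      unfolding eq using dist by (intro card_image) (auto simp: inj_on_def nth_eq_iff_index_eq)
    show ?thesis
    proof
      assume "?t (js ! (h - 1)) \<le> x"
      then have "{..<h} \<subseteq> {i. i < length js \<and> ?t (js ! i) \<le> x}"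
      proof (intro subsetI CollectI)
        fix i assume le: "?t (js ! (h - 1)) \<le> x" and "i \<in> {..<h}"
        then have "i \<le> h - 1" "h - 1 < length js" "i < length js" using h e(2) by auto
        then show "i < length js \<and> ?t (js ! i) \<le> x" using mono le order_trans by blast
      qed
      from card_mono[OF _ this] show "h \<le> card {j \<in> J. ?t j \<le> x}" by (simp add: card)
    next
      assume "h \<le> card {j \<in> J. ?t j \<le> x}"
      show "?t (js ! (h - 1)) \<le> x"
      proof (rule ccontr)
        assume n: "\<not> ?t (js ! (h - 1)) \<le> x"
        have "{i. i < length js \<and> ?t (js ! i) \<le> x} \<subseteq> {..<h - 1}"
        proof
          fix i assume i: "i \<in> {i. i < length js \<and> ?t (js ! i) \<le> x}"
          have "i < h - 1"
          proof (rule ccontr)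
            assume "\<not> i < h - 1"
            then have "?t (js ! (h - 1)) \<le> ?t (js ! i)" using mono[of "h - 1" i] i by simp
            then show False using i n by simp
          qed
          then show "i \<in> {..<h - 1}" by simp
        qed
        from card_mono[OF _ this] have "card {j \<in> J. ?t j \<le> x} \<le> h - 1" by (simp add: card)
        then show False using \<open>h \<le> card {j \<in> J. ?t j \<le> x}\<close> h by simp
      qed
    qed
  qed
  have "js ! (h - 1) \<in> J" using h e(1,2) by (metis One_nat_def Suc_le_eq Suc_pred nth_mem)
  then have "?t (js ! (h - 1)) \<in> set as" using set_as by auto
  then obtain m where m: "m < length as" "?t (js ! (h - 1)) = as ! m" by (metis in_set_conv_nth)
  have lt: "as ! x < as ! y \<longleftrightarrow> x < y" if "x < length as" "y < length as" for x y
    using as that by (metis linorder_neqE_nat order_less_asym sorted_wrt_iff_nth_less less_irrefl)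
  have "?t (js ! (h - 1)) = as ! k \<longleftrightarrow> m = k"
    using m lt[of m k] lt[of k m] k by (auto simp: as_def[symmetric])
  moreover have "h \<le> block_end lam J (Suc k) \<longleftrightarrow> m \<le> k"
    using cnt[of "as ! k"] m lt[of k m] k by (simp add: as_def[symmetric]) linarith
  moreover have "block_end lam J k < h \<longleftrightarrow> k \<le> m"
  proof (cases k)
    case (Suc k')
    then show ?thesis
      using cnt[of "as ! k'"] m lt[of k' m] k by (simp add: as_def[symmetric]) linarith
  qed (use h in simp)
  ultimately show ?thesis by (auto simp: js_def as_def)
qed

end

end

theory Submission
  imports Defs
begin

text \<open>
  Label an edge \<open>w \<rightarrow> w s\<^sub>\<beta>\<close> of the Bruhat graph by \<open>\<beta>\<close>. An admissible subset is a saturated path from the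
  identity, cut into blocks of constant \<open>t\<close>, whose labels increase inside a block; an LS chain only
  records the images in the orbit of the ends of the blocks. The theorem therefore amounts to the
  statement that, from a minimal coset representative, every chain in the \<open>t\<close>-Bruhat order lifts to
  exactly one increasing saturated path whose labels pair integrally with \<open>t lam\<close>.

  Multiplication by a simple reflection on the left does not change labels, and both halves are
  proved by such a translation, by induction on the length of the endpoint. For uniqueness one
  watches the pulled back simple root \<open>w\<^sup>-\<^sup>1 \<alpha>\<^sub>p\<close> along an increasing path: only one edge with this
  label can be inserted or removed. For existence, the orbit chain is lifted to a path, which is then
  sorted by exchanging decreasing pairs of adjacent labels; the exchange stays inside the rank two
  subsystem of the pair and so preserves integrality.
\<close>

text \<open>The Weyl group may be infinite: there is then no longest element, and two roots may
  generate an infinite dihedral group. Hence the inductions run on the length of an endpoint,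
  sorting relies on the finiteness of inversion sets, and no list of rank two systems appears.
  Translation by \<open>s_p\<close> has one obstruction, an edge from \<open>w\<close> to
  \<open>w s_a\<close> with \<open>w a\<close> equal to the simple root: there \<open>s_p\<close>
  swaps the two ends and the edge turns downwards. The arguments locate such edges, and the lengths
  at both ends of a path decide whether one must occur. The integer \<open>k\<close> of an index is
  determined by the root and \<open>t\<close>, so inside a block only the labels matter. Labels are
  compared through an alternating form rather than by quotients because the pulled back root may be
  negative or orthogonal to \<open>lam\<close>. Minimal representatives provide one vertex over each
  orbit point: saturated paths with labels not orthogonal to \<open>lam\<close> stay among them, and
  an exchange of labels then cannot produce an orthogonal one.\<close>

context kac_moody_roots
begin

subsection \<open>The Weyl group and its length function\<close>

lemma weyl_word:
  assumes "w \<in> weyl"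
  obtains ps where "set ps \<subseteq> {..<r}" "w = simple_word ps"
  using assms unfolding weyl_eq_words by auto

lemma word_in_weyl: "set ps \<subseteq> {..<r} \<Longrightarrow> simple_word ps \<in> weyl"
  unfolding weyl_eq_words by auto

lemma weyl_linear: "w \<in> weyl \<Longrightarrow> linear w"
  by (metis weyl_word linear_refl_prod)

lemma weyl_minus: "w \<in> weyl \<Longrightarrow> w (- x) = - w x"
  by (simp add: weyl_linear linear_neg)

lemma weyl_isometry: "w \<in> weyl \<Longrightarrow> ip (w u) (w v) = ip u v"
  by (metis weyl_word word_isometry)

lemma weyl_comp: "w \<in> weyl \<Longrightarrow> w' \<in> weyl \<Longrightarrow> w \<circ> w' \<in> weyl"
proof -
  assume "w \<in> weyl" "w' \<in> weyl"
  then obtain ps qs where "set ps \<subseteq> {..<r}" "w = simple_word ps" "set qs \<subseteq> {..<r}"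
    "w' = simple_word qs" by (metis weyl_word)
  then have "w \<circ> w' = simple_word (ps @ qs)" "set (ps @ qs) \<subseteq> {..<r}"
    by (auto simp: refl_prod_append)
  then show ?thesis by (metis word_in_weyl)
qed

lemma inv_word:
  assumes "set ps \<subseteq> {..<r}"
  shows "inv (simple_word ps) = simple_word (rev ps)"
  by (rule inv_equality) (use assms in \<open>auto simp: word_rev word_rev'\<close>)

lemma weyl_inv: "w \<in> weyl \<Longrightarrow> inv w \<in> weyl"
  by (metis weyl_word inv_word word_in_weyl set_rev)

lemma weyl_inv_left [simp]: "w \<in> weyl \<Longrightarrow> inv w (w x) = x"
  by (metis weyl_word inv_word word_rev)

lemma weyl_inv_right [simp]: "w \<in> weyl \<Longrightarrow> w (inv w x) = x"
  by (metis weyl_word inv_word word_rev')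

lemma weyl_inv_inv: "w \<in> weyl \<Longrightarrow> inv (inv w) = w"
  by (rule inv_equality) auto

lemma weyl_ip_inv: "w \<in> weyl \<Longrightarrow> ip (w u) v = ip u (inv w v)"
  by (metis weyl_inv_right weyl_isometry)

lemma weyl_inv_comp: "w \<in> weyl \<Longrightarrow> w' \<in> weyl \<Longrightarrow> inv (w \<circ> w') = inv w' \<circ> inv w"
  by (rule inv_equality) auto

lemma weyl_root: "w \<in> weyl \<Longrightarrow> a \<in> real_roots \<Longrightarrow> w a \<in> real_roots"
  by (metis weyl_word word_root)

lemma simple_real_root: "p < r \<Longrightarrow> simple p \<in> real_roots"
  by (auto simp: real_roots_def intro!: exI[of _ "[]"] exI[of _ p])

lemma simple_pos_root: "p < r \<Longrightarrow> simple p \<in> pos_roots"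
proof -
  assume p: "p < r"
  have "(\<Sum>q<r. (if q = p then 1 else 0) *\<^sub>R simple q) = simple p"
    using p by (simp add: if_distrib[of "\<lambda>x. x *\<^sub>R _"] sum.delta cong: if_cong)
  then show ?thesis
    using simple_real_root[OF p] unfolding pos_roots_def
    by (auto intro!: exI[of _ "\<lambda>q. if q = p then 1 else 0"])
qed

lemma uminus_root: "a \<in> real_roots \<Longrightarrow> - a \<in> real_roots"
  using roots_decomp(1) by force

lemma root_cases:
  assumes "a \<in> real_roots"
  obtains "a \<in> pos_roots" | "- a \<in> pos_roots"
  using assms roots_decomp(1) by force

lemma not_pos_neg: "a \<in> pos_roots \<Longrightarrow> - a \<notin> pos_roots"
  using roots_decomp(2) by force

lemma root_ip_neq: "a \<in> real_roots \<Longrightarrow> ip a a \<noteq> 0"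
  using root_pos by force

lemma root_neq_0: "a \<in> real_roots \<Longrightarrow> a \<noteq> 0"
  using root_pos by force

lemma reflect_self: "ip a a \<noteq> 0 \<Longrightarrow> reflect a a = - a"
  by (simp add: reflect_def ip_coroot scaleR_2)

lemma reflect_uminus: "reflect (- a) = reflect a"
  by (rule ext) (simp add: reflect_def ip_coroot)

lemma reflect_weyl: "a \<in> real_roots \<Longrightarrow> reflect a \<in> weyl"
  using weyl.weyl_refl[OF weyl.weyl_id] by simp

lemma reflect_reflect_root: "a \<in> real_roots \<Longrightarrow> reflect a (reflect a x) = x"
  by (simp add: refl_refl root_ip_neq)

lemma reflect_comp_self: "a \<in> real_roots \<Longrightarrow> reflect a \<circ> reflect a = id"
  by (rule ext) (simp add: reflect_reflect_root)

lemma inv_reflect: "a \<in> real_roots \<Longrightarrow> inv (reflect a) = reflect a"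
  by (rule inv_equality) (simp_all add: reflect_reflect_root)

lemma reflect_conj:
  assumes "w \<in> weyl"
  shows "reflect (w a) = w \<circ> reflect a \<circ> inv w"
proof -
  obtain ps where "set ps \<subseteq> {..<r}" "w = simple_word ps" using weyl_word assms by blast
  then show ?thesis by (simp add: refl_word inv_word)
qed

lemma reflect_conj_comp: "w \<in> weyl \<Longrightarrow> reflect (w a) \<circ> w = w \<circ> reflect a"
  by (rule ext) (simp add: reflect_conj)

lemma reflect_minus: "reflect a (- x) = - reflect a x"
  by (simp add: linear_refl linear_neg)

lemma refl_prod_weyl: "set as \<subseteq> real_roots \<Longrightarrow> refl_prod as \<in> weyl"
proof (induction as)
  case Nil
  show ?case unfolding refl_prod_Nil by (rule weyl.weyl_id)
next
  case (Cons a as)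
  then show ?case by (simp del: o_apply add: weyl_comp reflect_weyl)
qed

text \<open>The reflection changes only the coefficient of \<open>simple p\<close>. If the image
  were negative, every other coefficient of \<open>a\<close> would be both nonnegative and
  nonpositive, so \<open>a\<close> would be a multiple of \<open>simple p\<close>, and reducedness
  forces equality.\<close>

lemma simple_reflect_pos:
  assumes "p < r" "a \<in> pos_roots" "a \<noteq> simple p"
  shows "reflect (simple p) a \<in> pos_roots"
proof (rule ccontr)
  assume "\<not> ?thesis"
  moreover have root: "a \<in> real_roots" using assms(2) by (rule pos_root_real)
  ultimately have "- reflect (simple p) a \<in> pos_roots"
    using root_cases weyl_root[OF reflect_weyl[OF simple_real_root[OF assms(1)]]] by metis
  then obtain e where e: "\<forall>q<r. 0 \<le> e q" "- reflect (simple p) a = (\<Sum>q<r. e q *\<^sub>R simple q)"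
    unfolding pos_roots_def by auto
  obtain c where c: "\<forall>q<r. 0 \<le> c q" "a = (\<Sum>q<r. c q *\<^sub>R simple q)"
    using assms(2) unfolding pos_roots_def by auto
  let ?k = "ip a (coroot (simple p))"
  have "(\<Sum>q<r. (c q - (if q = p then ?k else 0)) *\<^sub>R simple q) = a - ?k *\<^sub>R simple p"
    using assms(1) c(2) by (simp add: scaleR_diff_left sum_subtractf
        if_distrib[of "\<lambda>x. x *\<^sub>R _"] sum.delta cong: if_cong)
  also have "\<dots> = (\<Sum>q<r. (- e q) *\<^sub>R simple q)"
    using e(2) by (simp add: reflect_def sum_negf) (metis minus_diff_eq minus_minus)
  finally have eq: "c q - (if q = p then ?k else 0) = - e q" if "q < r" for q
    using simple_sum_eq[of "\<lambda>q. c q - (if q = p then ?k else 0)" "\<lambda>q. - e q" q] that by simp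
  have zero: "c q = 0" if "q < r" "q \<noteq> p" for q
    using eq[of q] that c(1) e(1) by (simp, metis neg_0_le_iff_le order_antisym)
  have "a = (\<Sum>q<r. (if q = p then c p else 0) *\<^sub>R simple q)"
    unfolding c(2) by (intro sum.cong) (auto simp: zero)
  also have "\<dots> = c p *\<^sub>R simple p"
    using assms(1) by (simp add: if_distrib[of "\<lambda>x. x *\<^sub>R _"] sum.delta cong: if_cong)
  finally have a: "a = c p *\<^sub>R simple p" .
  then have "c p \<noteq> 0" using root_neq_0[OF root] by auto
  then have "c p = 1"
    using roots_reduced[OF simple_real_root[OF assms(1)], of "c p"] root a c(1) assms(1)
    by (metis order_le_less)
  with a assms(3) show False by simp
qed

section \<open>Length and inversions in the Weyl group\<close>

lemma weyl_length_le: "set ps \<subseteq> {..<r} \<Longrightarrow> weyl_length (simple_word ps) \<le> length ps"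
  unfolding weyl_length_def by (rule Least_le) auto

lemma reduced_word:
  assumes "w \<in> weyl"
  obtains ps where "set ps \<subseteq> {..<r}" "w = simple_word ps" "length ps = weyl_length w"
proof -
  have "\<exists>n ps. length ps = n \<and> set ps \<subseteq> {..<r} \<and> w = simple_word ps"
    using weyl_word[OF assms] by metis
  from LeastI_ex[OF this] show ?thesis using that unfolding weyl_length_def by auto
qed

text \<open>The strong exchange condition, reduced to a bound on word length. Some letter turns the
  image of \<open>a\<close> from positive to negative; just before it the image is the simple root
  of that letter, which therefore cancels against \<open>reflect a\<close>.\<close>

lemma word_exchange:
  assumes "set ps \<subseteq> {..<r}" "a \<in> pos_roots" "- simple_word ps a \<in> pos_roots"
  shows "\<exists>qs. set qs \<subseteq> {..<r} \<and> length qs < length ps \<and> simple_word ps \<circ> reflect a = simple_word qs"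
  using assms(1,3)
proof (induction ps)
  case Nil
  then show ?case using not_pos_neg assms(2) by simp
next
  case (Cons p ps)
  let ?y = "simple_word ps a"
  have p: "p < r" and ps: "set ps \<subseteq> {..<r}" using Cons by auto
  have y: "?y \<in> real_roots" using word_root[OF pos_root_real[OF assms(2)] ps] .
  show ?case
  proof (cases "?y \<in> pos_roots")
    case True
    with Cons.prems(2) simple_reflect_pos[OF p True] not_pos_neg have "?y = simple p"
      by auto
    then have "reflect (simple p) \<circ> simple_word ps = simple_word ps \<circ> reflect a"
      using reflect_conj_comp[OF word_in_weyl[OF ps], of a] by simp
    then have "simple_word (p # ps) \<circ> reflect a = simple_word ps \<circ> (reflect a \<circ> reflect a)"
      by (simp add: comp_assoc)
    then have "simple_word (p # ps) \<circ> reflect a = simple_word ps"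
      using reflect_comp_self[OF pos_root_real[OF assms(2)]] by simp
    moreover have "length ps < length (p # ps)" by simp
    ultimately show ?thesis using ps by blast
  next
    case False
    then have "- ?y \<in> pos_roots" using y root_cases by blast
    from Cons.IH[OF ps this] obtain qs where "set qs \<subseteq> {..<r}" "length qs < length ps"
      "simple_word ps \<circ> reflect a = simple_word qs" by blast
    then have "simple_word (p # ps) \<circ> reflect a = simple_word (p # qs)"
      by (auto simp: fun_eq_iff)
    moreover have "set (p # qs) \<subseteq> {..<r}" "length (p # qs) < length (p # ps)"
      using p \<open>set qs \<subseteq> {..<r}\<close> \<open>length qs < length ps\<close> by auto
    ultimately show ?thesis by blast
  qed
qed

lemma length_reflect_less:
  assumes "w \<in> weyl" "a \<in> pos_roots" "- w a \<in> pos_roots"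
  shows "weyl_length (w \<circ> reflect a) < weyl_length w"
proof -
  obtain ps where ps: "set ps \<subseteq> {..<r}" "w = simple_word ps" "length ps = weyl_length w"
    using reduced_word[OF assms(1)] .
  then show ?thesis using word_exchange[OF ps(1) assms(2)] assms(3) weyl_length_le
    by (metis order_le_less_trans)
qed

lemma weyl_comp_reflect: "w \<in> weyl \<Longrightarrow> a \<in> pos_roots \<Longrightarrow> w \<circ> reflect a \<in> weyl"
  by (simp add: weyl.weyl_refl pos_root_real)

lemma length_reflect_greater:
  assumes "w \<in> weyl" "a \<in> pos_roots" "w a \<in> pos_roots"
  shows "weyl_length w < weyl_length (w \<circ> reflect a)"
proof -
  have a: "a \<in> real_roots" using assms(2) by (rule pos_root_real)
  have "- (w \<circ> reflect a) a \<in> pos_roots"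
    using assms a by (simp add: reflect_self root_ip_neq weyl_minus)
  from length_reflect_less[OF weyl_comp_reflect[OF assms(1,2)] assms(2) this]
  show ?thesis by (simp only: comp_assoc reflect_comp_self[OF a] comp_id)
qed

lemma weyl_image_pos:
  assumes "w \<in> weyl" "a \<in> pos_roots" "weyl_length w < weyl_length (w \<circ> reflect a)"
  shows "w a \<in> pos_roots"
  using root_cases[OF weyl_root[OF assms(1) pos_root_real[OF assms(2)]]]
    length_reflect_less[OF assms(1,2)] assms(3) by force

text \<open>The sign of the root \<open>w\<^sup>-\<^sup>1 \<alpha>\<^sub>p\<close> tells whether \<open>s\<^sub>p w\<close> is longer or shorter than \<open>w\<close>.\<close>

definition pull :: "nat \<Rightarrow> ('v \<Rightarrow> 'v) \<Rightarrow> 'v" where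
  "pull p w = inv w (simple p)"

abbreviation srefl :: "nat \<Rightarrow> 'v \<Rightarrow> 'v" where
  "srefl p \<equiv> reflect (simple p)"

lemma srefl_weyl: "p < r \<Longrightarrow> srefl p \<in> weyl"
  by (simp add: reflect_weyl simple_real_root)

lemma srefl_comp_weyl: "p < r \<Longrightarrow> w \<in> weyl \<Longrightarrow> srefl p \<circ> w \<in> weyl"
  by (simp add: weyl_comp srefl_weyl)

lemma srefl_srefl: "p < r \<Longrightarrow> srefl p \<circ> (srefl p \<circ> w) = w"
  by (rule ext) (simp add: reflect_reflect_root simple_real_root)

lemma pull_root: "p < r \<Longrightarrow> w \<in> weyl \<Longrightarrow> pull p w \<in> real_roots"
  by (simp add: pull_def weyl_root weyl_inv simple_real_root)

lemma weyl_pull: "w \<in> weyl \<Longrightarrow> w (pull p w) = simple p"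
  by (simp add: pull_def)

lemma pull_eq_iff: "w \<in> weyl \<Longrightarrow> pull p w = a \<longleftrightarrow> w a = simple p"
  unfolding pull_def by (metis weyl_inv_left weyl_inv_right)

lemma pull_reflect:
  "w \<in> weyl \<Longrightarrow> a \<in> real_roots \<Longrightarrow> pull p (w \<circ> reflect a) = reflect a (pull p w)"
  by (simp add: pull_def weyl_inv_comp reflect_weyl inv_reflect)

lemma pull_srefl: "p < r \<Longrightarrow> w \<in> weyl \<Longrightarrow> pull p (srefl p \<circ> w) = - pull p w"
  by (simp add: pull_def weyl_inv_comp srefl_weyl inv_reflect simple_real_root reflect_self
      root_ip_neq weyl_minus weyl_inv)

text \<open>Left multiplication by a simple reflection is itself an edge of the Bruhat graph, with
  label \<open>pull p w\<close>. Such edges are called \<open>srefl p\<close> edges in the comments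
  below.\<close>

lemma srefl_comp: "w \<in> weyl \<Longrightarrow> srefl p \<circ> w = w \<circ> reflect (pull p w)"
  using reflect_conj_comp[of w "pull p w"] by (simp add: weyl_pull)

lemma length_srefl_le:
  assumes "p < r" "w \<in> weyl"
  shows "weyl_length (srefl p \<circ> w) \<le> weyl_length w + 1"
proof -
  obtain ps where ps: "set ps \<subseteq> {..<r}" "w = simple_word ps" "length ps = weyl_length w"
    using reduced_word[OF assms(2)] .
  then have "srefl p \<circ> w = simple_word (p # ps)" by simp
  then show ?thesis using weyl_length_le[of "p # ps"] ps assms(1) by simp
qed

lemma length_srefl_up:
  assumes "p < r" "w \<in> weyl" "pull p w \<in> pos_roots"
  shows "weyl_length (srefl p \<circ> w) = weyl_length w + 1"
proof -
  have "weyl_length w < weyl_length (srefl p \<circ> w)"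
    using length_reflect_greater[OF assms(2,3)] assms
    by (simp add: weyl_pull simple_pos_root srefl_comp)
  then show ?thesis using length_srefl_le[OF assms(1,2)] by simp
qed

lemma length_srefl_down:
  assumes "p < r" "w \<in> weyl" "- pull p w \<in> pos_roots"
  shows "weyl_length w = weyl_length (srefl p \<circ> w) + 1"
  using length_srefl_up[OF assms(1) srefl_comp_weyl[OF assms(1,2)]] assms
  by (simp only: pull_srefl srefl_srefl)

lemma left_descent:
  assumes "w \<in> weyl" "w \<noteq> id"
  obtains p where "p < r" "- pull p w \<in> pos_roots"
proof -
  obtain ps where ps: "set ps \<subseteq> {..<r}" "w = simple_word ps" "length ps = weyl_length w"
    using reduced_word[OF assms(1)] .
  with assms(2) obtain p qs where [simp]: "ps = p # qs" by (cases ps) auto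
  have p: "p < r" and qs: "set qs \<subseteq> {..<r}" using ps by auto
  have "srefl p \<circ> w = simple_word qs"
    using srefl_srefl[OF p] ps(2) by simp
  then have "weyl_length (srefl p \<circ> w) < weyl_length w"
    using weyl_length_le[OF qs] ps(3) by simp
  then have "pull p w \<notin> pos_roots" using length_srefl_up[OF p assms(1)] by auto
  then show ?thesis using that p root_cases pull_root assms(1) by metis
qed

lemma right_descent:
  assumes "w \<in> weyl" "w \<noteq> id"
  obtains p where "p < r" "- w (simple p) \<in> pos_roots"
proof -
  have "inv w \<noteq> id" using assms by (metis weyl_inv_inv inv_id)
  from left_descent[OF weyl_inv[OF assms(1)] this] show ?thesis
    using that assms(1) by (auto simp: pull_def weyl_inv_inv)
qed

lemma proportional_pos_roots:
  assumes "a \<in> pos_roots" "b \<in> pos_roots" "a = c *\<^sub>R b"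
  shows "a = b"
proof -
  have a: "a \<in> real_roots" and b: "b \<in> real_roots" using assms by (simp_all add: pos_root_real)
  have "c \<noteq> 0" using root_neq_0[OF a] assms(3) by auto
  then consider "0 < c" | "0 < - c" by linarith
  then show ?thesis
  proof cases
    case 1
    then have "c = 1" using roots_reduced[OF b] a assms(3) by blast
    then show ?thesis using assms(3) by simp
  next
    case 2
    have "(- c) *\<^sub>R b = - a" using assms(3) by simp
    then have "- c = 1" using roots_reduced[OF b] uminus_root[OF a] 2 by metis
    then have "c = - 1" by simp
    then have "a = - b" using assms(3) by simp
    then show ?thesis using assms(1,2) not_pos_neg by auto
  qed
qed

lemma reflect_inj:
  assumes "a \<in> pos_roots" "b \<in> pos_roots" "reflect a = reflect b"
  shows "a = b"
proof -
  have ab: "a \<in> real_roots" "b \<in> real_roots" using assms by (simp_all add: pos_root_real)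
  have "reflect b a = - a" using assms(3) reflect_self[OF root_ip_neq[OF ab(1)]] by simp
  then have "2 *\<^sub>R a = ip a (coroot b) *\<^sub>R b"
    by (simp add: reflect_def scaleR_2 algebra_simps)
  then have "(1/2) *\<^sub>R (2 *\<^sub>R a) = (1/2) *\<^sub>R ip a (coroot b) *\<^sub>R b" by simp
  then have a: "a = (ip a (coroot b) / 2) *\<^sub>R b" by simp
  show ?thesis by (rule proportional_pos_roots[OF assms(1,2) a])
qed

end

locale dominant_data = kac_moody_roots +
  fixes lam :: 'a
  assumes dominant: "lam \<in> dominant_weights"
begin

subsection \<open>The order on positive roots\<close>

definition lexpos :: "(nat \<Rightarrow> real) \<Rightarrow> bool" where
  "lexpos f \<longleftrightarrow> (\<exists>q<r. 0 < f q \<and> (\<forall>p<q. f p = 0))"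

lemma lexpos_cong: "(\<And>q. q < r \<Longrightarrow> f q = g q) \<Longrightarrow> lexpos f \<longleftrightarrow> lexpos g"
  unfolding lexpos_def by (metis order.strict_trans)

text \<open>For positive \<open>x\<close> the leading position of the sum is the smaller of the two.
  The case \<open>x = 0\<close> is included because in \<open>lt_trans\<close> this weight is the
  pairing of \<open>lam\<close> with a root that may be orthogonal to it.\<close>

lemma lexpos_combine:
  assumes "lexpos f" "lexpos g" "0 \<le> x" "0 < y"
  shows "lexpos (\<lambda>q. x * f q + y * g q)"
proof -
  obtain m where m: "m < r" "0 < f m" "\<forall>p<m. f p = 0" using assms(1) lexpos_def by auto
  obtain n where n: "n < r" "0 < g n" "\<forall>p<n. g p = 0" using assms(2) lexpos_def by auto
  consider "x = 0" | "0 < x" "m < n" | "0 < x" "n < m" | "0 < x" "n = m" using assms(3) by fastforce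
  then show ?thesis
  proof cases
    case 1
    then show ?thesis unfolding lexpos_def using n assms(4) by auto
  next
    case 2
    then show ?thesis unfolding lexpos_def using m n by (intro exI[of _ m]) auto
  next
    case 3
    then show ?thesis unfolding lexpos_def using m n assms(4) by (intro exI[of _ n]) auto
  next
    case 4
    then show ?thesis unfolding lexpos_def using m n assms(4)
      by (intro exI[of _ n]) (auto intro: add_pos_pos)
  qed
qed

lemma lexpos_asym: "lexpos f \<Longrightarrow> \<not> lexpos (\<lambda>q. - f q)"
  unfolding lexpos_def
  by (metis less_irrefl linorder_neqE_nat neg_0_less_iff_less neg_equal_0_iff_equal order_less_asym)

lemma lexpos_cases:
  assumes "\<not> lexpos f" "\<not> lexpos (\<lambda>q. - f q)" "q < r"
  shows "f q = 0"
proof (rule ccontr)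
  assume "f q \<noteq> 0"
  define m where "m = (LEAST q. f q \<noteq> 0)"
  have m: "f m \<noteq> 0" "\<forall>p<m. f p = 0" "m \<le> q"
    using \<open>f q \<noteq> 0\<close> LeastI[of "\<lambda>q. f q \<noteq> 0"] not_less_Least Least_le[of "\<lambda>q. f q \<noteq> 0"]
    unfolding m_def by blast+
  then have "m < r" using assms(3) by simp
  then show False using m assms(1,2) unfolding lexpos_def
    by (metis linorder_neqE_linordered_idom neg_0_less_iff_less neg_equal_0_iff_equal)
qed

text \<open>Coordinates of the root itself in the basis of simple coroots. A root is a positive
  multiple of its coroot and the factor cancels in \<open>coord a q / ip lam a\<close>, so the
  comparison is that of the coroot coefficients, while \<open>coord\<close> is linear and thus easy
  to follow under reflections.\<close>

definition coord :: "'a \<Rightarrow> nat \<Rightarrow> real" where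
  "coord v q = representation ((\<lambda>p. coroot (simple p)) ` {..<r}) v (coroot (simple q))"

lemma root_span:
  assumes "a \<in> real_roots"
  shows "a \<in> span ((\<lambda>p. coroot (simple p)) ` {..<r})"
proof -
  have "a = (ip a a / 2) *\<^sub>R coroot a" using root_ip_neq[OF assms] by (simp add: coroot_def)
  then show ?thesis by (metis coroot_in_span[OF assms] span_scale)
qed

lemma coord_scale: "a \<in> real_roots \<Longrightarrow> coord (c *\<^sub>R a) q = c * coord a q"
  unfolding coord_def by (simp add: representation_scale independent_coroots root_span)

lemma coord_uminus: "a \<in> real_roots \<Longrightarrow> coord (- a) q = - coord a q"
  using coord_scale[of a "-1" q] by simp

lemma coord_diff_scale:
  "a \<in> real_roots \<Longrightarrow> b \<in> real_roots \<Longrightarrow> coord (a - c *\<^sub>R b) q = coord a q - c * coord b q"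
  unfolding coord_def
  by (simp add: representation_diff representation_scale independent_coroots root_span span_scale)

lemma coord_coroot: "a \<in> real_roots \<Longrightarrow> coroot_coeff a q = 2 / ip a a * coord a q"
  unfolding coroot_coeff_def coord_def[symmetric] by (simp add: coroot_def coord_scale)

lemma root_eq_coord_sum:
  assumes "a \<in> real_roots"
  shows "a = (\<Sum>q<r. coord a q *\<^sub>R coroot (simple q))"
proof -
  have "(\<Sum>b\<in>(\<lambda>p. coroot (simple p)) ` {..<r}.
      representation ((\<lambda>p. coroot (simple p)) ` {..<r}) a b *\<^sub>R b) = a"
    by (intro real_vector.sum_representation_eq independent_coroots root_span assms) auto
  then show ?thesis
    by (simp add: sum.reindex[OF coroot_simple_inj] coord_def)
qed

lemma coord_pos_root:
  assumes "a \<in> pos_roots"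
  shows "\<forall>q<r. 0 \<le> coord a q" "\<exists>q<r. 0 < coord a q"
proof -
  have root: "a \<in> real_roots" using assms by (rule pos_root_real)
  obtain c where c: "\<forall>q<r. 0 \<le> c q" "a = (\<Sum>q<r. c q *\<^sub>R simple q)"
    using assms unfolding pos_roots_def by auto
  have "(\<Sum>q<r. (coord a q * (2 / ip (simple q) (simple q))) *\<^sub>R simple q) = a"
    by (subst (2) root_eq_coord_sum[OF root]) (simp add: coroot_def)
  then have eq: "coord a q * (2 / ip (simple q) (simple q)) = c q" if "q < r" for q
    using c(2) simple_sum_eq[of "\<lambda>q. coord a q * (2 / ip (simple q) (simple q))" c q] that by simp
  show nonneg: "\<forall>q<r. 0 \<le> coord a q"
  proof (intro allI impI)
    fix q assume q: "q < r"
    have "coord a q = c q * ip (simple q) (simple q) / 2"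
      using simple_pos[OF q] by (simp add: eq[OF q, symmetric])
    moreover have "0 \<le> c q * ip (simple q) (simple q)" using simple_pos[OF q] c(1) q by simp
    ultimately show "0 \<le> coord a q" by linarith
  qed
  show "\<exists>q<r. 0 < coord a q"
  proof (rule ccontr)
    assume "\<not> ?thesis"
    then have "coord a q = 0" if "q < r" for q using nonneg that by force
    then have "a = 0" using root_eq_coord_sum[OF root] by simp
    then show False using root_neq_0[OF root] by simp
  qed
qed

text \<open>
  On roots with positive pairing, \<open>lt a b\<close> compares the vectors \<open>coord a / ip lam a\<close> and
  \<open>coord b / ip lam b\<close> lexicographically. Clearing denominators makes the comparison the sign of an
  alternating bilinear form, which is invariant under \<open>reflect a\<close> in its second argument, and puts
  the roots orthogonal to \<open>lam\<close> at the end.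
\<close>

definition cross :: "'a \<Rightarrow> 'a \<Rightarrow> nat \<Rightarrow> real" where
  "cross a b q = ip lam a * coord b q - ip lam b * coord a q"

definition lt :: "'a \<Rightarrow> 'a \<Rightarrow> bool" where
  "lt a b \<longleftrightarrow> lexpos (cross a b)"

lemma cross_swap: "cross b a q = - cross a b q"
  by (simp add: cross_def)

lemma cross_uminus_right: "b \<in> real_roots \<Longrightarrow> cross a (- b) q = - cross a b q"
  by (simp add: cross_def coord_uminus)

lemma cross_reflect:
  "a \<in> real_roots \<Longrightarrow> b \<in> real_roots \<Longrightarrow> cross a (reflect a b) q = cross a b q"
  by (simp add: cross_def reflect_def coord_diff_scale algebra_simps)

lemma lt_uminus_right: "a \<in> real_roots \<Longrightarrow> b \<in> real_roots \<Longrightarrow> lt a (- b) \<longleftrightarrow> lt b a"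
  unfolding lt_def by (intro lexpos_cong) (simp add: cross_uminus_right, simp add: cross_def)

lemma lt_uminus_left: "a \<in> real_roots \<Longrightarrow> b \<in> real_roots \<Longrightarrow> lt (- a) b \<longleftrightarrow> lt b a"
  using lt_uminus_right[of b "- a"] uminus_root[of a] by simp

lemma lt_reflect_right: "a \<in> real_roots \<Longrightarrow> b \<in> real_roots \<Longrightarrow> lt a (reflect a b) \<longleftrightarrow> lt a b"
  unfolding lt_def by (intro lexpos_cong) (simp add: cross_reflect)

lemma lt_reflect_left: "a \<in> real_roots \<Longrightarrow> b \<in> real_roots \<Longrightarrow> lt (reflect a b) a \<longleftrightarrow> lt b a"
  unfolding lt_def by (intro lexpos_cong) (metis cross_swap cross_reflect)

lemma lt_irrefl: "\<not> lt a a"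
  by (simp add: lt_def lexpos_def cross_def)

lemma lt_asym: "lt a b \<Longrightarrow> \<not> lt b a"
  using lexpos_asym[of "cross a b"] unfolding lt_def by (simp add: cross_swap[symmetric])

lemma ip_lam_pos_root: "a \<in> pos_roots \<Longrightarrow> 0 \<le> ip lam a"
  using dominant root_pos[OF pos_root_real, of a] unfolding dominant_weights_def
  by (auto simp: ip_coroot zero_le_divide_iff zero_le_mult_iff)

lemma ip_lam_coroot_pos: "a \<in> real_roots \<Longrightarrow> 0 < ip lam (coroot a) \<longleftrightarrow> 0 < ip lam a"
  using root_pos[of a] by (simp add: ip_coroot zero_less_divide_iff)

text \<open>When \<open>ip lam a\<close> vanishes, \<open>cross a b q\<close> equals
  \<open>- ip lam b * coord a q\<close>, which is never positive for positive roots.\<close>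

lemma lt_imp_ip_lam_pos:
  assumes "lt a b" "a \<in> pos_roots" "b \<in> pos_roots"
  shows "0 < ip lam a"
proof (rule ccontr)
  assume "\<not> ?thesis"
  then have "ip lam a = 0" using ip_lam_pos_root[OF assms(2)] by simp
  then have "cross a b q \<le> 0" if "q < r" for q
    using ip_lam_pos_root[OF assms(3)] coord_pos_root(1)[OF assms(2)] that
    by (simp add: cross_def)
  then show False using assms(1) unfolding lt_def lexpos_def by force
qed

text \<open>Rests on the identity \<open>ip lam c * cross a b + ip lam a * cross b c = ip lam b *
  cross a c\<close>; positivity of the roots fixes the signs of the weights. On all roots
  transitivity fails: \<open>lt a b\<close> gives \<open>lt b (- a)\<close>, but
  \<open>lt a (- a)\<close> never holds.\<close>

lemma lt_trans:
  assumes "lt a b" "lt b c" "a \<in> pos_roots" "b \<in> pos_roots" "c \<in> pos_roots"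
  shows "lt a c"
proof -
  have a: "0 < ip lam a" and b: "0 < ip lam b"
    using lt_imp_ip_lam_pos assms by blast+
  have "lexpos (\<lambda>q. ip lam c * cross a b q + ip lam a * cross b c q)"
    using lexpos_combine[OF assms(1,2)[unfolded lt_def] ip_lam_pos_root[OF assms(5)] a] .
  also have "(\<lambda>q. ip lam c * cross a b q + ip lam a * cross b c q) = (\<lambda>q. ip lam b * cross a c q)"
    by (rule ext) (simp add: cross_def algebra_simps)
  finally show ?thesis using b unfolding lt_def lexpos_def by (auto simp: zero_less_mult_iff)
qed

lemma lt_total:
  assumes "a \<in> pos_roots" "b \<in> pos_roots" "0 < ip lam a"
  shows "lt a b \<or> a = b \<or> lt b a"
proof (cases "lt a b \<or> lt b a")
  case False
  have ab: "a \<in> real_roots" "b \<in> real_roots" using assms by (simp_all add: pos_root_real)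
  have "\<not> lexpos (\<lambda>q. - cross a b q)" using False lt_def by (simp add: cross_swap[symmetric])
  with False have "cross a b q = 0" if "q < r" for q
    using lexpos_cases[of "cross a b" q] that unfolding lt_def by blast
  then have "coord b q = (ip lam b / ip lam a) * coord a q" if "q < r" for q
    using that assms(3) by (simp add: cross_def field_simps)
  then have "b = (\<Sum>q<r. ((ip lam b / ip lam a) * coord a q) *\<^sub>R coroot (simple q))"
    by (subst root_eq_coord_sum[OF ab(2)]) (intro sum.cong, auto)
  also have "\<dots> = (ip lam b / ip lam a) *\<^sub>R (\<Sum>q<r. coord a q *\<^sub>R coroot (simple q))"
    by (simp add: scaleR_sum_right)
  also have "\<dots> = (ip lam b / ip lam a) *\<^sub>R a"
    by (simp only: root_eq_coord_sum[OF ab(1), symmetric])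
  finally have "b = a" by (rule proportional_pos_roots[OF assms(2,1)])
  then show ?thesis by simp
qed auto

lemma lt_root_total:
  assumes "a \<in> pos_roots" "0 < ip lam a" "x \<in> real_roots" "x \<noteq> a" "x \<noteq> - a"
  shows "lt x a \<or> lt a x"
  using assms(3)
proof (cases rule: root_cases)
  case 1
  then show ?thesis using lt_total[OF assms(1) 1 assms(2)] assms(4) by auto
next
  case 2
  then have "lt (- x) a \<or> lt a (- x)" using lt_total[OF assms(1) 2 assms(2)] assms(5) by auto
  then show ?thesis
    using lt_uminus_left[of x a] lt_uminus_right[of a x] assms(1,3) pos_root_real by blast
qed

end

context kac_moody_roots
begin

subsection \<open>Labelled paths in the Bruhat graph\<close>

text \<open>Edges may gain any length here. Positivity of \<open>w a\<close> is the form of going up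
  that can be followed through a left translation, where lengths are not known in advance.\<close>

fun up_path :: "('v \<Rightarrow> 'v) \<Rightarrow> 'v list \<Rightarrow> bool" where
  "up_path w [] \<longleftrightarrow> True"
| "up_path w (a # as) \<longleftrightarrow> a \<in> pos_roots \<and> w a \<in> pos_roots \<and> up_path (w \<circ> reflect a) as"

fun sat_path :: "('v \<Rightarrow> 'v) \<Rightarrow> 'v list \<Rightarrow> bool" where
  "sat_path w [] \<longleftrightarrow> True"
| "sat_path w (a # as) \<longleftrightarrow> a \<in> pos_roots \<and> weyl_length (w \<circ> reflect a) = weyl_length w + 1 \<and>
    sat_path (w \<circ> reflect a) as"

text \<open>The excluded edges are the upward \<open>srefl p\<close> edges. They are exactly the
  upward edges that a translation by \<open>srefl p\<close> turns downwards.\<close>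

fun avoids :: "nat \<Rightarrow> ('v \<Rightarrow> 'v) \<Rightarrow> 'v list \<Rightarrow> bool" where
  "avoids p w [] \<longleftrightarrow> True"
| "avoids p w (a # as) \<longleftrightarrow> w a \<noteq> simple p \<and> avoids p (w \<circ> reflect a) as"

fun path_end :: "('v \<Rightarrow> 'v) \<Rightarrow> 'v list \<Rightarrow> 'v \<Rightarrow> 'v" where
  "path_end w [] = w"
| "path_end w (a # as) = path_end (w \<circ> reflect a) as"

lemma path_end_eq: "path_end w as = w \<circ> refl_prod as"
  by (induction as arbitrary: w) (simp_all add: comp_assoc)

lemma path_end_append [simp]: "path_end w (as @ bs) = path_end (path_end w as) bs"
  by (induction as arbitrary: w) simp_all

lemma path_end_comp: "path_end (f \<circ> w) as = f \<circ> path_end w as"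
  by (simp only: path_end_eq comp_assoc)

declare o_apply [simp del]

lemma up_path_append: "up_path w (as @ bs) \<longleftrightarrow> up_path w as \<and> up_path (path_end w as) bs"
  by (induction as arbitrary: w) simp_all

lemma sat_path_append: "sat_path w (as @ bs) \<longleftrightarrow> sat_path w as \<and> sat_path (path_end w as) bs"
  by (induction as arbitrary: w) simp_all

lemma sat_path_roots: "sat_path w as \<Longrightarrow> set as \<subseteq> pos_roots"
  by (induction as arbitrary: w) auto

lemma path_end_weyl: "w \<in> weyl \<Longrightarrow> set as \<subseteq> pos_roots \<Longrightarrow> path_end w as \<in> weyl"
  unfolding path_end_eq by (intro weyl_comp refl_prod_weyl) (auto simp: pos_root_real)

lemma sat_path_end_weyl: "w \<in> weyl \<Longrightarrow> sat_path w as \<Longrightarrow> path_end w as \<in> weyl"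
  by (simp add: path_end_weyl sat_path_roots)

lemma sat_path_length:
  "sat_path w as \<Longrightarrow> weyl_length (path_end w as) = weyl_length w + length as"
  by (induction as arbitrary: w) simp_all

lemma sat_imp_up_path: "w \<in> weyl \<Longrightarrow> sat_path w as \<Longrightarrow> up_path w as"
  by (induction as arbitrary: w) (auto simp: weyl_image_pos weyl_comp_reflect)

lemma up_path_length:
  "w \<in> weyl \<Longrightarrow> up_path w as \<Longrightarrow> weyl_length w + length as \<le> weyl_length (path_end w as)"
proof (induction as arbitrary: w)
  case (Cons a as)
  then have "weyl_length (w \<circ> reflect a) + length as \<le> weyl_length (path_end (w \<circ> reflect a) as)"
    by (simp add: weyl_comp_reflect)
  moreover have "weyl_length w < weyl_length (w \<circ> reflect a)"
    using Cons.prems by (simp add: length_reflect_greater)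
  ultimately show ?case by simp
qed simp

text \<open>Each upward edge gains at least one, so a total gain of at most the number of edges
  leaves exactly one for each. Saturation of a translated path is thus read off from the lengths of
  its two ends.\<close>

lemma up_path_sat:
  "w \<in> weyl \<Longrightarrow> up_path w as \<Longrightarrow> weyl_length (path_end w as) \<le> weyl_length w + length as \<Longrightarrow>
    sat_path w as"
proof (induction as arbitrary: w)
  case (Cons a as)
  have w': "w \<circ> reflect a \<in> weyl" and up: "up_path (w \<circ> reflect a) as" and a: "a \<in> pos_roots"
    using Cons.prems by (simp_all add: weyl_comp_reflect)
  have 1: "weyl_length w < weyl_length (w \<circ> reflect a)"
    using Cons.prems by (simp add: length_reflect_greater)
  moreover have "weyl_length (w \<circ> reflect a) + length as \<le> weyl_length (path_end w (a # as))"
    using up_path_length[OF w' up] by simp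
  moreover have "sat_path (w \<circ> reflect a) as"
    using Cons.IH[OF w' up] 1 Cons.prems(3) by simp
  ultimately show ?case using a Cons.prems(3) by simp
qed simp

lemma up_path_translate:
  assumes "p < r"
  shows "w \<in> weyl \<Longrightarrow> up_path w as \<Longrightarrow> avoids p w as \<Longrightarrow> up_path (srefl p \<circ> w) as"
proof (induction as arbitrary: w)
  case (Cons a as)
  have "up_path (srefl p \<circ> (w \<circ> reflect a)) as"
    using Cons by (simp add: weyl_comp_reflect)
  moreover have "(srefl p \<circ> w) a \<in> pos_roots"
    using Cons.prems by (simp add: simple_reflect_pos assms o_apply)
  ultimately show ?case using Cons.prems by (simp add: comp_assoc)
qed simp

text \<open>Cutting at the last \<open>srefl p\<close> edge leaves a suffix that can be translated;
  \<open>not_avoids_first\<close> leaves such a prefix.\<close>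

lemma not_avoids_last:
  "\<not> avoids p w as \<Longrightarrow> \<exists>ps a qs. as = ps @ a # qs \<and> path_end w ps a = simple p \<and>
    avoids p (path_end w ps \<circ> reflect a) qs"
proof (induction as arbitrary: w)
  case (Cons a as)
  show ?case
  proof (cases "avoids p (w \<circ> reflect a) as")
    case True
    with Cons.prems show ?thesis
      by (intro exI[of _ "[]"] exI[of _ a] exI[of _ as]) simp
  next
    case False
    from Cons.IH[OF this] obtain ps b qs where "as = ps @ b # qs"
      "path_end (w \<circ> reflect a) ps b = simple p"
      "avoids p (path_end (w \<circ> reflect a) ps \<circ> reflect b) qs"
      by blast
    then show ?thesis by (intro exI[of _ "a # ps"] exI[of _ b] exI[of _ qs]) simp
  qed
qed simp

lemma not_avoids_first:
  "\<not> avoids p w as \<Longrightarrow> \<exists>ps a qs. as = ps @ a # qs \<and> path_end w ps a = simple p \<and> avoids p w ps"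
proof (induction as arbitrary: w)
  case (Cons a as)
  show ?case
  proof (cases "w a = simple p")
    case True
    then show ?thesis by (intro exI[of _ "[]"] exI[of _ a] exI[of _ as]) simp
  next
    case False
    with Cons.prems have "\<not> avoids p (w \<circ> reflect a) as" by simp
    from Cons.IH[OF this] obtain ps b qs where "as = ps @ b # qs"
      "path_end (w \<circ> reflect a) ps b = simple p" "avoids p (w \<circ> reflect a) ps"
      by blast
    then show ?thesis using False
      by (intro exI[of _ "a # ps"] exI[of _ b] exI[of _ qs]) simp
  qed
qed simp

lemma used_reflection:
  assumes "w \<in> weyl" "w a = simple p"
  shows "w \<circ> reflect a = srefl p \<circ> w"
  using reflect_conj_comp[OF assms(1), of a] assms(2) by simp

lemma edge_not_down:
  assumes "w \<in> weyl" "p < r" "w a \<in> pos_roots"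
  shows "pull p w \<noteq> - a"
proof
  assume "pull p w = - a"
  then have "w (- a) = simple p" using pull_eq_iff assms(1) by blast
  then have "- w a \<in> pos_roots" using simple_pos_root[OF assms(2)] assms(1) by (simp add: weyl_minus)
  then show False using assms(3) not_pos_neg by blast
qed

end

context dominant_data
begin

subsection \<open>Uniqueness of increasing paths\<close>

text \<open>A label orthogonal to \<open>lam\<close> does not move the orbit point. Such edges are
  invisible in the orbit and would spoil uniqueness, hence the condition on the pairings.\<close>

definition inc_path :: "('a \<Rightarrow> 'a) \<Rightarrow> 'a list \<Rightarrow> bool" where
  "inc_path w as \<longleftrightarrow> sat_path w as \<and> sorted_wrt lt as \<and> (\<forall>a\<in>set as. 0 < ip lam a)"

lemma inc_path_Cons:
  "inc_path w (a # as) \<longleftrightarrow> sat_path w [a] \<and> (\<forall>b\<in>set as. lt a b) \<and> 0 < ip lam a \<and>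
    inc_path (w \<circ> reflect a) as"
  unfolding inc_path_def by auto

lemma inc_path_append1: "inc_path w (as @ bs) \<Longrightarrow> inc_path w as"
  unfolding inc_path_def by (simp add: sat_path_append sorted_wrt_append)

lemma inc_path_append2: "inc_path w (as @ bs) \<Longrightarrow> inc_path (path_end w as) bs"
  unfolding inc_path_def by (simp add: sat_path_append sorted_wrt_append)

lemma inc_path_roots: "inc_path w as \<Longrightarrow> set as \<subseteq> pos_roots"
  unfolding inc_path_def using sat_path_roots by blast

lemma inc_path_end_weyl: "w \<in> weyl \<Longrightarrow> inc_path w as \<Longrightarrow> path_end w as \<in> weyl"
  by (simp add: path_end_weyl inc_path_roots)

text \<open>
  Fix a simple root and pull it back along a path to \<open>x\<close>. At an edge labelled \<open>a\<close> call the path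
  negative if \<open>lt x a\<close> and positive if \<open>x = a\<close> or \<open>lt a x\<close>. Since \<open>cross a\<close> is invariant under
  \<open>reflect a\<close>, the sign changes only between two edges, and it changes from negative to positive
  only at an element with negative \<open>x\<close>.
\<close>

lemma negative_prefix:
  assumes p: "p < r"
  shows "w \<in> weyl \<Longrightarrow> inc_path w (a # as) \<Longrightarrow> lt (pull p w) a \<Longrightarrow>
    - pull p (path_end w (a # as)) \<in> pos_roots \<Longrightarrow>
    \<exists>ps qs. a # as = ps @ qs \<and> ps \<noteq> [] \<and> avoids p w ps \<and> - pull p (path_end w ps) \<in> pos_roots"
proof (induction as arbitrary: w a)
  case Nil
  have "w a \<noteq> simple p" using Nil.prems pull_eq_iff lt_irrefl by metis
  then show ?case using Nil.prems by (intro exI[of _ "[a]"] exI[of _ "[]"]) simp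
next
  case (Cons b as)
  let ?w = "w \<circ> reflect a"
  have a: "a \<in> pos_roots" "b \<in> pos_roots" using inc_path_roots[OF Cons.prems(2)] by auto
  then have ar: "a \<in> real_roots" "b \<in> real_roots" by (simp_all add: pos_root_real)
  have w': "?w \<in> weyl" using Cons.prems(1) a by (simp add: weyl_comp_reflect)
  have ab: "lt a b" and bpos: "0 < ip lam b" and inc: "inc_path ?w (b # as)"
    using Cons.prems(2) by (auto simp: inc_path_Cons inc_path_def)
  have avoid: "w a \<noteq> simple p" using Cons.prems(1,3) pull_eq_iff lt_irrefl by metis
  let ?x = "pull p ?w"
  have x: "?x \<in> real_roots" using pull_root p w' by blast
  have xa: "lt ?x a"
    using Cons.prems(1,3) ar p by (simp add: pull_reflect lt_reflect_left pull_root)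
  show ?case
  proof (cases "lt ?x b")
    case True
    have "- pull p (path_end ?w (b # as)) \<in> pos_roots" using Cons.prems(4) by simp
    from Cons.IH[OF w' inc True this] obtain ps qs where "b # as = ps @ qs" "ps \<noteq> []"
      "avoids p ?w ps" "- pull p (path_end ?w ps) \<in> pos_roots" by blast
    then show ?thesis using avoid by (intro exI[of _ "a # ps"] exI[of _ qs]) simp
  next
    case False
    \<comment> \<open>A positive \<open>?x\<close> would satisfy \<open>lt ?x b\<close> by
      transitivity through \<open>a\<close>.\<close>
    have "?x \<notin> pos_roots" using False lt_trans[OF xa ab _ a] by blast
    then have "- ?x \<in> pos_roots" using x root_cases by blast
    then show ?thesis using avoid by (intro exI[of _ "[a]"] exI[of _ "b # as"]) simp
  qed
qed

text \<open>A negative first edge would yield, by \<open>negative_prefix\<close>, a prefix from an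
  ascent of \<open>p\<close> to a descent without a \<open>srefl p\<close> edge. Its translate is an
  upward path with the same number of edges, but with a longer start and a shorter end, which the
  lengths forbid.\<close>

lemma ascent_first_positive:
  assumes p: "p < r" and w: "w \<in> weyl" and inc: "inc_path w (a # as)"
    and asc: "pull p w \<in> pos_roots" and desc: "- pull p (path_end w (a # as)) \<in> pos_roots"
  shows "pull p w = a \<or> lt a (pull p w)"
proof -
  have a: "a \<in> pos_roots" "0 < ip lam a"
    using inc_path_roots[OF inc] inc by (auto simp: inc_path_def)
  have "\<not> lt (pull p w) a"
  proof
    assume "lt (pull p w) a"
    from negative_prefix[OF p w inc this desc] obtain ps qs where ps: "a # as = ps @ qs"
      "avoids p w ps" "- pull p (path_end w ps) \<in> pos_roots" by blast
    have sat: "sat_path w ps"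
      using inc unfolding ps(1) by (simp add: inc_path_def sat_path_append)
    have e: "path_end w ps \<in> weyl" using sat_path_end_weyl[OF w sat] .
    have "up_path (srefl p \<circ> w) ps"
      by (rule up_path_translate[OF p w sat_imp_up_path[OF w sat] ps(2)])
    from up_path_length[OF srefl_comp_weyl[OF p w] this]
    have "weyl_length (srefl p \<circ> w) + length ps \<le> weyl_length (srefl p \<circ> path_end w ps)"
      by (simp only: path_end_comp)
    then show False
      using length_srefl_up[OF p w asc] length_srefl_down[OF p e ps(3)] sat_path_length[OF sat]
      by simp
  qed
  moreover have "pull p w \<noteq> - a"
    using asc a(1) not_pos_neg by auto
  ultimately show ?thesis using lt_root_total[OF a pull_root[OF p w]] by blast
qed

text \<open>The disjunctive premise is the invariant along the path: at an ascent
  \<open>ascent_first_positive\<close> applies, and whenever the pulled back root is negative it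
  lies above all remaining labels.\<close>

lemma positive_everywhere:
  assumes p: "p < r"
  shows "w \<in> weyl \<Longrightarrow> inc_path w (ps @ a # qs) \<Longrightarrow>
    - pull p (path_end w (ps @ a # qs)) \<in> pos_roots \<Longrightarrow>
    pull p w \<in> pos_roots \<or> (\<forall>b\<in>set (ps @ a # qs). lt b (pull p w)) \<Longrightarrow>
    pull p (path_end w ps) = a \<or> lt a (pull p (path_end w ps))"
proof (induction ps arbitrary: w)
  case Nil
  then have "pull p w \<in> pos_roots \<Longrightarrow> pull p w = a \<or> lt a (pull p w)"
    using ascent_first_positive[OF p, of w a qs] by simp
  then show ?case using Nil.prems(4) by auto
next
  case (Cons c ps)
  let ?w = "w \<circ> reflect c"
  have c: "c \<in> pos_roots" and sub: "set (ps @ a # qs) \<subseteq> pos_roots"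
    using inc_path_roots[OF Cons.prems(2)] by auto
  then have cr: "c \<in> real_roots" by (simp add: pos_root_real)
  have w': "?w \<in> weyl" using Cons.prems(1) c by (simp add: weyl_comp_reflect)
  have inc: "inc_path ?w (ps @ a # qs)" and less: "\<forall>b\<in>set (ps @ a # qs). lt c b"
    using Cons.prems(2) by (auto simp: inc_path_Cons)
  have xr: "pull p w \<in> real_roots" using p Cons.prems(1) by (simp add: pull_root)
  have x': "pull p ?w = reflect c (pull p w)" using Cons.prems(1) cr by (simp add: pull_reflect)
  have first: "pull p w = c \<or> lt c (pull p w)"
    using ascent_first_positive[OF p Cons.prems(1), of c "ps @ a # qs"] Cons.prems(2-4) by auto
  have "pull p ?w \<in> pos_roots \<or> (\<forall>b\<in>set (ps @ a # qs). lt b (pull p ?w))"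
  proof (cases "pull p ?w \<in> pos_roots")
    case False
    have "lt b (pull p ?w)" if b: "b \<in> set (ps @ a # qs)" for b
    proof (cases "pull p w = c")
      case True
      then have "pull p ?w = - c" using x' cr by (simp add: reflect_self root_ip_neq)
      then show ?thesis using less b sub cr lt_uminus_right[of b c] pos_root_real by auto
    next
      case xc: False
      let ?y = "- pull p ?w"
      have xr': "pull p ?w \<in> real_roots" using p w' by (simp add: pull_root)
      have y: "?y \<in> pos_roots" using False xr' root_cases by blast
      have "lt c (pull p ?w)" using first xc by (simp add: x' lt_reflect_right cr xr)
      then have "lt ?y c" using lt_uminus_left[OF xr' cr] by simp
      then have "lt ?y b" using lt_trans[OF _ _ y c] less b sub by blast
      then show ?thesis using lt_uminus_left[OF xr', of b] b sub pos_root_real by auto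
    qed
    then show ?thesis by blast
  qed simp
  from Cons.IH[OF w' inc _ this] Cons.prems(3) show ?case by simp
qed

text \<open>A \<open>srefl p\<close> edge must occur, as otherwise the translated path would violate
  the length bound. Omitting the last one and translating what follows keeps the other labels, hence
  their order, and the lengths of the ends show that the result is saturated.\<close>

lemma remove_last_used:
  assumes p: "p < r" and w: "w \<in> weyl" and inc: "inc_path w as"
    and asc: "pull p w \<in> pos_roots" and desc: "- pull p (path_end w as) \<in> pos_roots"
  obtains ps a qs where "as = ps @ a # qs" "pull p (path_end w ps) = a" "inc_path w (ps @ qs)"
    "path_end w (ps @ qs) = srefl p \<circ> path_end w as"
proof -
  have sat: "sat_path w as" using inc by (simp add: inc_path_def)
  have e: "path_end w as \<in> weyl" using sat_path_end_weyl[OF w sat] .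
  have len: "weyl_length (path_end w as) = weyl_length w + length as" by (rule sat_path_length[OF sat])
  have "\<not> avoids p w as"
  proof
    assume "avoids p w as"
    from up_path_length[OF srefl_comp_weyl[OF p w] up_path_translate[OF p w sat_imp_up_path[OF w sat] this]]
    have "weyl_length (srefl p \<circ> w) + length as \<le> weyl_length (srefl p \<circ> path_end w as)"
      by (simp only: path_end_comp)
    then show False
      using length_srefl_up[OF p w asc] length_srefl_down[OF p e desc] len by simp
  qed
  then obtain ps a qs where as: "as = ps @ a # qs" and a: "path_end w ps a = simple p"
    and av: "avoids p (path_end w ps \<circ> reflect a) qs"
    using not_avoids_last by blast
  let ?v = "path_end w ps" and ?v' = "path_end w ps \<circ> reflect a"
  have satp: "sat_path w ps" and aroot: "a \<in> pos_roots" and satq: "sat_path ?v' qs"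
    using sat by (simp_all add: as sat_path_append)
  have v: "?v \<in> weyl" using sat_path_end_weyl[OF w satp] .
  have v': "?v' \<in> weyl" using v aroot by (rule weyl_comp_reflect)
  have vv': "srefl p \<circ> ?v' = ?v"
    unfolding used_reflection[OF v a] by (rule srefl_srefl[OF p])
  have "up_path ?v qs"
    using up_path_translate[OF p v' sat_imp_up_path[OF v' satq] av] by (simp only: vv')
  then have up: "up_path w (ps @ qs)"
    using sat_imp_up_path[OF w satp] by (simp add: up_path_append)
  have pe: "path_end w (ps @ qs) = srefl p \<circ> path_end w as"
    by (simp add: as path_end_comp[symmetric] vv')
  have "sat_path w (ps @ qs)"
    using up_path_sat[OF w up] length_srefl_down[OF p e desc] len unfolding pe by (simp add: as)
  then have "inc_path w (ps @ qs)"
    using inc by (simp add: as inc_path_def sorted_wrt_append)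
  then show ?thesis using that as a pe v by (simp add: pull_eq_iff)
qed

text \<open>Scans for the place where the root \<open>- pull p\<close> fits between the labels.
  \<open>cs\<close> stands for labels already passed; the recursion keeps only the latest one and
  recovers the others by transitivity. The scan starts with \<open>cs\<close> empty, and then at a
  negative \<open>pull p w\<close>.\<close>

lemma insert_first:
  assumes p: "p < r"
  shows "w \<in> weyl \<Longrightarrow> inc_path w as \<Longrightarrow>
    - pull p (path_end w as) \<in> pos_roots \<Longrightarrow> 0 < ip lam (- pull p (path_end w as)) \<Longrightarrow>
    set cs \<subseteq> pos_roots \<Longrightarrow> (\<forall>c\<in>set cs. \<forall>a\<in>set as. lt c a) \<Longrightarrow>
    - pull p w \<in> pos_roots \<or> cs \<noteq> [] \<Longrightarrow> (\<forall>c\<in>set cs. lt (pull p w) c) \<Longrightarrow>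
    \<exists>ps qs. as = ps @ qs \<and> avoids p w ps \<and> - pull p (path_end w ps) \<in> pos_roots \<and>
      0 < ip lam (- pull p (path_end w ps)) \<and>
      (\<forall>a\<in>set (cs @ ps). lt a (- pull p (path_end w ps))) \<and>
      (\<forall>a\<in>set qs. lt (- pull p (path_end w ps)) a)"
proof (induction as arbitrary: w cs)
  case Nil
  have "pull p w \<in> real_roots" using p Nil.prems(1) by (simp add: pull_root)
  then have "\<forall>c\<in>set cs. lt c (- pull p w)"
    using Nil.prems(5,8) lt_uminus_right pos_root_real by blast
  then show ?case using Nil.prems by (intro exI[of _ "[]"]) simp
next
  case (Cons a as)
  let ?x = "pull p w" and ?w = "w \<circ> reflect a"
  have a: "a \<in> pos_roots" "0 < ip lam a" and sub: "set as \<subseteq> pos_roots" and less: "\<forall>b\<in>set as. lt a b"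
    using inc_path_roots[OF Cons.prems(2)] Cons.prems(2) by (auto simp: inc_path_def)
  then have ar: "a \<in> real_roots" by (simp add: pos_root_real)
  have x: "?x \<in> real_roots" using p Cons.prems(1) by (simp add: pull_root)
  have wa: "w a \<in> pos_roots"
    using sat_imp_up_path[OF Cons.prems(1), of "a # as"] Cons.prems(2) by (simp add: inc_path_def)
  \<comment> \<open>A positive \<open>?x\<close> lies below a passed label and so below
    \<open>a\<close>. Hence the scan stops only at a negative \<open>?x\<close>.\<close>
  have trans: "lt ?x a" if "?x \<in> pos_roots"
  proof -
    have "cs \<noteq> []" using Cons.prems(7) that not_pos_neg by auto
    then obtain c where "c \<in> set cs" by (meson hd_in_set)
    then show ?thesis using lt_trans[OF _ _ that _ a(1)] Cons.prems(5,6,8)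
      by (meson list.set_intros(1) subsetD)
  qed
  show ?case
  proof (cases "lt ?x a")
    case True
    have "w a \<noteq> simple p" using True pull_eq_iff[OF Cons.prems(1)] lt_irrefl by metis
    then have "avoids p w [a]" by simp
    have w': "?w \<in> weyl" using Cons.prems(1) a by (simp add: weyl_comp_reflect)
    have inc: "inc_path ?w as" using Cons.prems(2) by (simp add: inc_path_Cons)
    have pe: "path_end w (a # bs) = path_end ?w bs" for bs by simp
    have xa: "lt (pull p ?w) a"
      using True Cons.prems(1) by (simp add: pull_reflect lt_reflect_left ar x)
    have "\<exists>ps qs. as = ps @ qs \<and> avoids p ?w ps \<and> - pull p (path_end ?w ps) \<in> pos_roots \<and>
      0 < ip lam (- pull p (path_end ?w ps)) \<and>
      (\<forall>b\<in>set ([a] @ ps). lt b (- pull p (path_end ?w ps))) \<and>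
      (\<forall>b\<in>set qs. lt (- pull p (path_end ?w ps)) b)"
      using Cons.IH[OF w' inc Cons.prems(3,4)[unfolded pe], of "[a]"] a(1) less xa by simp
    then obtain ps qs where *: "as = ps @ qs" "avoids p ?w ps"
      "- pull p (path_end w (a # ps)) \<in> pos_roots" "0 < ip lam (- pull p (path_end w (a # ps)))"
      "\<forall>b\<in>set ([a] @ ps). lt b (- pull p (path_end w (a # ps)))"
      "\<forall>b\<in>set qs. lt (- pull p (path_end w (a # ps))) b"
      unfolding pe[symmetric] by blast
    have "lt c (- pull p (path_end w (a # ps)))" if "c \<in> set cs" for c
    proof (rule lt_trans[OF _ _ _ a(1) *(3)])
      show "lt c a" "c \<in> pos_roots" using that Cons.prems(5,6) by auto
      show "lt a (- pull p (path_end w (a # ps)))" using *(5) by simp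
    qed
    then have "\<forall>b\<in>set (cs @ a # ps). lt b (- pull p (path_end w (a # ps)))"
      using *(5) by auto
    moreover have "avoids p w (a # ps)" "a # as = (a # ps) @ qs"
      using *(1,2) \<open>avoids p w [a]\<close> by simp_all
    ultimately show ?thesis using *(3,4,6) by blast
  next
    case False
    then have neg: "- ?x \<in> pos_roots" using trans x root_cases by blast
    moreover have "?x \<noteq> a" using neg a(1) not_pos_neg by auto
    moreover have "?x \<noteq> - a" using edge_not_down[OF Cons.prems(1) p wa] .
    ultimately have "lt a ?x" using lt_root_total[OF a x] False by blast
    then have xa: "lt (- ?x) a" using lt_uminus_left[OF x ar] by simp
    then have "\<forall>b\<in>set (a # as). lt (- ?x) b"
      using lt_trans[OF xa _ neg a(1)] less sub by auto
    moreover have "\<forall>c\<in>set cs. lt c (- ?x)"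
      using Cons.prems(5,8) lt_uminus_right[OF _ x] pos_root_real by blast
    moreover have "0 < ip lam (- ?x)" by (rule lt_imp_ip_lam_pos[OF xa neg a(1)])
    ultimately show ?thesis using neg by (intro exI[of _ "[]"] exI[of _ "a # as"]) simp
  qed
qed

lemma ip_pull: "w \<in> weyl \<Longrightarrow> ip (w lam) (simple p) = ip lam (pull p w)"
  by (simp add: pull_def weyl_ip_inv)

lemma pull_negative:
  assumes "p < r" "w \<in> weyl" "ip (w lam) (simple p) < 0"
  shows "- pull p w \<in> pos_roots" "0 < ip lam (- pull p w)"
proof -
  have neg: "ip lam (pull p w) < 0" using assms by (simp add: ip_pull)
  then show "0 < ip lam (- pull p w)" by simp
  show "- pull p w \<in> pos_roots"
    using pull_root[OF assms(1,2)] root_cases ip_lam_pos_root neg by (metis not_le)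
qed

text \<open>If the last edge leaves \<open>?v\<close> with label \<open>a\<close>, then
  \<open>lam\<close> pairs with the positive root \<open>?v a\<close> as
  \<open>reflect a lam\<close> pairs with \<open>a\<close>, that is negatively, against
  dominance.\<close>

lemma inc_path_to_lam:
  assumes "w \<in> weyl" "inc_path w as" "path_end w as lam = lam"
  shows "as = []"
proof (cases as rule: rev_exhaust)
  case (snoc ps a)
  let ?v = "path_end w ps"
  have "inc_path ?v [a]" using assms(2) snoc inc_path_append2 by blast
  then have a: "a \<in> pos_roots" "0 < ip lam a" and sat: "sat_path ?v [a]"
    by (auto simp: inc_path_def)
  have v: "?v \<in> weyl"
    using assms(1,2) snoc inc_path_append1 inc_path_end_weyl by blast
  have "?v a \<in> pos_roots" using sat_imp_up_path[OF v sat] by simp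
  then have "0 \<le> ip lam (?v a)" by (rule ip_lam_pos_root)
  moreover have "lam = ?v (reflect a lam)" using assms(3) snoc by (simp add: o_apply)
  then have "ip lam (?v a) = ip (reflect a lam) a" using weyl_isometry[OF v] by metis
  moreover have "ip (reflect a lam) a = - ip lam a"
    using root_ip_neq[OF pos_root_real[OF a(1)]] by (simp add: reflect_def ip_coroot)
  ultimately show ?thesis using a(2) by simp
qed

text \<open>If a label \<open>z\<close> stood between the two removed ones, the first path would
  give \<open>lt a z\<close>. In the second path \<open>a\<close> is the pulled back root at the
  edge labelled \<open>z\<close>, and \<open>positive_everywhere\<close> gives \<open>a = z\<close>
  or \<open>lt z a\<close>.\<close>

lemma removal_injective:
  assumes p: "p < r" and w: "w \<in> weyl" and asc: "pull p w \<in> pos_roots"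
    and inc1: "inc_path w (ps1 @ a # qs1)" and inc2: "inc_path w (ps2 @ b # qs2)"
    and desc: "- pull p (path_end w (ps2 @ b # qs2)) \<in> pos_roots"
    and a: "pull p (path_end w ps1) = a" and b: "pull p (path_end w ps2) = b"
    and eq: "ps1 @ qs1 = ps2 @ qs2" and len: "length ps1 \<le> length ps2"
  shows "ps1 @ a # qs1 = ps2 @ b # qs2"
proof -
  obtain zs where zs: "ps2 = ps1 @ zs" "qs1 = zs @ qs2"
    using eq len by (auto simp: append_eq_append_conv2)
  show ?thesis
  proof (cases zs)
    case Nil
    then show ?thesis using zs a b by simp
  next
    case (Cons z zs')
    have "lt a z" using inc1 zs Cons by (auto simp: inc_path_def sorted_wrt_append)
    moreover have "a = z \<or> lt z a"
      using positive_everywhere[OF p w, of ps1 z "zs' @ b # qs2"] inc2 desc asc zs Cons a by simp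
    ultimately show ?thesis using lt_irrefl lt_asym by blast
  qed
qed

lemma unique_from_ascent:
  assumes p: "p < r" and w: "w \<in> weyl" and asc: "pull p w \<in> pos_roots"
    and incs: "inc_path w as" "inc_path w bs"
    and ends: "path_end w as lam = v lam" "path_end w bs lam = v lam"
    and neg: "ip (v lam) (simple p) < 0"
    and IH: "\<And>cs ds. inc_path w cs \<Longrightarrow> inc_path w ds \<Longrightarrow>
      path_end w cs lam = (srefl p \<circ> v) lam \<Longrightarrow> path_end w ds lam = (srefl p \<circ> v) lam \<Longrightarrow> cs = ds"
  shows "as = bs"
proof -
  have desc: "- pull p (path_end w as) \<in> pos_roots" "- pull p (path_end w bs) \<in> pos_roots"
    using pull_negative(1)[OF p inc_path_end_weyl[OF w]] incs ends neg by simp_all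
  obtain ps1 a qs1 where 1: "as = ps1 @ a # qs1" "pull p (path_end w ps1) = a"
    "inc_path w (ps1 @ qs1)" "path_end w (ps1 @ qs1) = srefl p \<circ> path_end w as"
    using remove_last_used[OF p w incs(1) asc desc(1)] .
  obtain ps2 b qs2 where 2: "bs = ps2 @ b # qs2" "pull p (path_end w ps2) = b"
    "inc_path w (ps2 @ qs2)" "path_end w (ps2 @ qs2) = srefl p \<circ> path_end w bs"
    using remove_last_used[OF p w incs(2) asc desc(2)] .
  have eq: "ps1 @ qs1 = ps2 @ qs2"
    using IH[OF 1(3) 2(3)] unfolding 1(4) 2(4) using ends by (simp add: o_apply)
  show ?thesis
  proof (cases "length ps1 \<le> length ps2")
    case True
    show ?thesis
      using removal_injective[OF p w asc _ _ _ 1(2) 2(2) eq True] incs desc 1(1) 2(1) by simp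
  next
    case False
    then have "length ps2 \<le> length ps1" by simp
    from removal_injective[OF p w asc _ _ _ 2(2) 1(2) eq[symmetric] this] show ?thesis
      using incs desc 1(1) 2(1) by simp
  qed
qed

text \<open>Moves the start of a path from a descent of \<open>p\<close> to the ascent
  \<open>srefl p \<circ> w\<close>. The part before the insertion is translated, and the inserted
  \<open>srefl p\<close> edge leads back to the original path.\<close>

lemma insert_increasing:
  assumes p: "p < r" and w: "w \<in> weyl" and inc: "inc_path w as" and dsc: "- pull p w \<in> pos_roots"
    and neg: "ip (path_end w as lam) (simple p) < 0"
  obtains ps d qs where "as = ps @ qs" "pull p (path_end w ps) = - d" "d \<in> pos_roots"
    "inc_path (srefl p \<circ> w) (ps @ d # qs)"
    "path_end (srefl p \<circ> w) (ps @ d # qs) = path_end w as"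
proof -
  have e: "path_end w as \<in> weyl" using w inc by (rule inc_path_end_weyl)
  note desc = pull_negative[OF p e neg]
  have "\<exists>ps qs. as = ps @ qs \<and> avoids p w ps \<and> - pull p (path_end w ps) \<in> pos_roots \<and>
      0 < ip lam (- pull p (path_end w ps)) \<and>
      (\<forall>a\<in>set ([] @ ps). lt a (- pull p (path_end w ps))) \<and>
      (\<forall>a\<in>set qs. lt (- pull p (path_end w ps)) a)"
    using insert_first[OF p w inc desc, of "[]"] dsc by simp
  then obtain ps qs where as: "as = ps @ qs" and av: "avoids p w ps"
    and d: "- pull p (path_end w ps) \<in> pos_roots" "0 < ip lam (- pull p (path_end w ps))"
    and less: "\<forall>a\<in>set ps. lt a (- pull p (path_end w ps))"
      "\<forall>a\<in>set qs. lt (- pull p (path_end w ps)) a"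
    by auto
  define d where "d = - pull p (path_end w ps)"
  note d = d[folded d_def] and less = less[folded d_def]
  let ?v = "path_end w ps"
  have sat: "sat_path w as" "sat_path w ps" "sat_path ?v qs"
    using inc by (simp_all add: inc_path_def as sat_path_append)
  have v: "?v \<in> weyl" using sat_path_end_weyl[OF w sat(2)] .
  have sw: "srefl p \<circ> w \<in> weyl" using p w by (rule srefl_comp_weyl)
  have sv: "srefl p \<circ> ?v \<in> weyl" using p v by (rule srefl_comp_weyl)
  have "pull p (srefl p \<circ> ?v) = d" by (simp add: pull_srefl p v d_def)
  then have svd: "(srefl p \<circ> ?v) d = simple p" using pull_eq_iff[OF sv] by blast
  have restore: "srefl p \<circ> ?v \<circ> reflect d = ?v"
    unfolding used_reflection[OF sv svd] by (rule srefl_srefl[OF p])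
  have up: "up_path (srefl p \<circ> w) (ps @ d # qs)"
    using up_path_translate[OF p w sat_imp_up_path[OF w sat(2)] av]
      sat_imp_up_path[OF v sat(3)] d(1) svd simple_pos_root[OF p] restore
    by (simp add: up_path_append path_end_comp)
  have pe: "path_end (srefl p \<circ> w) (ps @ d # qs) = path_end w as"
    by (simp add: as path_end_comp[of "srefl p" w] restore)
  have "sat_path (srefl p \<circ> w) (ps @ d # qs)"
    using up_path_sat[OF sw up] sat_path_length[OF sat(1)] length_srefl_down[OF p w dsc]
    unfolding pe by (simp add: as)
  moreover have "sorted_wrt lt (ps @ d # qs)"
    using inc less by (auto simp: inc_path_def as sorted_wrt_append)
  ultimately have "inc_path (srefl p \<circ> w) (ps @ d # qs)"
    using inc d(2) by (auto simp: inc_path_def as)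
  moreover have "pull p (path_end w ps) = - d" by (simp add: d_def)
  ultimately show ?thesis using that as d(1) pe by blast
qed

text \<open>If the places differed, the path from \<open>w\<close> would contain an edge labelled
  \<open>a\<close> at a vertex where the pulled back root is \<open>- a\<close>; such an edge goes
  down.\<close>

lemma insertion_injective:
  assumes p: "p < r" and w: "w \<in> weyl" and inc: "inc_path w (ps2 @ qs2)"
    and a: "pull p (path_end w ps1) = - a" and a_pos: "a \<in> pos_roots"
    and eq: "ps1 @ a # qs1 = ps2 @ b # qs2" and len: "length ps1 \<le> length ps2"
  shows "ps1 @ qs1 = ps2 @ qs2"
proof -
  obtain zs where zs: "ps2 = ps1 @ zs" "a # qs1 = zs @ b # qs2"
    using eq len by (auto simp: append_eq_append_conv2)
  show ?thesis
  proof (cases zs)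
    case (Cons z zs')
    with zs have ps2: "ps2 = ps1 @ a # zs'" by simp
    have "sat_path w (ps1 @ a # zs' @ qs2)" using inc ps2 by (simp add: inc_path_def)
    then have s: "sat_path w ps1" "sat_path (path_end w ps1) [a]" by (simp_all add: sat_path_append)
    have v: "path_end w ps1 \<in> weyl" using sat_path_end_weyl[OF w s(1)] .
    have "path_end w ps1 a \<in> pos_roots" using sat_imp_up_path[OF v s(2)] by simp
    then show ?thesis using edge_not_down[OF v p] a by blast
  qed (use zs in simp)
qed

text \<open>Only the point \<open>v lam\<close> matters. For a left descent \<open>p\<close> of
  \<open>v\<close>, either \<open>srefl p \<circ> v\<close> gives the same point, or removing the
  last \<open>srefl p\<close> edges leads to the target \<open>srefl p \<circ> v\<close>. A start at
  a descent of \<open>p\<close> is moved to an ascent beforehand.\<close>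

theorem inc_path_unique:
  assumes "v \<in> weyl" "w \<in> weyl" "inc_path w as" "inc_path w bs"
    "path_end w as lam = v lam" "path_end w bs lam = v lam"
  shows "as = bs"
  using assms
proof (induction "weyl_length v" arbitrary: v w as bs rule: less_induct)
  case less
  show ?case
  proof (cases "v = id")
    case True
    then show ?thesis using less.prems inc_path_to_lam by auto
  next
    case False
    obtain p where p: "p < r" "- pull p v \<in> pos_roots" using left_descent[OF less.prems(1) False] .
    have sv: "srefl p \<circ> v \<in> weyl" "weyl_length (srefl p \<circ> v) < weyl_length v"
      using srefl_comp_weyl[OF p(1) less.prems(1)] length_srefl_down[OF p(1) less.prems(1) p(2)]
      by simp_all
    have le: "ip (v lam) (simple p) \<le> 0"
      using ip_lam_pos_root[OF p(2)] less.prems(1) by (simp add: ip_pull)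
    show ?thesis
    proof (cases "ip (v lam) (simple p) = 0")
      case True
      then have "(srefl p \<circ> v) lam = v lam" by (simp add: o_apply reflect_def ip_coroot)
      then show ?thesis using less.hyps[OF sv(2,1) less.prems(2-4)] less.prems(5,6) by simp
    next
      case False
      with le have neg: "ip (v lam) (simple p) < 0" by simp
      have asc: "as = bs" if "u \<in> weyl" "pull p u \<in> pos_roots" "inc_path u as" "inc_path u bs"
        "path_end u as lam = v lam" "path_end u bs lam = v lam" for u as bs
        using unique_from_ascent[where v = v, OF p(1) that neg] less.hyps[OF sv(2,1) that(1)] by blast
      show ?thesis
      proof (cases "pull p w \<in> pos_roots")
        case True
        then show ?thesis using asc less.prems by blast
      next
        case False
        then have dsc: "- pull p w \<in> pos_roots"
          using root_cases pull_root[OF p(1) less.prems(2)] by blast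
        obtain ps1 a qs1 where 1: "as = ps1 @ qs1" "pull p (path_end w ps1) = - a" "a \<in> pos_roots"
          "inc_path (srefl p \<circ> w) (ps1 @ a # qs1)"
          "path_end (srefl p \<circ> w) (ps1 @ a # qs1) = path_end w as"
          using insert_increasing[OF p(1) less.prems(2,3) dsc] less.prems(5) neg by metis
        obtain ps2 b qs2 where 2: "bs = ps2 @ qs2" "pull p (path_end w ps2) = - b" "b \<in> pos_roots"
          "inc_path (srefl p \<circ> w) (ps2 @ b # qs2)"
          "path_end (srefl p \<circ> w) (ps2 @ b # qs2) = path_end w bs"
          using insert_increasing[OF p(1) less.prems(2,4) dsc] less.prems(6) neg by metis
        have "pull p (srefl p \<circ> w) \<in> pos_roots"
          using dsc p(1) less.prems(2) by (simp add: pull_srefl)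
        then have eq: "ps1 @ a # qs1 = ps2 @ b # qs2"
          using asc[OF srefl_comp_weyl[OF p(1) less.prems(2)] _ 1(4) 2(4)] 1(5) 2(5) less.prems(5,6)
          by simp
        show ?thesis
        proof (cases "length ps1 \<le> length ps2")
          case True
          then show ?thesis
            using insertion_injective[OF p(1) less.prems(2) _ 1(2,3) eq] less.prems(4) 1(1) 2(1) by simp
        next
          case False
          then have "length ps2 \<le> length ps1" by simp
          from insertion_injective[OF p(1) less.prems(2) _ 2(2,3) eq[symmetric] this]
          show ?thesis using less.prems(3) 1(1) 2(1) by simp
        qed
      qed
    qed
  qed
qed

subsection \<open>Minimal representatives and the orbit order\<close>

text \<open>Minimal representatives modulo the stabiliser of \<open>lam\<close>, described by their
  effect on the simple roots orthogonal to \<open>lam\<close>; minimality of length is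
  \<open>minrep_length_le\<close>.\<close>

definition minrep :: "('a \<Rightarrow> 'a) \<Rightarrow> bool" where
  "minrep w \<longleftrightarrow> w \<in> weyl \<and> (\<forall>p<r. ip lam (simple p) = 0 \<longrightarrow> w (simple p) \<in> pos_roots)"

lemma minrep_weyl: "minrep w \<Longrightarrow> w \<in> weyl"
  by (simp add: minrep_def)

lemma minrep_id: "minrep id"
  by (simp add: minrep_def weyl.weyl_id simple_pos_root)

text \<open>The pairing of \<open>lam\<close> with \<open>d\<close> is a vanishing sum of
  nonnegative terms, so only simple roots orthogonal to \<open>lam\<close> occur in
  \<open>d\<close>, and \<open>w\<close> keeps each of them positive.\<close>

lemma minrep_pos:
  assumes "minrep w" "d \<in> pos_roots" "ip lam d = 0"
  shows "w d \<in> pos_roots"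
proof -
  have w: "w \<in> weyl" using assms(1) by (rule minrep_weyl)
  obtain c where c: "\<forall>q<r. 0 \<le> c q" "d = (\<Sum>q<r. c q *\<^sub>R simple q)"
    using assms(2) unfolding pos_roots_def by auto
  have lin: "linear (\<lambda>v. ip lam v)" using bilinear by (simp add: bilinear_def)
  have "(\<Sum>q<r. c q * ip lam (simple q)) = 0"
    using assms(3) c(2) by (simp add: linear_sum[OF lin])
  moreover have "0 \<le> c q * ip lam (simple q)" if "q < r" for q
    using c(1) that ip_lam_pos_root[OF simple_pos_root] by simp
  ultimately have zero: "c q * ip lam (simple q) = 0" if "q < r" for q
    using sum_nonneg_0[of "{..<r}" "\<lambda>q. c q * ip lam (simple q)" q] that by auto
  have "\<exists>e. (\<forall>s<r. 0 \<le> e s) \<and> c q *\<^sub>R w (simple q) = (\<Sum>s<r. e s *\<^sub>R simple s)" if q: "q < r" for q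
  proof (cases "c q = 0")
    case True
    then show ?thesis by (intro exI[of _ "\<lambda>_. 0"]) simp
  next
    case False
    with zero[OF q] have "ip lam (simple q) = 0" by simp
    then have "w (simple q) \<in> pos_roots" using assms(1) q by (simp add: minrep_def)
    then obtain e where "\<forall>s<r. 0 \<le> e s" "w (simple q) = (\<Sum>s<r. e s *\<^sub>R simple s)"
      unfolding pos_roots_def by auto
    then show ?thesis using c(1) q
      by (intro exI[of _ "\<lambda>s. c q * e s"]) (simp add: scaleR_sum_right)
  qed
  then obtain E where E: "\<And>q s. q < r \<Longrightarrow> s < r \<Longrightarrow> 0 \<le> E q s"
    "\<And>q. q < r \<Longrightarrow> c q *\<^sub>R w (simple q) = (\<Sum>s<r. E q s *\<^sub>R simple s)"
    by metis
  have "w d = (\<Sum>q<r. \<Sum>s<r. E q s *\<^sub>R simple s)"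
    using E(2) by (simp add: c(2) linear_sum[OF weyl_linear[OF w]] linear_scale[OF weyl_linear[OF w]])
  also have "\<dots> = (\<Sum>s<r. (\<Sum>q<r. E q s) *\<^sub>R simple s)"
    by (subst sum.swap) (simp add: scaleR_sum_left)
  finally have "w d = (\<Sum>s<r. (\<Sum>q<r. E q s) *\<^sub>R simple s)" .
  moreover have "\<forall>s<r. 0 \<le> (\<Sum>q<r. E q s)" using E(1) by (auto intro: sum_nonneg)
  moreover have "w d \<in> real_roots" using weyl_root[OF w pos_root_real[OF assms(2)]] .
  ultimately show ?thesis
    unfolding pos_roots_def by (intro CollectI conjI exI[of _ "\<lambda>s. \<Sum>q<r. E q s"])
qed

text \<open>Otherwise \<open>u \<circ> reflect b \<circ> srefl p\<close> is no longer than
  \<open>u\<close> for some simple root orthogonal to \<open>lam\<close>. The same element arises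
  from \<open>u \<circ> srefl p\<close>, already longer than \<open>u\<close>, by an upward edge
  labelled \<open>srefl p b\<close>.\<close>

lemma minrep_step:
  assumes u: "minrep u" and b: "b \<in> pos_roots" "0 < ip lam b"
    and len: "weyl_length (u \<circ> reflect b) = weyl_length u + 1"
  shows "minrep (u \<circ> reflect b)"
  unfolding minrep_def
proof (intro conjI allI impI)
  have uw: "u \<in> weyl" using u by (rule minrep_weyl)
  show x: "u \<circ> reflect b \<in> weyl" using uw b(1) by (rule weyl_comp_reflect)
  fix p assume p: "p < r" and zero: "ip lam (simple p) = 0"
  show "(u \<circ> reflect b) (simple p) \<in> pos_roots"
  proof (rule ccontr)
    assume "\<not> ?thesis"
    then have "- (u \<circ> reflect b) (simple p) \<in> pos_roots"
      using root_cases weyl_root[OF x simple_real_root[OF p]] by blast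
    from length_reflect_less[OF x simple_pos_root[OF p] this]
    have 1: "weyl_length (u \<circ> reflect b \<circ> srefl p) \<le> weyl_length u" using len by simp
    have up: "u (simple p) \<in> pos_roots" using u p zero by (simp add: minrep_def)
    have us: "u \<circ> srefl p \<in> weyl" using uw p by (simp add: weyl_comp srefl_weyl)
    have "b \<noteq> simple p" using b zero by auto
    then have c: "srefl p b \<in> pos_roots" using simple_reflect_pos p b by blast
    have "reflect (srefl p b) = srefl p \<circ> reflect b \<circ> srefl p"
      using reflect_conj[OF srefl_weyl[OF p]] by (simp add: inv_reflect simple_real_root p)
    then have "u \<circ> srefl p \<circ> reflect (srefl p b) = u \<circ> reflect b \<circ> srefl p"
      by (simp add: fun_eq_iff o_apply reflect_reflect_root simple_real_root p)
    moreover have "(u \<circ> srefl p) (srefl p b) \<in> pos_roots"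
      using weyl_image_pos[OF uw b(1)] len
      by (simp add: o_apply reflect_reflect_root simple_real_root p)
    ultimately have "weyl_length (u \<circ> srefl p) < weyl_length (u \<circ> reflect b \<circ> srefl p)"
      using length_reflect_greater[OF us c] by simp
    moreover have "weyl_length u < weyl_length (u \<circ> srefl p)"
      using length_reflect_greater[OF uw simple_pos_root[OF p] up] .
    ultimately show False using 1 by simp
  qed
qed

lemma minrep_path:
  "minrep u \<Longrightarrow> sat_path u as \<Longrightarrow> \<forall>a\<in>set as. 0 < ip lam a \<Longrightarrow> minrep (path_end u as)"
  by (induction as arbitrary: u) (auto simp: minrep_step)

text \<open>The quotient \<open>z\<close> fixes \<open>lam\<close>. At a right descent
  \<open>p\<close> of \<open>z\<close> both \<open>simple p\<close> and
  \<open>- z (simple p)\<close> are orthogonal to \<open>lam\<close>; \<open>u\<close> makes the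
  second positive and \<open>w\<close> the first, although \<open>w\<close> is \<open>u\<close>
  after \<open>z\<close>.\<close>

lemma minrep_unique:
  assumes u: "minrep u" and w: "minrep w" and eq: "u lam = w lam"
  shows "u = w"
proof -
  have uw: "u \<in> weyl" "w \<in> weyl" using u w by (simp_all add: minrep_weyl)
  define z where "z = inv u \<circ> w"
  have z: "z \<in> weyl" using uw by (simp add: z_def weyl_comp weyl_inv)
  have zlam: "z lam = lam" using eq[symmetric] uw by (simp add: z_def o_apply)
  have w_eq: "w x = u (z x)" for x using uw by (simp add: z_def o_apply)
  have "z = id"
  proof (rule ccontr)
    assume "z \<noteq> id"
    then obtain p where p: "p < r" "- z (simple p) \<in> pos_roots" using right_descent[OF z] by blast
    have "ip lam (z (simple p)) = ip lam (simple p)" using weyl_isometry[OF z] zlam by metis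
    then have 0: "ip lam (simple p) = 0" "ip lam (- z (simple p)) = 0"
      using ip_lam_pos_root[OF p(2)] ip_lam_pos_root[OF simple_pos_root[OF p(1)]] by simp_all
    have "- w (simple p) \<in> pos_roots"
      using minrep_pos[OF u p(2) 0(2)] uw by (simp add: w_eq weyl_minus)
    then show False using w 0(1) p(1) not_pos_neg by (auto simp: minrep_def)
  qed
  then show ?thesis using w_eq by auto
qed

lemma minrep_exists:
  assumes "w \<in> weyl"
  obtains u where "minrep u" "u lam = w lam" "weyl_length u \<le> weyl_length w"
proof -
  let ?P = "\<lambda>u. u \<in> weyl \<and> u lam = w lam"
  define u where "u = arg_min weyl_length ?P"
  have u: "?P u" and least: "\<And>v. ?P v \<Longrightarrow> weyl_length u \<le> weyl_length v"
    using arg_min_natI[of ?P w weyl_length] arg_min_nat_le[of ?P _ weyl_length] assms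
    unfolding u_def by blast+
  have "minrep u"
    unfolding minrep_def
  proof (intro conjI allI impI)
    fix p assume p: "p < r" and zero: "ip lam (simple p) = 0"
    show "u (simple p) \<in> pos_roots"
    proof (rule ccontr)
      assume "\<not> ?thesis"
      then have "- u (simple p) \<in> pos_roots"
        using root_cases weyl_root u simple_real_root[OF p] by blast
      then have "weyl_length (u \<circ> srefl p) < weyl_length u"
        using length_reflect_less u simple_pos_root[OF p] by blast
      moreover have "?P (u \<circ> srefl p)"
        using u zero weyl_comp srefl_weyl[OF p] by (simp add: o_apply reflect_def ip_coroot)
      ultimately show False using least by fastforce
    qed
  qed (use u in blast)
  then show ?thesis using that u least[of w] assms by blast
qed

lemma minrep_length_le:
  assumes "minrep u" "w \<in> weyl" "w lam = u lam"
  shows "weyl_length u \<le> weyl_length w"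
  by (metis assms minrep_exists minrep_unique)

section \<open>The Bruhat order on the orbit and lengths of representatives\<close>

lemma mem_orbit: "y \<in> orbit (- lam) \<longleftrightarrow> (\<exists>w\<in>weyl. y = - w lam)"
  unfolding orbit_def using weyl_minus by fastforce

lemma orbitE:
  assumes "y \<in> orbit (- lam)"
  obtains u where "minrep u" "y = - u lam"
  using assms mem_orbit minrep_exists by metis

definition orbit_step :: "'a \<Rightarrow> 'a \<Rightarrow> bool" where
  "orbit_step x y \<longleftrightarrow> y \<in> orbit (- lam) \<and>
    (\<exists>a\<in>pos_roots. 0 < ip y (coroot a) \<and> x = reflect a y)"

lemma orbit_less_eq: "orbit_less (- lam) = orbit_step\<^sup>+\<^sup>+"
  unfolding orbit_less_def orbit_step_def ..

lemma orbit_reflect: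
  assumes "y \<in> orbit (- lam)" "a \<in> real_roots"
  shows "reflect a y \<in> orbit (- lam)"
proof -
  obtain w where w: "w \<in> weyl" "y = - w lam" using assms(1) mem_orbit by blast
  then have "reflect a y = - (reflect a \<circ> w) lam" by (simp add: reflect_minus o_apply)
  then show ?thesis using w mem_orbit weyl_comp reflect_weyl assms(2) by blast
qed

lemma orbit_step_orbit: "orbit_step x y \<Longrightarrow> x \<in> orbit (- lam) \<and> y \<in> orbit (- lam)"
  unfolding orbit_step_def using orbit_reflect pos_root_real by blast

lemma ip_coroot_pos_iff: "a \<in> real_roots \<Longrightarrow> 0 < ip y (coroot a) \<longleftrightarrow> 0 < ip y a"
  using root_pos[of a] by (simp add: ip_coroot zero_less_divide_iff)

text \<open>A positive pairing of the point \<open>- v lam\<close> with \<open>a\<close> makes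
  \<open>- inv v a\<close> an inversion of \<open>v\<close>. The sign in \<open>- lam\<close> thus
  lets higher points have longer representatives.\<close>

lemma orbit_step_length:
  assumes "orbit_step (- u lam) (- v lam)" "minrep u" "minrep v"
  shows "weyl_length u < weyl_length v"
proof -
  obtain a where a: "a \<in> pos_roots" "0 < ip (- v lam) (coroot a)" "- u lam = reflect a (- v lam)"
    using assms(1) unfolding orbit_step_def by blast
  have v: "v \<in> weyl" using assms(3) by (rule minrep_weyl)
  have ar: "a \<in> real_roots" using a(1) by (rule pos_root_real)
  let ?b = "inv v a"
  have b: "?b \<in> real_roots" using weyl_root[OF weyl_inv[OF v] ar] .
  have "ip lam ?b < 0"
    using a(2) ip_coroot_pos_iff[OF ar, of "- v lam"] by (simp add: weyl_ip_inv[OF v])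
  then have nb: "- ?b \<in> pos_roots" using b root_cases ip_lam_pos_root by (metis not_le)
  have eq: "reflect a \<circ> v = v \<circ> reflect (- ?b)"
    using reflect_conj_comp[OF v, of ?b] v by (simp add: reflect_uminus)
  have "weyl_length (reflect a \<circ> v) < weyl_length v"
    unfolding eq using length_reflect_less[OF v nb] a(1) v by (simp add: weyl_minus)
  moreover have "u lam = (reflect a \<circ> v) lam" using a(3) by (simp add: reflect_minus o_apply)
  then have "weyl_length u \<le> weyl_length (reflect a \<circ> v)"
    using minrep_length_le[OF assms(2)] weyl_comp[OF reflect_weyl[OF ar] v] by simp
  ultimately show ?thesis by simp
qed

lemma orbit_less_length:
  assumes "orbit_less (- lam) x y"
  shows "minrep u \<Longrightarrow> minrep v \<Longrightarrow> x = - u lam \<Longrightarrow> y = - v lam \<Longrightarrow> weyl_length u < weyl_length v"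
  using assms unfolding orbit_less_eq
proof (induction arbitrary: v rule: tranclp_induct)
  case (base y)
  then show ?case using orbit_step_length by simp
next
  case (step y z)
  then obtain w where w: "minrep w" "y = - w lam" using orbitE orbit_step_orbit by metis
  then have "weyl_length u < weyl_length w" "weyl_length w < weyl_length v"
    using step orbit_step_length by auto
  then show ?case by simp
qed

lemma orbit_less_orbit: "orbit_less (- lam) x y \<Longrightarrow> x \<in> orbit (- lam) \<and> y \<in> orbit (- lam)"
  unfolding orbit_less_eq by (induction rule: tranclp_induct) (auto dest: orbit_step_orbit)

lemma orbit_less_irrefl: "\<not> orbit_less (- lam) x x"
  using orbit_less_length orbit_less_orbit orbitE by (metis less_irrefl)

lemma orbit_less_trans: "orbit_less (- lam) x y \<Longrightarrow> orbit_less (- lam) y z \<Longrightarrow> orbit_less (- lam) x z"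
  unfolding orbit_less_eq by (rule tranclp_trans)

text \<open>Dictionary between an edge labelled \<open>b\<close> and a relation in the orbit. The
  orbit root is \<open>u b\<close>, and its pairing with the upper point depends on the label only,
  so integrality can be read off the label.\<close>

lemma edge_orbit_step:
  assumes u: "u \<in> weyl" and b: "b \<in> pos_roots" "0 < ip lam b" and ub: "u b \<in> pos_roots"
  shows "orbit_step (- u lam) (- (u \<circ> reflect b) lam)"
    "- u lam = reflect (u b) (- (u \<circ> reflect b) lam)"
    "ip (- (u \<circ> reflect b) lam) (coroot (u b)) = ip lam (coroot b)"
proof -
  have br: "b \<in> real_roots" "u b \<in> real_roots" using b ub by (simp_all add: pos_root_real)
  have coroot_u: "coroot (u b) = u (coroot b)"
    by (simp add: coroot_def weyl_isometry[OF u] linear_scale[OF weyl_linear[OF u]])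
  have "ip (- (u \<circ> reflect b) lam) (coroot (u b)) = - ip (reflect b lam) (coroot b)"
    by (simp add: coroot_u o_apply weyl_isometry[OF u])
  also have "\<dots> = ip lam (coroot b)"
    using root_ip_neq[OF br(1)] by (simp add: reflect_def ip_coroot)
  finally show ip_eq: "ip (- (u \<circ> reflect b) lam) (coroot (u b)) = ip lam (coroot b)" .
  have "reflect (u b) ((u \<circ> reflect b) lam) = u lam"
    using u br by (simp add: reflect_conj o_apply reflect_reflect_root)
  then show eq: "- u lam = reflect (u b) (- (u \<circ> reflect b) lam)" by (simp add: reflect_minus)
  have "- (u \<circ> reflect b) lam \<in> orbit (- lam)"
    using mem_orbit weyl_comp_reflect[OF u b(1)] by blast
  moreover have "0 < ip (- (u \<circ> reflect b) lam) (coroot (u b))"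
    using ip_eq ip_lam_coroot_pos[OF br(1)] b(2) by simp
  ultimately show "orbit_step (- u lam) (- (u \<circ> reflect b) lam)"
    unfolding orbit_step_def using ub eq by blast
qed

text \<open>The orbit order strictly raises the length of minimal representatives, so a gap of one
  leaves no room for a third point.\<close>

lemma cover_orbit_cover:
  assumes u: "minrep u" and b: "b \<in> pos_roots" "0 < ip lam b"
    and len: "weyl_length (u \<circ> reflect b) = weyl_length u + 1"
  shows "orbit_cover (- lam) (- u lam) (- (u \<circ> reflect b) lam)"
  unfolding orbit_cover_def
proof
  have uw: "u \<in> weyl" using u by (rule minrep_weyl)
  have "u b \<in> pos_roots" using weyl_image_pos[OF uw b(1)] len by simp
  then show "orbit_less (- lam) (- u lam) (- (u \<circ> reflect b) lam)"
    unfolding orbit_less_eq using edge_orbit_step(1)[OF uw b] by blast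
  have v: "minrep (u \<circ> reflect b)" using minrep_step assms by blast
  show "\<not> (\<exists>z. orbit_less (- lam) (- u lam) z \<and> orbit_less (- lam) z (- (u \<circ> reflect b) lam))"
  proof
    assume "\<exists>z. orbit_less (- lam) (- u lam) z \<and> orbit_less (- lam) z (- (u \<circ> reflect b) lam)"
    then obtain z where z: "orbit_less (- lam) (- u lam) z"
      "orbit_less (- lam) z (- (u \<circ> reflect b) lam)" by blast
    then obtain w where w: "minrep w" "z = - w lam" using orbitE orbit_less_orbit by metis
    then show False using orbit_less_length[OF z(1) u w(1) refl w(2)]
        orbit_less_length[OF z(2) w(1) v w(2) refl] len by simp
  qed
qed

definition integral_at :: "real \<Rightarrow> 'a \<Rightarrow> bool" where
  "integral_at t a \<longleftrightarrow> t * ip lam (coroot a) \<in> \<int>"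

lemma path_orbit_less_at:
  "minrep u \<Longrightarrow> sat_path u as \<Longrightarrow> \<forall>a\<in>set as. 0 < ip lam a \<and> integral_at t a \<Longrightarrow> as \<noteq> [] \<Longrightarrow>
    orbit_less_at (- lam) t (- u lam) (- path_end u as lam)"
proof (induction as arbitrary: u)
  case (Cons a as)
  have u: "u \<in> weyl" using Cons.prems(1) by (rule minrep_weyl)
  have a: "a \<in> pos_roots" "0 < ip lam a" "weyl_length (u \<circ> reflect a) = weyl_length u + 1"
    using Cons.prems by auto
  have ua: "u a \<in> pos_roots" using weyl_image_pos[OF u a(1)] a(3) by simp
  have "- (u \<circ> reflect a) lam \<in> orbit (- lam)"
    using mem_orbit weyl_comp_reflect[OF u a(1)] by blast
  moreover have "t * ip (- (u \<circ> reflect a) lam) (coroot (u a)) \<in> \<int>"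
    using edge_orbit_step(3)[OF u a(1,2) ua] Cons.prems(3) by (simp add: integral_at_def)
  ultimately have step: "orbit_less_at (- lam) t (- u lam) (- (u \<circ> reflect a) lam)"
    unfolding orbit_less_at_def
    using edge_orbit_step(2)[OF u a(1,2) ua] cover_orbit_cover[OF Cons.prems(1) a] ua
    by (intro tranclp.r_into_trancl conjI bexI[of _ "u a"]) simp_all
  show ?case
  proof (cases "as = []")
    case True
    then show ?thesis using step by simp
  next
    case False
    have "orbit_less_at (- lam) t (- (u \<circ> reflect a) lam) (- path_end (u \<circ> reflect a) as lam)"
      using Cons.IH[OF minrep_step[OF Cons.prems(1) a]] Cons.prems False by simp
    with step show ?thesis unfolding orbit_less_at_def by (simp add: tranclp_trans)
  qed
qed simp

lemma orbit_less_at_imp_less: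
  assumes "orbit_less_at (- lam) t x y"
  shows "orbit_less (- lam) x y"
  using assms unfolding orbit_less_at_def
proof (induction rule: tranclp_induct)
  case (base y)
  then show ?case by (elim conjE bexE) (simp add: orbit_cover_def)
next
  case (step y z)
  from step.hyps(2) have "orbit_less (- lam) y z" by (elim conjE bexE) (simp add: orbit_cover_def)
  then show ?case using step.IH orbit_less_trans by blast
qed

subsection \<open>Lifting orbit chains to paths\<close>

text \<open>The smaller of \<open>x\<close> and \<open>srefl p x\<close> in the orbit order. Its
  monotonicity is the orbit form of the lifting property of Bruhat order.\<close>

definition lower :: "nat \<Rightarrow> 'a \<Rightarrow> 'a" where
  "lower p x = (if 0 < ip x (simple p) then srefl p x else x)"

lemma coroot_weyl: "w \<in> weyl \<Longrightarrow> coroot (w a) = w (coroot a)"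
  by (simp add: coroot_def weyl_isometry linear_scale[OF weyl_linear])

lemma orbit_step_srefl:
  assumes "p < r" "x \<in> orbit (- lam)" "0 < ip x (simple p)"
  shows "orbit_step (srefl p x) x"
  unfolding orbit_step_def
  using assms simple_pos_root ip_coroot_pos_iff[OF simple_real_root] by blast

lemma ip_srefl_simple: "p < r \<Longrightarrow> ip (srefl p x) (simple p) = - ip x (simple p)"
  using simple_pos[of p] by (simp add: reflect_def ip_coroot)

lemma lower_mono_step:
  assumes p: "p < r" and step: "orbit_step x y"
  shows "orbit_step\<^sup>*\<^sup>* (lower p x) (lower p y)"
proof -
  obtain a where y: "y \<in> orbit (- lam)" and a: "a \<in> pos_roots" "0 < ip y (coroot a)"
    and x: "x = reflect a y"
    using step unfolding orbit_step_def by blast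
  have xo: "x \<in> orbit (- lam)" using step orbit_step_orbit by blast
  have s: "srefl p \<in> weyl" using srefl_weyl[OF p] .
  have ss: "srefl p (srefl p z) = z" for z by (simp add: reflect_reflect_root simple_real_root p)
  show ?thesis
  proof (cases "a = simple p")
    case True
    then have "0 < ip y (simple p)" using a ip_coroot_pos_iff pos_root_real by blast
    then have "lower p y = x" "lower p x = x"
      using x True ip_srefl_simple[OF p, of y] by (simp_all add: lower_def)
    then show ?thesis by simp
  next
    case False
    then have sa: "srefl p a \<in> pos_roots" using simple_reflect_pos p a by blast
    have "srefl p x = reflect (srefl p a) (srefl p y)"
      using reflect_conj_comp[OF s, of a] x by (metis comp_apply)
    moreover have "0 < ip (srefl p y) (coroot (srefl p a))"
      using a(2) by (simp add: coroot_weyl[OF s] weyl_isometry[OF s])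
    moreover have "srefl p y \<in> orbit (- lam)"
      using orbit_reflect[OF y simple_real_root[OF p]] .
    \<comment> \<open>Away from \<open>simple p\<close>, the reflection \<open>srefl p\<close>
      preserves the relation; each sign pattern below combines \<open>st\<close> or the given step
      with at most one more step.\<close>
    ultimately have st: "orbit_step (srefl p x) (srefl p y)" unfolding orbit_step_def using sa by blast
    consider "0 < ip x (simple p)" "0 < ip y (simple p)" | "0 < ip x (simple p)" "\<not> 0 < ip y (simple p)"
      | "ip x (simple p) = 0" "0 < ip y (simple p)" | "ip x (simple p) < 0" "0 < ip y (simple p)"
      | "\<not> 0 < ip x (simple p)" "\<not> 0 < ip y (simple p)" by linarith
    then show ?thesis
    proof cases
      case 1
      then show ?thesis using st by (simp add: lower_def)
    next
      case 2
      then have "orbit_step (srefl p x) x" using orbit_step_srefl p xo by blast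
      then show ?thesis using step 2 by (simp add: lower_def)
    next
      case 3
      then have "srefl p x = x" by (simp add: reflect_def ip_coroot)
      then show ?thesis using st 3 by (simp add: lower_def)
    next
      case 4
      then have "orbit_step (srefl p (srefl p x)) (srefl p x)"
        using orbit_step_srefl[OF p orbit_reflect[OF xo simple_real_root[OF p]]]
        by (simp add: ip_srefl_simple[OF p])
      then have "orbit_step x (srefl p x)" by (simp add: ss)
      then show ?thesis using st 4 by (simp add: lower_def)
    next
      case 5
      then show ?thesis using step by (simp add: lower_def)
    qed
  qed
qed

lemma lower_mono:
  assumes "p < r"
  shows "orbit_step\<^sup>*\<^sup>* x y \<Longrightarrow> orbit_step\<^sup>*\<^sup>* (lower p x) (lower p y)"
proof (induction rule: rtranclp_induct)
  case (step y z)
  then show ?case using lower_mono_step[OF assms] by (meson rtranclp_trans)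
qed simp

lemma sat_path_translate:
  assumes p: "p < r" and w: "w \<in> weyl" and sat: "sat_path w as" and av: "avoids p w as"
    and asc: "pull p w \<in> pos_roots" "pull p (path_end w as) \<in> pos_roots"
  shows "sat_path (srefl p \<circ> w) as"
proof (rule up_path_sat)
  show "srefl p \<circ> w \<in> weyl" using srefl_comp_weyl[OF p w] .
  show "up_path (srefl p \<circ> w) as"
    using up_path_translate[OF p w sat_imp_up_path[OF w sat] av] .
  show "weyl_length (path_end (srefl p \<circ> w) as) \<le> weyl_length (srefl p \<circ> w) + length as"
    using length_srefl_up[OF p w asc(1)] length_srefl_up[OF p sat_path_end_weyl[OF w sat] asc(2)]
      sat_path_length[OF sat] by (simp add: path_end_comp)
qed

lemma minrep_srefl:
  assumes p: "p < r" and u: "minrep u" and neq: "ip (u lam) (simple p) \<noteq> 0"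
  shows "minrep (srefl p \<circ> u)"
  unfolding minrep_def
proof (intro conjI allI impI)
  have uw: "u \<in> weyl" using u by (rule minrep_weyl)
  show "srefl p \<circ> u \<in> weyl" using srefl_comp_weyl[OF p uw] .
  fix q assume q: "q < r" and zero: "ip lam (simple q) = 0"
  have "u (simple q) \<in> pos_roots" using u q zero by (simp add: minrep_def)
  moreover have "u (simple q) \<noteq> simple p"
    using neq zero weyl_isometry[OF uw] by metis
  ultimately show "(srefl p \<circ> u) (simple q) \<in> pos_roots"
    using simple_reflect_pos[OF p] by (simp add: o_apply)
qed

lemma pull_positive:
  assumes "p < r" "w \<in> weyl" "0 < ip (w lam) (simple p)"
  shows "pull p w \<in> pos_roots" "0 < ip lam (pull p w)"
proof -
  show pos: "0 < ip lam (pull p w)" using assms by (simp add: ip_pull)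
  show "pull p w \<in> pos_roots"
    using pull_root[OF assms(1,2)] root_cases ip_lam_pos_root pos
    by (metis ip_simps(10) neg_0_le_iff_le not_le)
qed

lemma extend_to_srefl:
  assumes p: "p < r" and w: "w \<in> weyl" and sat: "sat_path w as"
    and fin: "\<forall>a\<in>set as. 0 < ip lam a" and pos: "0 < ip (path_end w as lam) (simple p)"
  obtains a where "sat_path w (as @ [a])" "0 < ip lam a"
    "path_end w (as @ [a]) = srefl p \<circ> path_end w as"
proof -
  have e: "path_end w as \<in> weyl" using sat_path_end_weyl[OF w sat] .
  note a = pull_positive[OF p e pos]
  have "path_end w as \<circ> reflect (pull p (path_end w as)) = srefl p \<circ> path_end w as"
    using srefl_comp[OF e] by simp
  moreover from this have "sat_path w (as @ [pull p (path_end w as)])"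
    using sat a(1) length_srefl_up[OF p e a(1)] by (simp add: sat_path_append)
  ultimately show ?thesis using that a(2) by simp
qed

text \<open>Without a \<open>srefl p\<close> edge the whole path is translated. Otherwise the
  translated prefix ends just beyond the first such edge, the rest continues unchanged to the old
  end, and one appended edge applies \<open>srefl p\<close> there.\<close>

lemma path_exists_from_descent:
  assumes p: "p < r" and u: "u \<in> weyl" and asc: "pull p u \<in> pos_roots"
    and sat: "sat_path u as" and fin: "\<forall>a\<in>set as. 0 < ip lam a"
    and pos: "0 < ip (path_end u as lam) (simple p)"
  shows "\<exists>bs. sat_path (srefl p \<circ> u) bs \<and> (\<forall>a\<in>set bs. 0 < ip lam a) \<and>
    path_end (srefl p \<circ> u) bs = srefl p \<circ> path_end u as"
proof (cases "avoids p u as")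
  case True
  have "pull p (path_end u as) \<in> pos_roots"
    using pull_positive(1)[OF p sat_path_end_weyl[OF u sat] pos] .
  then show ?thesis
    using sat_path_translate[OF p u sat True asc] fin by (auto simp: path_end_comp)
next
  case False
  then obtain ps a qs where as: "as = ps @ a # qs" and a: "path_end u ps a = simple p"
    and av: "avoids p u ps"
    using not_avoids_first by blast
  have satp: "sat_path u ps" and satq: "sat_path (path_end u ps \<circ> reflect a) qs" and aroot: "a \<in> pos_roots"
    using sat by (simp_all add: as sat_path_append)
  have v: "path_end u ps \<in> weyl" using sat_path_end_weyl[OF u satp] .
  have pv: "pull p (path_end u ps) \<in> pos_roots" using aroot a pull_eq_iff[OF v] by metis
  have "path_end (srefl p \<circ> u) ps = path_end u ps \<circ> reflect a"
    by (simp add: path_end_comp used_reflection[OF v a])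
  then have sat': "sat_path (srefl p \<circ> u) (ps @ qs)"
    and e: "path_end (srefl p \<circ> u) (ps @ qs) = path_end u as"
    using sat_path_translate[OF p u satp av asc pv] satq by (simp_all add: sat_path_append as)
  have "\<forall>a\<in>set (ps @ qs). 0 < ip lam a" using fin as by auto
  from extend_to_srefl[OF p srefl_comp_weyl[OF p u] sat' this] pos e
  obtain b where "sat_path (srefl p \<circ> u) ((ps @ qs) @ [b])" "0 < ip lam b"
    "path_end (srefl p \<circ> u) ((ps @ qs) @ [b]) = srefl p \<circ> path_end u as"
    by metis
  then show ?thesis using fin as by (intro exI[of _ "(ps @ qs) @ [b]"]) auto
qed

text \<open>The target is lowered by a left descent \<open>p\<close> of \<open>v\<close>. If
  \<open>srefl p\<close> strictly lowers the start too, the path found for the lowered pair is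
  carried back; otherwise the start is kept and one edge is appended. If \<open>srefl p\<close>
  fixes the target point, only \<open>v\<close> is replaced.\<close>

lemma path_exists:
  assumes "v \<in> weyl" "minrep u" "orbit_step\<^sup>*\<^sup>* (- u lam) (- v lam)"
  shows "\<exists>as. sat_path u as \<and> (\<forall>a\<in>set as. 0 < ip lam a) \<and> path_end u as lam = v lam"
  using assms
proof (induction "weyl_length v" arbitrary: v u rule: less_induct)
  case less
  have uw: "u \<in> weyl" using less.prems(2) by (rule minrep_weyl)
  show ?case
  proof (cases "v = id")
    case True
    have "\<not> orbit_step x (- lam)" for x
    proof
      assume "orbit_step x (- lam)"
      then obtain a where "a \<in> pos_roots" "0 < ip (- lam) a"
        unfolding orbit_step_def using ip_coroot_pos_iff pos_root_real by blast
      then show False using ip_lam_pos_root[of a] by simp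
    qed
    then have "- u lam = - lam"
      using less.prems(3) True by (auto elim: rtranclp.cases)
    then show ?thesis using True by (intro exI[of _ "[]"]) simp
  next
    case False
    obtain p where p: "p < r" "- pull p v \<in> pos_roots" using left_descent[OF less.prems(1) False] .
    have sv: "srefl p \<circ> v \<in> weyl" "weyl_length (srefl p \<circ> v) < weyl_length v"
      using srefl_comp_weyl[OF p(1) less.prems(1)] length_srefl_down[OF p(1) less.prems(1) p(2)]
      by simp_all
    have le: "ip (v lam) (simple p) \<le> 0"
      using ip_lam_pos_root[OF p(2)] less.prems(1) by (simp add: ip_pull)
    show ?thesis
    proof (cases "ip (v lam) (simple p) = 0")
      case True
      then have "(srefl p \<circ> v) lam = v lam" by (simp add: o_apply reflect_def ip_coroot)
      then show ?thesis using less.hyps[OF sv(2,1) less.prems(2)] less.prems(3) by simp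
    next
      case False
      with le have neg: "ip (v lam) (simple p) < 0" by simp
      have lv: "lower p (- v lam) = - (srefl p \<circ> v) lam"
        using neg by (simp add: lower_def o_apply reflect_minus)
      note low = lower_mono[OF p(1) less.prems(3), unfolded lv]
      have pos: "0 < ip ((srefl p \<circ> v) lam) (simple p)"
        using neg by (simp add: o_apply ip_srefl_simple[OF p(1)])
      have ssv: "srefl p ((srefl p \<circ> v) lam) = v lam"
        by (simp add: o_apply reflect_reflect_root simple_real_root p)
      show ?thesis
      proof (cases "ip (u lam) (simple p) < 0")
        case True
        have su: "minrep (srefl p \<circ> u)" using minrep_srefl[OF p(1) less.prems(2)] True by simp
        have "lower p (- u lam) = - (srefl p \<circ> u) lam"
          using True by (simp add: lower_def o_apply reflect_minus)
        with low obtain as where as: "sat_path (srefl p \<circ> u) as" "\<forall>a\<in>set as. 0 < ip lam a"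
          "path_end (srefl p \<circ> u) as lam = (srefl p \<circ> v) lam"
          using less.hyps[OF sv(2,1) su] by auto
        have "pull p (srefl p \<circ> u) \<in> pos_roots"
          using pull_negative(1)[OF p(1) uw True] by (simp add: pull_srefl p uw)
        from path_exists_from_descent[OF p(1) minrep_weyl[OF su] this as(1,2)] pos as(3)
        show ?thesis by (metis srefl_srefl[OF p(1)] comp_apply ssv)
      next
        case False
        then have "lower p (- u lam) = - u lam" by (simp add: lower_def)
        with low obtain as where as: "sat_path u as" "\<forall>a\<in>set as. 0 < ip lam a"
          "path_end u as lam = (srefl p \<circ> v) lam"
          using less.hyps[OF sv(2,1) less.prems(2)] by auto
        obtain a where "sat_path u (as @ [a])" "0 < ip lam a"
          "path_end u (as @ [a]) = srefl p \<circ> path_end u as"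
          using extend_to_srefl[OF p(1) uw as(1,2)] pos as(3) by metis
        then show ?thesis using as ssv
          by (intro exI[of _ "as @ [a]"]) (auto simp del: path_end_append simp: o_apply)
      qed
    qed
  qed
qed

text \<open>The lifted path has one edge, since a further vertex would give a point strictly in
  between. Its root is \<open>a\<close> because both reflections displace \<open>y\<close> by the
  same nonzero vector and positive roots on one line coincide.\<close>

lemma orbit_cover_lift:
  assumes u: "minrep u" and cov: "orbit_cover (- lam) (- u lam) y"
    and a: "a \<in> pos_roots" "- u lam = reflect a y"
  obtains b where "sat_path u [b]" "0 < ip lam b" "y = - (u \<circ> reflect b) lam" "u b = a"
proof -
  have uw: "u \<in> weyl" using u by (rule minrep_weyl)
  have less: "orbit_less (- lam) (- u lam) y" using cov by (simp add: orbit_cover_def)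
  then obtain v where v: "v \<in> weyl" "y = - v lam" using orbit_less_orbit mem_orbit by metis
  from less have "orbit_step\<^sup>*\<^sup>* (- u lam) (- v lam)"
    unfolding orbit_less_eq v(2) by (rule tranclp_into_rtranclp)
  from path_exists[OF v(1) u this] obtain bs where bs: "sat_path u bs"
    "\<forall>a\<in>set bs. 0 < ip lam a" "path_end u bs lam = v lam" by blast
  have "bs \<noteq> []" using bs(3) v(2) less orbit_less_irrefl by auto
  then obtain b cs where b: "bs = b # cs" by (cases bs) auto
  have bp: "b \<in> pos_roots" "0 < ip lam b" "weyl_length (u \<circ> reflect b) = weyl_length u + 1"
    using bs b by auto
  have ub: "u b \<in> pos_roots" using weyl_image_pos[OF uw bp(1)] bp(3) by simp
  have first: "orbit_less (- lam) (- u lam) (- (u \<circ> reflect b) lam)"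
    using cover_orbit_cover[OF u bp] by (simp add: orbit_cover_def)
  have cs: "cs = []"
  proof (rule ccontr)
    assume "cs \<noteq> []"
    \<comment> \<open>The value \<open>0\<close> makes every label integral, so only the strict
      order remains.\<close>
    then have "orbit_less_at (- lam) 0 (- (u \<circ> reflect b) lam) (- path_end (u \<circ> reflect b) cs lam)"
      using path_orbit_less_at[OF minrep_step[OF u bp], of cs 0] bs b by (simp add: integral_at_def)
    then have "orbit_less (- lam) (- (u \<circ> reflect b) lam) y"
      using orbit_less_at_imp_less bs(3) b v(2) by simp
    then show False using first cov unfolding orbit_cover_def by blast
  qed
  have y: "y = - (u \<circ> reflect b) lam" using bs(3) b cs v(2) by simp
  have "- u lam = reflect (u b) y" using edge_orbit_step(2)[OF uw bp(1,2) ub] y by simp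
  then have eq: "ip y (coroot a) *\<^sub>R a = ip y (coroot (u b)) *\<^sub>R u b"
    using a(2) by (simp add: reflect_def)
  have "ip y (coroot a) \<noteq> 0"
    using a(2) less orbit_less_irrefl by (auto simp: reflect_def)
  then have "a = inverse (ip y (coroot a)) *\<^sub>R (ip y (coroot a) *\<^sub>R a)" by simp
  also have "\<dots> = (inverse (ip y (coroot a)) * ip y (coroot (u b))) *\<^sub>R u b"
    unfolding eq by simp
  finally have "a = (inverse (ip y (coroot a)) * ip y (coroot (u b))) *\<^sub>R u b" .
  then have "a = u b" by (rule proportional_pos_roots[OF a(1) ub])
  then show ?thesis using that[of b] bp y by simp
qed

text \<open>Covers are lifted one at a time, which is possible because each lifted path ends again
  at a minimal representative.\<close>

lemma orbit_less_at_lift: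
  assumes "orbit_less_at (- lam) t x y" "minrep u" "x = - u lam"
  shows "\<exists>as. sat_path u as \<and> (\<forall>a\<in>set as. 0 < ip lam a \<and> integral_at t a) \<and> as \<noteq> [] \<and>
    y = - path_end u as lam"
  using assms(1) unfolding orbit_less_at_def
proof (induction rule: tranclp_induct)
  case (base y)
  then obtain a where a: "a \<in> pos_roots" "x = reflect a y" "orbit_cover (- lam) x y"
    "t * ip y (coroot a) \<in> \<int>" by blast
  obtain b where b: "sat_path u [b]" "0 < ip lam b" "y = - (u \<circ> reflect b) lam" "u b = a"
    using orbit_cover_lift[OF assms(2)] a assms(3) by metis
  have "ip y (coroot a) = ip lam (coroot b)"
    using edge_orbit_step(3)[OF minrep_weyl[OF assms(2)] _ b(2)] b a(1) by simp
  then have "integral_at t b" using a(4) by (simp add: integral_at_def)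
  then show ?case using b by (intro exI[of _ "[b]"]) simp
next
  case (step y z)
  then obtain as where as: "sat_path u as" "\<forall>a\<in>set as. 0 < ip lam a \<and> integral_at t a" "as \<noteq> []"
    "y = - path_end u as lam" by blast
  let ?w = "path_end u as"
  have w: "minrep ?w" using minrep_path[OF assms(2) as(1)] as(2) by blast
  from step.hyps(2) obtain a where a: "a \<in> pos_roots" "y = reflect a z" "orbit_cover (- lam) y z"
    "t * ip z (coroot a) \<in> \<int>" by blast
  obtain b where b: "sat_path ?w [b]" "0 < ip lam b" "z = - (?w \<circ> reflect b) lam" "?w b = a"
    using orbit_cover_lift[OF w] a as(4) by metis
  have "ip z (coroot a) = ip lam (coroot b)"
    using edge_orbit_step(3)[OF minrep_weyl[OF w] _ b(2)] b a(1) by simp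
  then have "integral_at t b" using a(4) by (simp add: integral_at_def)
  then show ?case using b as by (intro exI[of _ "as @ [b]"]) (auto simp: sat_path_append)
qed

lemma lam_orbit_le: "v \<in> weyl \<Longrightarrow> orbit_step\<^sup>*\<^sup>* (- lam) (- v lam)"
proof (induction "weyl_length v" arbitrary: v rule: less_induct)
  case less
  show ?case
  proof (cases "v = id")
    case False
    obtain p where p: "p < r" "- pull p v \<in> pos_roots" using left_descent[OF less.prems False] .
    have "weyl_length (srefl p \<circ> v) < weyl_length v"
      using length_srefl_down[OF p(1) less.prems p(2)] by simp
    from less.hyps[OF this srefl_comp_weyl[OF p(1) less.prems]]
    have IH: "orbit_step\<^sup>*\<^sup>* (- lam) (srefl p (- v lam))" by (simp add: o_apply reflect_minus)
    have le: "0 \<le> ip (- v lam) (simple p)"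
      using ip_lam_pos_root[OF p(2)] less.prems by (simp add: ip_pull)
    show ?thesis
    proof (cases "ip (- v lam) (simple p) = 0")
      case True
      then have "srefl p (- v lam) = - v lam" by (simp add: reflect_def ip_coroot)
      then show ?thesis using IH by simp
    next
      case False
      then have "orbit_step (srefl p (- v lam)) (- v lam)"
        using orbit_step_srefl[OF p(1)] le mem_orbit less.prems by (metis order_le_less)
      then show ?thesis using IH by (rule rtranclp.rtrancl_into_rtrancl[rotated])
    qed
  qed simp
qed

end

section \<open>Integrality of root pairings and finiteness of inversion sets\<close>

context kac_moody_roots
begin

lemma root_cartan_int:
  assumes "b \<in> real_roots" "y \<in> real_roots"
  shows "ip b (coroot y) \<in> \<int>"
proof -
  obtain ps p where y: "y = simple_word ps (simple p)" "set ps \<subseteq> {..<r}" "p < r"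
    using assms(2) by (auto simp: real_roots_def)
  let ?w = "simple_word ps"
  have w: "?w \<in> weyl" using y(2) by (rule word_in_weyl)
  have "coroot y = ?w (coroot (simple p))"
    by (simp add: y(1) coroot_def weyl_isometry[OF w] linear_scale[OF weyl_linear[OF w]])
  then have eq: "ip b (coroot y) = ip (inv w b) (coroot (simple p))" if "w = ?w" for w
    using weyl_ip_inv[OF weyl_inv[OF w], of b] w that by (simp add: weyl_inv_inv)
  have "inv ?w b \<in> real_roots" using weyl_root[OF weyl_inv[OF w] assms(1)] .
  then obtain c :: "nat \<Rightarrow> real" where c: "\<forall>q<r. c q \<in> \<int>" "inv ?w b = (\<Sum>q<r. c q *\<^sub>R simple q)"
    using root_int_combination by metis
  have lin: "linear (\<lambda>v. ip v (coroot (simple p)))" using bilinear by (simp add: bilinear_def)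
  have "ip b (coroot y) = (\<Sum>q<r. c q * ip (simple q) (coroot (simple p)))"
    unfolding eq[OF refl] c(2) by (simp add: linear_sum[OF lin])
  then show ?thesis using c(1) cartan_int'[OF _ y(3)] by (auto intro!: Ints_sum Ints_mult)
qed

text \<open>Prepending a letter creates at most one new inversion, since a simple reflection makes
  only its own simple root negative. This finiteness lets \<open>sort_path\<close> choose a maximal
  last label.\<close>

lemma finite_word_inversions:
  "set ps \<subseteq> {..<r} \<Longrightarrow> finite {a \<in> pos_roots. - simple_word ps a \<in> pos_roots}"
proof (induction ps)
  case Nil
  have "{a \<in> pos_roots. - simple_word [] a \<in> pos_roots} = {}" using not_pos_neg by auto
  then show ?case by (simp only: finite.emptyI)
next
  case (Cons p ps)
  let ?w = "simple_word ps"
  have p: "p < r" and ps: "set ps \<subseteq> {..<r}" using Cons.prems by auto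
  have w: "?w \<in> weyl" using ps by (rule word_in_weyl)
  have "{a \<in> pos_roots. - simple_word (p # ps) a \<in> pos_roots} \<subseteq>
    insert (inv ?w (simple p)) {a \<in> pos_roots. - ?w a \<in> pos_roots}"
  proof
    fix a assume a: "a \<in> {a \<in> pos_roots. - simple_word (p # ps) a \<in> pos_roots}"
    show "a \<in> insert (inv ?w (simple p)) {a \<in> pos_roots. - ?w a \<in> pos_roots}"
    proof (cases "?w a \<in> pos_roots")
      case True
      have "- reflect (simple p) (?w a) \<in> pos_roots" using a by (simp add: o_apply)
      then have "?w a = simple p" using simple_reflect_pos[OF p True] not_pos_neg by blast
      then show ?thesis using weyl_inv_left[OF w, of a] by simp
    next
      case False
      then show ?thesis using a weyl_root[OF w] root_cases pos_root_real by blast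
    qed
  qed
  then show ?case by (rule finite_subset) (rule finite.insertI[OF Cons.IH[OF ps]])
qed

lemma finite_inversions: "w \<in> weyl \<Longrightarrow> finite {a \<in> pos_roots. - w a \<in> pos_roots}"
  using finite_word_inversions by (metis weyl_word)

end

context dominant_data
begin

subsection \<open>Sorting paths\<close>

lemma integral_at_uminus: "integral_at t (- a) \<longleftrightarrow> integral_at t a"
proof -
  have "coroot (- a) = - coroot a" by (simp add: coroot_def)
  then show ?thesis by (simp add: integral_at_def)
qed

text \<open>The coroot of \<open>reflect b y\<close> is the coroot of \<open>y\<close> minus
  \<open>ip b (coroot y)\<close> times the coroot of \<open>b\<close>, and that factor is an
  integer.\<close>

lemma integral_at_reflect:
  assumes "b \<in> real_roots" "y \<in> real_roots" "integral_at t b" "integral_at t y"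
  shows "integral_at t (reflect b y)"
proof -
  have "ip lam (coroot (reflect b y)) = ip lam (reflect b (coroot y))"
    using coroot_weyl[OF reflect_weyl[OF assms(1)]] by simp
  also have "\<dots> = ip lam (coroot y) - ip (coroot y) (coroot b) * ip lam b"
    by (simp add: reflect_def)
  also have "ip (coroot y) (coroot b) * ip lam b = ip b (coroot y) * ip lam (coroot b)"
    using symmetric[of b "coroot y"] by (simp add: ip_coroot[of _ b])
  finally have eq: "ip lam (coroot (reflect b y)) =
      ip lam (coroot y) - ip b (coroot y) * ip lam (coroot b)" .
  have "t * ip lam (coroot (reflect b y)) =
      t * ip lam (coroot y) - ip b (coroot y) * (t * ip lam (coroot b))"
    unfolding eq by (simp add: algebra_simps)
  then show ?thesis
    using assms root_cartan_int[OF assms(1,2)] by (simp add: integral_at_def)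
qed

text \<open>Any other edge would translate to an upward edge whose start has length one more than
  \<open>w\<close> and whose end has the length of \<open>w\<close>.\<close>

lemma used_at_ascent_descent:
  assumes p: "p < r" and w: "w \<in> weyl" and sat: "sat_path w [a]"
    and asc: "pull p w \<in> pos_roots" and desc: "- pull p (w \<circ> reflect a) \<in> pos_roots"
  shows "pull p w = a"
proof (rule ccontr)
  assume "pull p w \<noteq> a"
  then have "avoids p w [a]" using pull_eq_iff[OF w] by simp
  from up_path_length[OF srefl_comp_weyl[OF p w] up_path_translate[OF p w sat_imp_up_path[OF w sat] this]]
  have "weyl_length (srefl p \<circ> w) + 1 \<le> weyl_length (srefl p \<circ> (w \<circ> reflect a))"
    by (simp add: comp_assoc)
  moreover have "w \<circ> reflect a \<in> weyl" using w sat by (simp add: weyl_comp_reflect)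
  ultimately show False
    using length_srefl_up[OF p w asc] length_srefl_down[OF p _ desc] sat by simp
qed

text \<open>The second edge is no \<open>srefl p\<close> edge either, because it would end at a
  descent of \<open>p\<close>.\<close>

lemma translate_pair:
  assumes p: "p < r" and w: "w \<in> weyl" and sat: "sat_path w [b, g]"
    and asc: "pull p w \<in> pos_roots" and asc': "pull p (path_end w [b, g]) \<in> pos_roots"
    and neq: "pull p w \<noteq> b"
  shows "sat_path (srefl p \<circ> w) [b, g]"
proof (rule sat_path_translate[OF p w sat _ asc asc'])
  let ?x = "w \<circ> reflect b"
  have b: "b \<in> pos_roots" and g: "g \<in> pos_roots" using sat by simp_all
  have x: "?x \<in> weyl" using weyl_comp_reflect[OF w b] .
  have "?x g \<noteq> simple p"
  proof
    assume "?x g = simple p"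
    then have "pull p ?x = g" using pull_eq_iff[OF x] by blast
    then have "pull p (path_end w [b, g]) = - g"
      using g by (simp add: pull_reflect[OF x] pos_root_real reflect_self root_ip_neq)
    then show False using asc' g not_pos_neg by simp
  qed
  then show "avoids p w [b, g]" using neq pull_eq_iff[OF w] by simp
qed

text \<open>
  A decreasing pair of labels is traded for an increasing one by induction on the length of the
  endpoint. The claim \<open>lt g g'\<close> makes the process of sorting a path terminate.
\<close>

lemma exchange:
  assumes "u \<in> weyl" "sat_path u [b, g]" "lt g b" "integral_at t b" "integral_at t g"
  shows "\<exists>b' g'. sat_path u [b', g'] \<and> path_end u [b', g'] = path_end u [b, g] \<and>
    lt b' g' \<and> lt g g' \<and> integral_at t b' \<and> integral_at t g'"
  using assms
proof (induction "weyl_length (path_end u [b, g])" arbitrary: u b g rule: less_induct)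
  case less
  note u = less.prems(1) and gb = less.prems(3) and int = less.prems(4,5)
  define x where "x = u \<circ> reflect b"
  define v where "v = x \<circ> reflect g"
  have pe: "path_end u [b, g] = v" by (simp add: x_def v_def)
  have b: "b \<in> pos_roots" and g: "g \<in> pos_roots"
    and lx: "weyl_length x = weyl_length u + 1" and lv: "weyl_length v = weyl_length x + 1"
    using less.prems(2) by (simp_all add: x_def v_def)
  then have br: "b \<in> real_roots" and gr: "g \<in> real_roots" by (simp_all add: pos_root_real)
  have x: "x \<in> weyl" using u b unfolding x_def by (rule weyl_comp_reflect)
  have v: "v \<in> weyl" using x g unfolding v_def by (rule weyl_comp_reflect)
  have "v \<noteq> id" using lv weyl_length_le[of "[]"] by auto
  then obtain p where p: "p < r" and vd: "- pull p v \<in> pos_roots" using left_descent[OF v] by blast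
  have px: "pull p x = reflect b (pull p u)" using u br by (simp add: x_def pull_reflect)
  have pv: "pull p v = reflect g (pull p x)" using x gr by (simp add: v_def pull_reflect)
  have ur: "pull p u \<in> real_roots" using pull_root[OF p u] .
  have pu: "pull p u = reflect b (pull p x)" using px br by (simp add: reflect_reflect_root)
  have su: "srefl p \<circ> u \<in> weyl" and sx: "srefl p \<circ> x \<in> weyl" and sv: "srefl p \<circ> v \<in> weyl"
    using srefl_comp_weyl[OF p] u x v by blast+
  have lsv: "weyl_length v = weyl_length (srefl p \<circ> v) + 1" using length_srefl_down[OF p v vd] .
  have up: "up_path u [b, g]" using sat_imp_up_path[OF u less.prems(2)] .
  \<comment> \<open>The letters record ascent (A) or descent (D) of \<open>p\<close> at
    \<open>u\<close> and at the middle element \<open>x\<close>; at \<open>v\<close> it is a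
    descent.\<close>
  consider (AA) "pull p u \<in> pos_roots" "pull p x \<in> pos_roots"
    | (AD) "pull p u \<in> pos_roots" "- pull p x \<in> pos_roots"
    | (DA) "- pull p u \<in> pos_roots" "pull p x \<in> pos_roots"
    | (DD) "- pull p u \<in> pos_roots" "- pull p x \<in> pos_roots"
    using root_cases ur pull_root[OF p x] by metis
  then show ?case
  proof cases
    \<comment> \<open>The edge into \<open>v\<close> is a \<open>srefl p\<close> edge. It can be
      taken at the start instead, from \<open>u\<close> to \<open>srefl p \<circ> u\<close>,
      followed by the label \<open>b\<close>.\<close>
    case AA
    have g_eq: "pull p x = g"
      using used_at_ascent_descent[OF p x _ AA(2), of g] vd g lv by (simp add: v_def)
    let ?d = "pull p u"
    have d: "?d = reflect b g" using pu g_eq by simp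
    have ud: "u \<circ> reflect ?d = srefl p \<circ> u" using srefl_comp[OF u] by simp
    have vs: "v = srefl p \<circ> x" using srefl_comp[OF x] g_eq by (simp add: v_def)
    have e: "path_end u [?d, b] = v" by (simp add: ud vs x_def comp_assoc)
    have "sat_path u [?d, b]"
      using AA(1) b length_srefl_up[OF p u AA(1)] lx lv by (simp add: ud vs x_def comp_assoc)
    moreover have "lt ?d b" unfolding d using gb lt_reflect_left[OF br gr] by simp
    moreover have "integral_at t ?d" unfolding d using integral_at_reflect[OF br gr int] .
    ultimately show ?thesis using e pe gb int by metis
  next
    \<comment> \<open>The edge into \<open>x\<close> is a \<open>srefl p\<close> edge. The new path
      takes the label \<open>g\<close> first, to \<open>srefl p \<circ> v\<close>, and a
      \<open>srefl p\<close> edge last.\<close>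
    case AD
    have b_eq: "pull p u = b"
      using used_at_ascent_descent[OF p u _ AD(1), of b] AD(2) b lx by (simp add: x_def)
    have xs: "x = srefl p \<circ> u" using srefl_comp[OF u] b_eq by (simp add: x_def)
    have ug: "u \<circ> reflect g = srefl p \<circ> v"
      using srefl_srefl[OF p, of u] by (simp add: v_def xs comp_assoc[symmetric])
    let ?g = "reflect g b"
    have "pull p x = - b" using px b_eq br by (simp add: reflect_self root_ip_neq)
    then have psv: "pull p (srefl p \<circ> v) = ?g" by (simp add: pull_srefl p v pv reflect_minus)
    then have g': "?g \<in> pos_roots" using vd by (simp add: pull_srefl p v)
    have e: "u \<circ> reflect g \<circ> reflect ?g = v"
      using srefl_comp[OF sv] srefl_srefl[OF p, of v] by (simp add: ug psv)
    have "weyl_length (u \<circ> reflect g) = weyl_length u + 1" using lsv lv lx by (simp add: ug)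
    then have "sat_path u [g, ?g]" using g g' e lv lx by simp
    moreover have "lt g ?g" using gb lt_reflect_right[OF gr br] by simp
    moreover have "integral_at t ?g" using integral_at_reflect[OF gr br int(2,1)] .
    moreover have "path_end u [g, ?g] = path_end u [b, g]" using e pe by simp
    ultimately show ?thesis using int by blast
  next
    \<comment> \<open>The elements \<open>srefl p \<circ> u\<close>, \<open>u\<close>,
      \<open>x\<close> form a decreasing pair with a shorter endpoint. Its exchange is translated by
      \<open>srefl p\<close>, which takes \<open>x\<close> to \<open>v\<close>.\<close>
    case DA
    have g_eq: "pull p x = g"
      using used_at_ascent_descent[OF p x _ DA(2), of g] vd g lv by (simp add: v_def)
    have vs: "v = srefl p \<circ> x" using srefl_comp[OF x] g_eq by (simp add: v_def)
    define d where "d = - pull p u"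
    have d: "d \<in> pos_roots" "pull p (srefl p \<circ> u) = d" using DA(1) by (simp_all add: d_def pull_srefl p u)
    have dr: "d \<in> real_roots" using d(1) by (rule pos_root_real)
    have d_eq: "d = - reflect b g" using pu g_eq by (simp add: d_def)
    have sud: "srefl p \<circ> u \<circ> reflect d = u"
      using srefl_comp[OF su] srefl_srefl[OF p, of u] d(2) by simp
    have pe': "path_end (srefl p \<circ> u) [d, b] = x" by (simp add: sud x_def)
    have "weyl_length u = weyl_length (srefl p \<circ> u) + 1" using length_srefl_down[OF p u DA(1)] .
    then have sat: "sat_path (srefl p \<circ> u) [d, b]" using d(1) b lx by (simp add: sud x_def)
    have rbg: "reflect b g \<in> real_roots" using weyl_root[OF reflect_weyl[OF br] gr] .
    have bd: "lt b d"
      unfolding d_eq using gb lt_uminus_right[OF br rbg] lt_reflect_left[OF br gr] by simp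
    have intd: "integral_at t d"
      unfolding d_eq integral_at_uminus using integral_at_reflect[OF br gr int] .
    have "weyl_length (path_end (srefl p \<circ> u) [d, b]) < weyl_length (path_end u [b, g])"
      unfolding pe pe' using lv by simp
    from less.hyps[OF this su sat bd intd int(1)] obtain b' g' where IH:
      "sat_path (srefl p \<circ> u) [b', g']" "path_end (srefl p \<circ> u) [b', g'] = x"
      "lt b' g'" "lt b g'" "integral_at t b'" "integral_at t g'" unfolding pe' by blast
    have g': "g' \<in> pos_roots" using IH(1) by simp
    \<comment> \<open>A \<open>srefl p\<close> edge in front would lead to \<open>u\<close> and
      leave \<open>b\<close> as second label, against \<open>lt b g'\<close>.\<close>
    have neq: "pull p (srefl p \<circ> u) \<noteq> b'"
    proof
      assume "pull p (srefl p \<circ> u) = b'"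
      then have "u \<circ> reflect g' = u \<circ> reflect b" using IH(2) d(2) sud by (simp add: x_def)
      then have "reflect g' = reflect b"
        using u by (metis comp_apply ext weyl_inv_left)
      then have "g' = b" using reflect_inj g' b by blast
      then show False using IH(4) lt_irrefl by blast
    qed
    have "sat_path (srefl p \<circ> (srefl p \<circ> u)) [b', g']"
      using translate_pair[OF p su IH(1) _ _ neq] d DA(2) IH(2) by simp
    then have "sat_path u [b', g']" by (simp add: srefl_srefl[OF p])
    moreover have "path_end u [b', g'] = v"
      using path_end_comp[of "srefl p" "srefl p \<circ> u" "[b', g']"]
      by (simp only: srefl_srefl[OF p] IH(2) vs)
    moreover have "lt g g'" using lt_trans[OF gb IH(4) g b g'] .
    ultimately show ?thesis using IH pe by metis
  next
    \<comment> \<open>\<open>srefl p\<close> lowers all three elements, and the pair with the same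
      labels is exchanged below.\<close>
    case DD
    have lsu: "weyl_length u = weyl_length (srefl p \<circ> u) + 1" using length_srefl_down[OF p u DD(1)] .
    have lsx: "weyl_length x = weyl_length (srefl p \<circ> x) + 1" using length_srefl_down[OF p x DD(2)] .
    have pe': "path_end (srefl p \<circ> u) [b, g] = srefl p \<circ> v"
      by (simp only: path_end_comp pe)
    have sat: "sat_path (srefl p \<circ> u) [b, g]"
      using b g lsu lsx lsv lx lv by (simp add: x_def v_def comp_assoc)
    have "weyl_length (path_end (srefl p \<circ> u) [b, g]) < weyl_length (path_end u [b, g])"
      unfolding pe pe' using lsv by simp
    from less.hyps[OF this su sat gb int] obtain b' g' where IH:
      "sat_path (srefl p \<circ> u) [b', g']" "path_end (srefl p \<circ> u) [b', g'] = srefl p \<circ> v"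
      "lt b' g'" "lt g g'" "integral_at t b'" "integral_at t g'" unfolding pe' by blast
    have b': "b' \<in> pos_roots" and g': "g' \<in> pos_roots" using IH(1) by simp_all
    then have b'r: "b' \<in> real_roots" and g'r: "g' \<in> real_roots" by (simp_all add: pos_root_real)
    have asc: "pull p (srefl p \<circ> u) \<in> pos_roots" "pull p (srefl p \<circ> v) \<in> pos_roots"
      using DD(1) vd by (simp_all add: pull_srefl p u v)
    show ?thesis
    proof (cases "pull p (srefl p \<circ> u) = b'")
      case False
      have "sat_path (srefl p \<circ> (srefl p \<circ> u)) [b', g']"
        using translate_pair[OF p su IH(1) _ _ False] asc IH(2) by simp
      then have "sat_path u [b', g']" by (simp add: srefl_srefl[OF p])
      moreover have "path_end u [b', g'] = v"
        using path_end_comp[of "srefl p" "srefl p \<circ> u" "[b', g']"]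
        by (simp only: srefl_srefl[OF p] IH(2))
      ultimately show ?thesis using IH pe by metis
    next
      \<comment> \<open>The exchanged path passes through \<open>u\<close>. Its second edge leads
        from there to \<open>srefl p \<circ> v\<close>, and a \<open>srefl p\<close> edge completes
        the new path.\<close>
      case True
      have pu': "pull p u = - b'" using True pull_srefl[OF p u] by (metis minus_minus)
      have sub: "srefl p \<circ> u \<circ> reflect b' = u"
        using srefl_comp[OF su] srefl_srefl[OF p, of u] True by simp
      then have ug: "u \<circ> reflect g' = srefl p \<circ> v" using IH(2) by simp
      define h where "h = pull p (srefl p \<circ> v)"
      have h: "h \<in> pos_roots" using asc(2) by (simp add: h_def)
      have h_eq: "h = - reflect g' b'"
        using pull_reflect[OF u g'r, of p] by (simp add: h_def ug[symmetric] pu' reflect_minus)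
      have e: "u \<circ> reflect g' \<circ> reflect h = v"
        using srefl_comp[OF sv] srefl_srefl[OF p, of v] by (simp add: ug h_def)
      have "sat_path u [g', h]" using g' h e ug lsv lv lx by simp
      moreover have rg'b': "reflect g' b' \<in> real_roots" using weyl_root[OF reflect_weyl[OF g'r] b'r] .
      have "lt g' h"
        unfolding h_eq using IH(3) lt_uminus_right[OF g'r rg'b'] lt_reflect_left[OF g'r b'r] by simp
      moreover from this have "lt g h" using lt_trans[OF IH(4) _ g g' h] by blast
      moreover have "integral_at t h"
        unfolding h_eq integral_at_uminus using integral_at_reflect[OF g'r b'r IH(6,5)] .
      moreover have "path_end u [g', h] = path_end u [b, g]" using e pe by simp
      ultimately show ?thesis using IH(6) by blast
    qed
  qed
qed

text \<open>Among all such paths to the given end, one with maximal last label \<open>m\<close> is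
  chosen; last labels are inversions of the end, hence finitely many. Once the rest is sorted by
  induction, a preceding label not below \<open>m\<close> could be exchanged, producing a larger
  last label.\<close>

lemma sort_path:
  assumes "minrep u" "sat_path u as" "\<forall>a\<in>set as. 0 < ip lam a \<and> integral_at t a"
  shows "\<exists>bs. inc_path u bs \<and> (\<forall>a\<in>set bs. integral_at t a) \<and> path_end u bs = path_end u as"
  using assms(2,3)
proof (induction "weyl_length (path_end u as)" arbitrary: as rule: less_induct)
  case less
  let ?good = "\<lambda>cs. sat_path u cs \<and> (\<forall>a\<in>set cs. 0 < ip lam a \<and> integral_at t a) \<and>
    path_end u cs = path_end u as"
  let ?L = "{a. \<exists>ps. ?good (ps @ [a])}"
  have uw: "u \<in> weyl" using assms(1) by (rule minrep_weyl)
  have v: "path_end u as \<in> weyl" using sat_path_end_weyl[OF uw less.prems(1)] .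
  have vmin: "minrep (path_end u as)" using minrep_path[OF assms(1)] less.prems by blast
  show ?case
  proof (cases as rule: rev_exhaust)
    case Nil
    then show ?thesis by (intro exI[of _ "[]"]) (simp add: inc_path_def)
  next
    case (snoc as' a')
    have last: "a \<in> pos_roots" "path_end u ps a \<in> pos_roots" "- path_end u as a \<in> pos_roots"
      "weyl_length (path_end u ps) < weyl_length (path_end u as)"
      if "?good (ps @ [a])" for ps a
    proof -
      have "sat_path u (ps @ [a])" using that by blast
      then have s: "sat_path u ps" "sat_path (path_end u ps) [a]" by (simp_all add: sat_path_append)
      have w: "path_end u ps \<in> weyl" using sat_path_end_weyl[OF uw s(1)] .
      show a: "a \<in> pos_roots" "path_end u ps a \<in> pos_roots"
        using sat_imp_up_path[OF w s(2)] by simp_all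
      have e: "path_end u as = path_end u ps \<circ> reflect a" using that by simp
      show "- path_end u as a \<in> pos_roots"
        unfolding e using a w
        by (simp add: o_apply reflect_self root_ip_neq pos_root_real weyl_minus)
      show "weyl_length (path_end u ps) < weyl_length (path_end u as)" unfolding e using s(2) by simp
    qed
    have "?L \<subseteq> {a \<in> pos_roots. - path_end u as a \<in> pos_roots}" using last(1,3) by blast
    then have "finite ?L" using finite_inversions[OF v] finite_subset by blast
    moreover have "a' \<in> ?L" using less.prems snoc by blast
    then have "?L \<noteq> {}" by blast
    moreover have Lpos: "?L \<subseteq> pos_roots" using last(1) by blast
    have "asymp_on ?L lt" using lt_asym by (intro asymp_onI)
    moreover have "transp_on ?L lt" using lt_trans Lpos by (intro transp_onI) blast
    ultimately obtain m where m: "m \<in> ?L" and max: "\<And>x. x \<in> ?L \<Longrightarrow> x \<noteq> m \<Longrightarrow> \<not> lt m x"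
      using Finite_Set.bex_max_element[of ?L lt] by blast
    from m obtain ps where ps: "?good (ps @ [m])" by blast
    have "\<exists>bs. inc_path u bs \<and> (\<forall>a\<in>set bs. integral_at t a) \<and> path_end u bs = path_end u ps"
      using less.hyps[OF last(4)[OF ps]] ps by (simp add: sat_path_append)
    then obtain bs where bs: "inc_path u bs" "\<forall>a\<in>set bs. integral_at t a"
      "path_end u bs = path_end u ps" by blast
    have good: "?good (bs @ [m])" using bs ps by (auto simp: sat_path_append inc_path_def)
    have "\<forall>a\<in>set bs. lt a m"
    proof (cases bs rule: rev_exhaust)
      case (snoc cs b)
      let ?w = "path_end u cs"
      have "sat_path u (bs @ [m])" using good by blast
      then have s: "sat_path u cs" "sat_path ?w [b, m]" by (simp_all add: snoc sat_path_append)
      have w: "?w \<in> weyl" using sat_path_end_weyl[OF uw s(1)] .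
      have b: "b \<in> pos_roots" "m \<in> pos_roots" "0 < ip lam b" using s(2) good snoc by auto
      have "lt b m"
      proof (rule ccontr)
        assume "\<not> lt b m"
        moreover have "b \<noteq> m"
        proof
          assume "b = m"
          have "?w b \<in> pos_roots" "(?w \<circ> reflect b) m \<in> pos_roots"
            using sat_imp_up_path[OF w s(2)] by simp_all
          then show False using \<open>b = m\<close> b(1) w not_pos_neg
            by (simp add: o_apply reflect_self root_ip_neq pos_root_real weyl_minus)
        qed
        ultimately have "lt m b" using lt_total[OF b] by blast
        moreover have "integral_at t b" "integral_at t m" using good snoc by simp_all
        ultimately obtain b' g' where ex: "sat_path ?w [b', g']"
          "path_end ?w [b', g'] = path_end ?w [b, m]" "lt b' g'" "lt m g'"
          "integral_at t b'" "integral_at t g'"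
          using exchange[OF w s(2)] by blast
        have e: "path_end u ((cs @ [b']) @ [g']) = path_end u as"
          using ex(2) good snoc by simp
        have g': "g' \<in> pos_roots" "b' \<in> pos_roots" using ex(1) by simp_all
        have w': "?w \<circ> reflect b' \<in> weyl" using weyl_comp_reflect[OF w g'(2)] .
        have "sat_path (?w \<circ> reflect b') [g']" using ex(1) by simp
        then have "(?w \<circ> reflect b') g' \<in> pos_roots" using sat_imp_up_path[OF w'] by fastforce
        moreover have "path_end u as = (?w \<circ> reflect b') \<circ> reflect g'" using e by simp
        then have "path_end u as g' = - (?w \<circ> reflect b') g'"
          using g'(1) w' by (simp add: o_apply[of _ "reflect g'"] reflect_self root_ip_neq
              pos_root_real weyl_minus)
        ultimately have "path_end u as g' \<notin> pos_roots" using not_pos_neg by auto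
        \<comment> \<open>The minimal representative at the end keeps positive roots orthogonal to
          \<open>lam\<close> positive, but it makes \<open>g'\<close> negative.\<close>
        then have fin: "0 < ip lam g'"
          using minrep_pos[OF vmin g'(1)] ip_lam_pos_root[OF g'(1)] by linarith
        have "0 < ip lam b'" using lt_imp_ip_lam_pos[OF ex(3) g'(2,1)] .
        then have "?good ((cs @ [b']) @ [g'])"
          using s(1) ex(1,5,6) fin good snoc e by (auto simp: sat_path_append)
        then have "g' \<in> ?L" by blast
        then show False using max[of g'] ex(4) lt_irrefl by blast
      qed
      moreover have "lt c m" if "c \<in> set cs" for c
      proof (rule lt_trans[OF _ \<open>lt b m\<close> _ b(1,2)])
        show "lt c b" using bs(1) snoc that by (auto simp: inc_path_def sorted_wrt_append)
        show "c \<in> pos_roots" using s(1) that sat_path_roots by blast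
      qed
      ultimately show ?thesis using snoc by auto
    qed simp
    then have "inc_path u (bs @ [m])"
      using good bs(1) by (simp add: inc_path_def sorted_wrt_append)
    then show ?thesis using good by blast
  qed
qed

lemma block_exists:
  assumes "minrep u" "orbit_less_at (- lam) t (- u lam) y"
  obtains as where "inc_path u as" "\<forall>a\<in>set as. integral_at t a" "as \<noteq> []" "- path_end u as lam = y"
proof -
  obtain as where as: "sat_path u as" "\<forall>a\<in>set as. 0 < ip lam a \<and> integral_at t a" "as \<noteq> []"
    "y = - path_end u as lam" using orbit_less_at_lift[OF assms(2,1) refl] by blast
  obtain bs where bs: "inc_path u bs" "\<forall>a\<in>set bs. integral_at t a" "path_end u bs = path_end u as"
    using sort_path[OF assms(1) as(1,2)] by blast
  have "length bs = length as"
    using sat_path_length[OF as(1)] sat_path_length[of u bs] bs(1,3) by (simp add: inc_path_def)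
  then have "bs \<noteq> []" using as(3) by auto
  then show ?thesis using that[of bs] bs as(4) by simp
qed

lemma first_block_exists:
  assumes "y \<in> orbit (- lam)"
  obtains as where "inc_path id as" "- path_end id as lam = y"
proof -
  obtain v where v: "v \<in> weyl" "y = - v lam" using assms mem_orbit by blast
  obtain as where as: "sat_path id as" "\<forall>a\<in>set as. 0 < ip lam a" "path_end id as lam = v lam"
    using path_exists[OF v(1) minrep_id] lam_orbit_le[OF v(1)] by auto
  then obtain bs where "inc_path id bs" "path_end id bs = path_end id as"
    using sort_path[OF minrep_id as(1), of 0] by (auto simp: integral_at_def)
  then show ?thesis using that as(3) v(2) by simp
qed

end

section \<open>Lexicographic comparison and lists sorted by a real key\<close>

lemma lexord_map_upt:
  fixes f g :: "nat \<Rightarrow> real"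
  shows "(map f [0..<n], map g [0..<n]) \<in> lexord {(u, v). u < v} \<longleftrightarrow>
    (\<exists>q<n. f q < g q \<and> (\<forall>p<q. f p = g p))"
proof -
  have "take i (map f [0..<n]) = take i (map g [0..<n]) \<longleftrightarrow> (\<forall>p<i. f p = g p)" if "i < n" for i
    using that by (auto simp: take_map)
  then show ?thesis unfolding lexord_take_index_conv by auto
qed

lemma filter_le_split:
  fixes f :: "'b \<Rightarrow> real"
  assumes "sorted_wrt (\<lambda>i j. f i \<le> f j) xs" "a \<le> b"
  shows "filter (\<lambda>j. f j \<le> b) xs = filter (\<lambda>j. f j \<le> a) xs @ filter (\<lambda>j. a < f j \<and> f j \<le> b) xs"
  using assms(1)
proof (induction xs)
  case (Cons x xs)
  show ?case
  proof (cases "f x \<le> a")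
    case False
    then have "filter (\<lambda>j. f j \<le> a) xs = []" using Cons.prems by (auto simp: filter_empty_conv)
    then show ?thesis using Cons False by auto
  qed (use Cons assms(2) in auto)
qed simp

lemma take_filter_le:
  fixes f :: "'b \<Rightarrow> real"
  assumes "sorted_wrt (\<lambda>i j. f i \<le> f j) xs"
  shows "take (length (filter (\<lambda>j. f j \<le> a) xs)) xs = filter (\<lambda>j. f j \<le> a) xs"
  using assms
proof (induction xs)
  case (Cons x xs)
  show ?case
  proof (cases "f x \<le> a")
    case False
    then have "filter (\<lambda>j. f j \<le> a) xs = []" using Cons.prems by (auto simp: filter_empty_conv)
    then show ?thesis using False by simp
  qed (use Cons in auto)
qed simp

context dominant_data
begin

subsection \<open>Admissible subsets as sorted lists\<close>

lemma weights_word: "set ps \<subseteq> {..<r} \<Longrightarrow> v \<in> weights \<Longrightarrow> simple_word ps v \<in> weights"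
proof (induction ps)
  case (Cons q ps)
  let ?v = "simple_word ps v"
  have q: "q < r" and v: "?v \<in> weights" using Cons by auto
  have "ip (srefl q ?v) (coroot (simple p)) \<in> \<int>" if "p < r" for p
    using v q that cartan_int'[OF q that] by (simp add: reflect_def weights_def)
  then show ?case by (simp add: weights_def o_apply)
qed simp

lemma lam_coroot_int:
  assumes "a \<in> real_roots"
  shows "ip lam (coroot a) \<in> \<int>"
proof -
  obtain ps p where a: "a = simple_word ps (simple p)" "set ps \<subseteq> {..<r}" "p < r"
    using assms by (auto simp: real_roots_def)
  have w: "simple_word ps \<in> weyl" using a(2) by (rule word_in_weyl)
  have "ip lam (coroot a) = ip (simple_word (rev ps) lam) (coroot (simple p))"
    unfolding a(1) coroot_weyl[OF w] using weyl_ip_inv[OF w] symmetric inv_word[OF a(2)] by metis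
  moreover have "simple_word (rev ps) lam \<in> weights"
    using weights_word[of "rev ps" lam] a(2) dominant by (simp add: dominant_weights_def)
  ultimately show ?thesis using a(3) by (simp add: weights_def)
qed

lemma chain_index_fst:
  assumes "i \<in> chain_index lam"
  shows "fst i \<in> pos_roots" "0 < ip lam (fst i)" "0 < ip lam (coroot (fst i))"
proof -
  obtain a k where [simp]: "i = (a, k)" by fastforce
  show "fst i \<in> pos_roots" "0 < ip lam (coroot (fst i))" using assms by (auto simp: chain_index_def)
  then show "0 < ip lam (fst i)" using ip_lam_coroot_pos pos_root_real by blast
qed

text \<open>By the last claim the root determines the index within a block of given
  \<open>t\<close>, so blocks can be compared by labels. The floor only converts a real number that
  is already integral.\<close>

lemma chain_t_props:
  assumes "i \<in> chain_index lam"
  shows "0 \<le> chain_t lam i" "chain_t lam i < 1" "chain_t lam i \<in> \<rat>"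
    "integral_at (chain_t lam i) (fst i)"
    "i = (fst i, \<lfloor>chain_t lam i * ip lam (coroot (fst i))\<rfloor>)"
proof -
  obtain a k where i: "i = (a, k)" by fastforce
  have h: "0 < ip lam (coroot a)" "0 \<le> k" "k < ip lam (coroot a)" and a: "a \<in> pos_roots"
    using assms i by (auto simp: chain_index_def)
  show "0 \<le> chain_t lam i" "chain_t lam i < 1" using h by (simp_all add: i)
  show "chain_t lam i \<in> \<rat>"
    using lam_coroot_int[OF pos_root_real[OF a]] unfolding i chain_t.simps
    by (meson Ints_subset_Rats Rats_divide Ints_of_int subsetD)
  have eq: "chain_t lam i * ip lam (coroot a) = k" using h(1) by (simp add: i)
  show "integral_at (chain_t lam i) (fst i)" using eq by (simp add: integral_at_def i)
  show "i = (fst i, \<lfloor>chain_t lam i * ip lam (coroot (fst i))\<rfloor>)" using eq i by simp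
qed

lemma lt_iff_coroot_coeff:
  assumes "a \<in> pos_roots" "0 < ip lam a" "b \<in> pos_roots" "0 < ip lam b"
  shows "lt a b \<longleftrightarrow> (\<exists>q<r. coroot_coeff a q / ip lam (coroot a) < coroot_coeff b q / ip lam (coroot b) \<and>
    (\<forall>p<q. coroot_coeff a p / ip lam (coroot a) = coroot_coeff b p / ip lam (coroot b)))"
proof -
  have c: "coroot_coeff x q / ip lam (coroot x) = coord x q / ip lam x" if "x \<in> pos_roots" for x q
    using root_pos[OF pos_root_real[OF that]] coord_coroot[OF pos_root_real[OF that]]
    by (simp add: ip_coroot)
  have "0 < cross a b q \<longleftrightarrow> coord a q / ip lam a < coord b q / ip lam b"
    "cross a b q = 0 \<longleftrightarrow> coord a q / ip lam a = coord b q / ip lam b" for q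
    using assms(2,4) by (auto simp: cross_def field_simps)
  then show ?thesis unfolding lt_def lexpos_def by (simp add: c assms)
qed

text \<open>Here the order of the special chain meets the order on labels: the head of
  \<open>chain_vec\<close> is \<open>t\<close>, and the tail holds the quotients that
  \<open>lt\<close> compares.\<close>

lemma chain_vec_less_iff:
  assumes "i \<in> chain_index lam" "j \<in> chain_index lam"
  shows "chain_vec lam i < chain_vec lam j \<longleftrightarrow>
    chain_t lam i < chain_t lam j \<or> chain_t lam i = chain_t lam j \<and> lt (fst i) (fst j)"
proof -
  obtain a k b m where ij: "i = (a, k)" "j = (b, m)" by fastforce
  have "chain_vec lam i < chain_vec lam j \<longleftrightarrow> chain_t lam i < chain_t lam j \<or>
    chain_t lam i = chain_t lam j \<and>
    (map (\<lambda>q. coroot_coeff a q / ip lam (coroot a)) [0..<r],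
      map (\<lambda>q. coroot_coeff b q / ip lam (coroot b)) [0..<r]) \<in> lexord {(u, v). u < v}"
    by (simp add: ij list_less_def comp_def)
  then show ?thesis
    using lt_iff_coroot_coeff chain_index_fst(1,2)[OF assms(1)] chain_index_fst(1,2)[OF assms(2)]
    unfolding lexord_map_upt by (simp add: ij)
qed

text \<open>Sorted enumerations replace admissible subsets, so that blocks can be appended and
  prefixes taken.\<close>

definition chain_list :: "('a \<times> int) list \<Rightarrow> bool" where
  "chain_list js \<longleftrightarrow> set js \<subseteq> chain_index lam \<and>
    sorted_wrt (\<lambda>i j. chain_vec lam i < chain_vec lam j) js \<and> sat_path id (map fst js)"

definition initial :: "('a \<times> int) list \<Rightarrow> real \<Rightarrow> ('a \<times> int) list" where
  "initial js t = filter (\<lambda>j. chain_t lam j \<le> t) js"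

abbreviation elem_at :: "('a \<times> int) list \<Rightarrow> real \<Rightarrow> 'a \<Rightarrow> 'a" where
  "elem_at js t \<equiv> path_end id (map fst (initial js t))"

lemma bruhat_chain_iff_sat_path:
  assumes "w \<in> weyl" "set bs \<subseteq> pos_roots"
  shows "(\<forall>m<length bs. bruhat_cover (path_end w (take m bs)) (path_end w (take (Suc m) bs))) \<longleftrightarrow>
    sat_path w bs"
  using assms
proof (induction bs arbitrary: w)
  case (Cons b bs)
  have w: "w \<circ> reflect b \<in> weyl" using Cons.prems by (simp add: weyl_comp_reflect)
  have "(\<forall>m<length (b # bs). bruhat_cover (path_end w (take m (b # bs))) (path_end w (take (Suc m) (b # bs)))) \<longleftrightarrow>
    bruhat_cover w (w \<circ> reflect b) \<and> (\<forall>m<length bs. bruhat_cover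
      (path_end (w \<circ> reflect b) (take m bs)) (path_end (w \<circ> reflect b) (take (Suc m) bs)))"
    by (simp add: All_less_Suc2)
  also have "\<dots> \<longleftrightarrow> bruhat_cover w (w \<circ> reflect b) \<and> sat_path (w \<circ> reflect b) bs"
    using Cons.IH[OF w] Cons.prems(2) by simp
  also have "bruhat_cover w (w \<circ> reflect b) \<longleftrightarrow> weyl_length (w \<circ> reflect b) = weyl_length w + 1"
    using Cons.prems by (auto simp: bruhat_cover_def)
  finally show ?case using Cons.prems(2) by simp
qed simp

lemma refl_prod_path_end: "refl_prod bs = path_end id bs"
  by (simp add: path_end_eq)

lemma admissible_iff:
  "J \<in> admissible lam \<longleftrightarrow> finite J \<and> J \<subseteq> chain_index lam \<and> sat_path id (map fst (index_list lam J))"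
proof (cases "finite J \<and> J \<subseteq> chain_index lam")
  case True
  then have "set (map fst (index_list lam J)) \<subseteq> pos_roots"
    using index_list_props(1)[of J lam] chain_index_fst(1) by auto
  from bruhat_chain_iff_sat_path[OF weyl.weyl_id this] show ?thesis
    using True by (simp add: admissible_def Let_def refl_prod_path_end)
qed (auto simp: admissible_def)

lemma admissible_chain_list:
  assumes "J \<in> admissible lam"
  shows "chain_list (index_list lam J)" "set (index_list lam J) = J"
  using assms index_list_props[of J lam] by (auto simp: chain_list_def admissible_iff)

lemma chain_list_admissible:
  assumes "chain_list js"
  shows "set js \<in> admissible lam" "index_list lam (set js) = js"
proof -
  have sub: "set js \<subseteq> chain_index lam" using assms by (simp add: chain_list_def)
  note e = index_list_props[OF finite_set sub]
  have "map (chain_vec lam) (index_list lam (set js)) = map (chain_vec lam) js"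
    by (rule strict_sorted_equal)
      (use assms e(3) in \<open>simp_all add: sorted_wrt_map chain_list_def e(1)\<close>)
  moreover have "inj_on (chain_vec lam) (set (index_list lam (set js)) \<union> set js)"
    using inj_on_subset[OF inj_on_chain_vec[of lam]] sub e(1) by simp
  ultimately show eq: "index_list lam (set js) = js" by (rule map_inj_on)
  show "set js \<in> admissible lam" using assms sub eq by (simp add: admissible_iff chain_list_def)
qed

lemma chain_list_sorted_t: "chain_list js \<Longrightarrow> sorted_wrt (\<lambda>i j. chain_t lam i \<le> chain_t lam j) js"
  unfolding chain_list_def by (meson chain_t_mono sorted_wrt_mono_rel)

lemma jumps_eq:
  assumes "J \<in> admissible lam"
  shows "jumps lam J = 0 # tl (jumps lam J)" "sorted_wrt (<) (jumps lam J)"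
    "set (jumps lam J) = insert 0 (chain_t lam ` J)"
proof -
  have J: "finite J" "J \<subseteq> chain_index lam" using assms by (simp_all add: admissible_iff)
  let ?A = "chain_t lam ` J"
  have fin: "finite (insert 0 ?A)" "finite (?A - {0})" using J(1) by simp_all
  show set: "set (jumps lam J) = insert 0 ?A"
    unfolding jumps_def using fin(1) by (rule set_sorted_list_of_set)
  show sorted: "sorted_wrt (<) (jumps lam J)"
    unfolding jumps_def by (rule strict_sorted_list_of_set)
  have "jumps lam J = 0 # sorted_list_of_set (?A - {0})"
  proof (rule strict_sorted_equal[OF _ sorted])
    have "0 < x" if x: "x \<in> ?A - {0}" for x
    proof -
      obtain j where "j \<in> J" "x = chain_t lam j" using x by blast
      then have "0 \<le> x" using chain_t_props(1) J(2) by blast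
      then show ?thesis using x by simp
    qed
    then show "sorted_wrt (<) (0 # sorted_list_of_set (?A - {0}))"
      using set_sorted_list_of_set[OF fin(2)] strict_sorted_list_of_set[of "?A - {0}"]
      unfolding sorted_wrt.simps by blast
    show "set (jumps lam J) = set (0 # sorted_list_of_set (?A - {0}))"
      using set_sorted_list_of_set[OF fin(2)] unfolding set by auto
  qed
  then show "jumps lam J = 0 # tl (jumps lam J)" by simp
qed

text \<open>\<open>block_end\<close> counts the indices with \<open>t\<close> up to a jump; since
  \<open>t\<close> increases weakly along the enumeration, taking that many elements is the same as
  filtering.\<close>

lemma gamma_eq:
  assumes "J \<in> admissible lam"
  shows "gamma lam J = (map (\<lambda>t. - elem_at (index_list lam J) t lam) (jumps lam J), tl (jumps lam J))"
proof -
  define js where "js = index_list lam J"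
  have js: "chain_list js" "set js = J" using admissible_chain_list[OF assms] by (simp_all add: js_def)
  have "sorted_wrt (\<noteq>) js"
    using js(1) unfolding chain_list_def by (auto elim: sorted_wrt_mono_rel[rotated])
  then have dist: "distinct js"
    unfolding sorted_wrt_iff_nth_less distinct_conv_nth by (metis linorder_neqE_nat)
  have "card {j \<in> J. chain_t lam j \<le> t} = length (initial js t)" for t
    unfolding initial_def distinct_length_filter[OF dist] js(2)[symmetric]
    by (rule arg_cong[of _ _ card]) auto
  then have "gamma_w lam J k = elem_at js (jumps lam J ! k)" for k
    using take_filter_le[OF chain_list_sorted_t[OF js(1)]]
    by (simp add: gamma_w_def js_def[symmetric] refl_prod_path_end initial_def)
  then show ?thesis
    unfolding gamma_def by (auto simp: js_def[symmetric] intro!: nth_equalityI)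
qed

subsection \<open>Blocks\<close>

lemma initial_split:
  assumes "chain_list js" "a \<le> b"
  shows "initial js b = initial js a @ filter (\<lambda>j. a < chain_t lam j \<and> chain_t lam j \<le> b) js"
  unfolding initial_def using filter_le_split[OF chain_list_sorted_t[OF assms(1)] assms(2)] .

lemma chain_list_initial: "chain_list js \<Longrightarrow> chain_list (initial js t)"
proof -
  assume js: "chain_list js"
  have "initial js t = take (length (initial js t)) js"
    unfolding initial_def using take_filter_le[OF chain_list_sorted_t[OF js]] by simp
  then obtain xs where "js = initial js t @ xs" by (metis append_take_drop_id)
  then have "sat_path id (map fst (initial js t))"
    using js unfolding chain_list_def by (metis map_append sat_path_append)
  then show ?thesis using js by (auto simp: chain_list_def initial_def sorted_wrt_filter)
qed

lemma chain_list_minrep: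
  assumes "chain_list js"
  shows "minrep (path_end id (map fst js))"
proof (rule minrep_path[OF minrep_id])
  show "sat_path id (map fst js)" using assms by (simp add: chain_list_def)
  have "0 < ip lam (fst j)" if "j \<in> set js" for j
    using assms that chain_index_fst(2)[of j] unfolding chain_list_def by blast
  then show "\<forall>a\<in>set (map fst js). 0 < ip lam a" by (simp only: set_map ball_simps) blast
qed

text \<open>For constant \<open>t\<close> the chain order is \<open>lt\<close> on the roots, so a
  block is an increasing path. The converse is \<open>chain_list_append_block\<close>.\<close>

lemma chain_list_block:
  assumes js: "chain_list (xs @ ys)" and t: "\<forall>j\<in>set ys. chain_t lam j = t"
  shows "inc_path (path_end id (map fst xs)) (map fst ys)" "\<forall>a\<in>set (map fst ys). integral_at t a"
    "ys = map (\<lambda>a. (a, \<lfloor>t * ip lam (coroot a)\<rfloor>)) (map fst ys)"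
proof -
  have sub: "set ys \<subseteq> chain_index lam" using js by (simp add: chain_list_def)
  have "sorted_wrt (\<lambda>i j. chain_vec lam i < chain_vec lam j) ys"
    using js by (simp add: chain_list_def sorted_wrt_append)
  then have "sorted_wrt (\<lambda>i j. lt (fst i) (fst j)) ys"
  proof (rule sorted_wrt_mono_rel[rotated])
    fix i j assume "i \<in> set ys" "j \<in> set ys" "chain_vec lam i < chain_vec lam j"
    then show "lt (fst i) (fst j)"
      using sub t chain_vec_less_iff[of i j] by (metis less_irrefl subsetD)
  qed
  moreover have "0 < ip lam (fst j)" if "j \<in> set ys" for j
    using sub that chain_index_fst(2)[of j] by blast
  moreover have "sat_path (path_end id (map fst xs)) (map fst ys)"
    using js by (simp only: chain_list_def map_append sat_path_append)
  ultimately show "inc_path (path_end id (map fst xs)) (map fst ys)"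
    unfolding inc_path_def sorted_wrt_map set_map by blast
  have "integral_at t (fst j)" if "j \<in> set ys" for j
    using sub t that chain_t_props(4)[of j] by (metis subsetD)
  then show "\<forall>a\<in>set (map fst ys). integral_at t a" unfolding set_map by blast
  have "j = (fst j, \<lfloor>t * ip lam (coroot (fst j))\<rfloor>)" if "j \<in> set ys" for j
    using chain_t_props(5)[of j] sub t that by (metis subsetD)
  then have "map (\<lambda>j. (fst j, \<lfloor>t * ip lam (coroot (fst j))\<rfloor>)) ys = ys"
    by (intro map_idI) simp
  then show "ys = map (\<lambda>a. (a, \<lfloor>t * ip lam (coroot a)\<rfloor>)) (map fst ys)"
    unfolding map_map o_def by simp
qed

lemma chain_index_of_root:
  assumes "a \<in> pos_roots" "0 < ip lam a" "integral_at t a" "0 \<le> t" "t < 1"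
  shows "(a, \<lfloor>t * ip lam (coroot a)\<rfloor>) \<in> chain_index lam"
    "chain_t lam (a, \<lfloor>t * ip lam (coroot a)\<rfloor>) = t"
proof -
  have h: "0 < ip lam (coroot a)" using assms(1,2) ip_lam_coroot_pos pos_root_real by blast
  obtain k :: int where k: "t * ip lam (coroot a) = k"
    using assms(3) unfolding integral_at_def by (auto elim: Ints_cases)
  have "0 \<le> real_of_int k" using k[symmetric] assms(4) h by simp
  moreover have "real_of_int k < ip lam (coroot a)" using k[symmetric] assms(5) h by simp
  ultimately show "(a, \<lfloor>t * ip lam (coroot a)\<rfloor>) \<in> chain_index lam"
    using assms(1) k by (simp add: chain_index_def)
  show "chain_t lam (a, \<lfloor>t * ip lam (coroot a)\<rfloor>) = t" using h by (simp add: k) (simp add: k[symmetric])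
qed

lemma chain_list_append_block:
  assumes js: "chain_list js" and inc: "inc_path (path_end id (map fst js)) as"
    and int: "\<forall>a\<in>set as. integral_at t a" and t: "0 \<le> t" "t < 1"
    and less: "\<forall>j\<in>set js. chain_t lam j < t"
  shows "chain_list (js @ map (\<lambda>a. (a, \<lfloor>t * ip lam (coroot a)\<rfloor>)) as)"
proof -
  let ?f = "\<lambda>a. (a, \<lfloor>t * ip lam (coroot a)\<rfloor>)"
  have f: "?f a \<in> chain_index lam" "chain_t lam (?f a) = t" if "a \<in> set as" for a
    using chain_index_of_root[of a t] that inc_path_roots[OF inc] inc int t
    by (auto simp: inc_path_def)
  have "sorted_wrt (\<lambda>a b. chain_vec lam (?f a) < chain_vec lam (?f b)) as"
  proof (rule sorted_wrt_mono_rel)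
    show "sorted_wrt lt as" using inc by (simp add: inc_path_def)
    fix a b assume ab: "a \<in> set as" "b \<in> set as" "lt a b"
    then show "chain_vec lam (?f a) < chain_vec lam (?f b)"
      using chain_vec_less_iff[OF f(1) f(1)] f(2) by (simp del: chain_vec.simps chain_t.simps)
  qed
  moreover have "chain_vec lam i < chain_vec lam (?f a)" if "i \<in> set js" "a \<in> set as" for i a
  proof -
    have "i \<in> chain_index lam" using js that by (auto simp: chain_list_def)
    then show ?thesis using chain_vec_less_iff[OF _ f(1)[OF that(2)]] f(2)[OF that(2)] less that(1)
      by (simp del: chain_vec.simps chain_t.simps)
  qed
  ultimately have "sorted_wrt (\<lambda>i j. chain_vec lam i < chain_vec lam j) (js @ map ?f as)"
    using js by (simp add: chain_list_def sorted_wrt_append sorted_wrt_map del: chain_vec.simps)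
  moreover have "map fst (js @ map ?f as) = map fst js @ as" by (simp add: o_def)
  then have "sat_path id (map fst (js @ map ?f as))"
    using js inc by (simp only: sat_path_append) (simp add: chain_list_def inc_path_def)
  moreover have "set (js @ map ?f as) \<subseteq> chain_index lam" using js f(1) by (auto simp: chain_list_def)
  ultimately show ?thesis unfolding chain_list_def by blast
qed

subsection \<open>The bijection\<close>

declare id_apply [simp del] chain_t.simps [simp del] chain_vec.simps [simp del]

lemma initial_all: "\<forall>j\<in>set js. chain_t lam j \<le> t \<Longrightarrow> initial js t = js"
  by (simp add: initial_def)

text \<open>\<open>T\<close> is any increasing list containing the values of \<open>t\<close>, so
  that one list can serve for two chain lists in the proof of injectivity.\<close>

lemma initial_Suc:
  assumes js: "chain_list js" and T: "sorted_wrt (<) T" "chain_t lam ` set js \<subseteq> set T"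
    and k: "Suc k < length T"
  shows "initial js (T ! Suc k) = initial js (T ! k) @ filter (\<lambda>j. chain_t lam j = T ! Suc k) js"
proof -
  have lt: "T ! k < T ! Suc k" using T(1) k by (simp add: sorted_wrt_nth_less)
  have "T ! k < chain_t lam j \<and> chain_t lam j \<le> T ! Suc k \<longleftrightarrow> chain_t lam j = T ! Suc k"
    if j: "j \<in> set js" for j
  proof -
    have "chain_t lam j \<in> set T" using T(2) j by blast
    then obtain m where m: "m < length T" "chain_t lam j = T ! m" by (auto simp: in_set_conv_nth)
    have T_less: "T ! a < T ! b" if "a < b" "b < length T" for a b
      using T(1) that by (simp add: sorted_wrt_nth_less)
    consider "m < k" | "m = k" | "m = Suc k" | "Suc k < m" by linarith
    then show ?thesis
    proof cases
      case 1
      then show ?thesis using T_less[of m k] k lt m(2) by simp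
    next
      case 4
      then show ?thesis using T_less[of "Suc k" m] m by simp
    qed (use lt m(2) in simp_all)
  qed
  then show ?thesis
    unfolding initial_split[OF js less_imp_le[OF lt]] by (intro arg_cong2[of _ _ _ _ "(@)"] filter_cong) auto
qed

lemma initial_block:
  assumes js: "chain_list js" and T: "sorted_wrt (<) T" "chain_t lam ` set js \<subseteq> set T"
    and k: "Suc k < length T"
  shows "inc_path (elem_at js (T ! k)) (map fst (filter (\<lambda>j. chain_t lam j = T ! Suc k) js))"
    "\<forall>a\<in>set (map fst (filter (\<lambda>j. chain_t lam j = T ! Suc k) js)). integral_at (T ! Suc k) a"
    "filter (\<lambda>j. chain_t lam j = T ! Suc k) js =
      map (\<lambda>a. (a, \<lfloor>T ! Suc k * ip lam (coroot a)\<rfloor>)) (map fst (filter (\<lambda>j. chain_t lam j = T ! Suc k) js))"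
    "elem_at js (T ! Suc k) =
      path_end (elem_at js (T ! k)) (map fst (filter (\<lambda>j. chain_t lam j = T ! Suc k) js))"
proof -
  note s = initial_Suc[OF assms]
  have "chain_list (initial js (T ! k) @ filter (\<lambda>j. chain_t lam j = T ! Suc k) js)"
    using chain_list_initial[OF js] s by metis
  note b = chain_list_block[OF this, of "T ! Suc k"]
  show "inc_path (elem_at js (T ! k)) (map fst (filter (\<lambda>j. chain_t lam j = T ! Suc k) js))"
    "\<forall>a\<in>set (map fst (filter (\<lambda>j. chain_t lam j = T ! Suc k) js)). integral_at (T ! Suc k) a"
    "filter (\<lambda>j. chain_t lam j = T ! Suc k) js =
      map (\<lambda>a. (a, \<lfloor>T ! Suc k * ip lam (coroot a)\<rfloor>)) (map fst (filter (\<lambda>j. chain_t lam j = T ! Suc k) js))"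
    by (rule b; simp)+
  show "elem_at js (T ! Suc k) =
      path_end (elem_at js (T ! k)) (map fst (filter (\<lambda>j. chain_t lam j = T ! Suc k) js))"
    unfolding s by simp
qed

text \<open>This block starts at the identity and may be empty, \<open>0\<close> being a jump by
  convention.\<close>

lemma initial_zero_block:
  assumes "chain_list js"
  shows "inc_path id (map fst (initial js 0))"
    "initial js 0 = map (\<lambda>a. (a, \<lfloor>0 * ip lam (coroot a)\<rfloor>)) (map fst (initial js 0))"
proof -
  have "chain_t lam j = 0" if "j \<in> set (initial js 0)" for j
  proof -
    have "j \<in> chain_index lam" "chain_t lam j \<le> 0"
      using that assms by (auto simp: initial_def chain_list_def)
    then show ?thesis using chain_t_props(1)[of j] by linarith
  qed
  then have "\<forall>j\<in>set (initial js 0). chain_t lam j = 0" by blast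
  from chain_list_block[of "[]", OF _ this] chain_list_initial[OF assms, of 0]
  show "inc_path id (map fst (initial js 0))"
    "initial js 0 = map (\<lambda>a. (a, \<lfloor>0 * ip lam (coroot a)\<rfloor>)) (map fst (initial js 0))"
    by simp_all
qed

lemma elem_at_weyl: "chain_list js \<Longrightarrow> elem_at js t \<in> weyl"
  using chain_list_minrep[OF chain_list_initial] minrep_weyl by blast

text \<open>The second component of \<open>gamma\<close> determines the jumps and the first the
  images of the block ends. \<open>inc_path_unique\<close> then recovers the blocks in turn, each
  starting where the previous ones end.\<close>

lemma gamma_inj: "inj_on (gamma lam) (admissible lam)"
proof (rule inj_onI)
  fix J J' assume J: "J \<in> admissible lam" and J': "J' \<in> admissible lam"
    and eq: "gamma lam J = gamma lam J'"
  define js js' T where "js = index_list lam J" and "js' = index_list lam J'" and "T = jumps lam J"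
  have js: "chain_list js" "set js = J" and js': "chain_list js'" "set js' = J'"
    using admissible_chain_list J J' by (simp_all add: js_def js'_def)
  have T': "jumps lam J' = T"
    using eq jumps_eq(1)[OF J] jumps_eq(1)[OF J'] by (simp add: gamma_eq J J' T_def)
  have T0: "T ! 0 = 0" "T \<noteq> []" using jumps_eq(1)[OF J] by (metis T_def nth_Cons_0, metis T_def list.distinct(1))
  note T = jumps_eq(2)[OF J, folded T_def]
  have sub: "chain_t lam ` set js \<subseteq> set T" "chain_t lam ` set js' \<subseteq> set T"
    using jumps_eq(3)[OF J] jumps_eq(3)[OF J'] js(2) js'(2) T' by (auto simp: T_def)
  have ends: "elem_at js (T ! k) lam = elem_at js' (T ! k) lam" if "k < length T" for k
  proof -
    have "map (\<lambda>t. - elem_at js t lam) T = map (\<lambda>t. - elem_at js' t lam) T"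
      using eq by (simp add: gamma_eq J J' T' T_def[symmetric] js_def js'_def)
    then have "\<forall>t\<in>set T. - elem_at js t lam = - elem_at js' t lam" by (simp only: map_eq_conv)
    then have "- elem_at js (T ! k) lam = - elem_at js' (T ! k) lam" using that nth_mem by blast
    then show ?thesis by (simp only: neg_equal_iff_equal)
  qed
  have initial: "initial js (T ! k) = initial js' (T ! k)" if "k < length T" for k
    using that
  proof (induction k)
    case 0
    note b = initial_zero_block[OF js(1)] and b' = initial_zero_block[OF js'(1)]
    have "elem_at js 0 lam = elem_at js' 0 lam" using ends[OF 0] by (simp only: T0(1))
    then have eq: "map fst (initial js 0) = map fst (initial js' 0)"
      using inc_path_unique[OF elem_at_weyl[OF js'(1)] weyl.weyl_id b(1) b'(1)] by blast
    show ?case unfolding T0(1) by (rule trans[OF b(2)[unfolded eq] b'(2)[symmetric]])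
  next
    case (Suc k)
    note b = initial_block[OF js(1) T sub(1) Suc.prems] and b' = initial_block[OF js'(1) T sub(2) Suc.prems]
    let ?B = "filter (\<lambda>j. chain_t lam j = T ! Suc k)"
    have IH: "initial js (T ! k) = initial js' (T ! k)" using Suc by simp
    have eq: "map fst (?B js) = map fst (?B js')"
    proof (rule inc_path_unique[OF elem_at_weyl[OF js'(1), of "T ! Suc k"] elem_at_weyl[OF js(1)] b(1)])
      show "inc_path (elem_at js (T ! k)) (map fst (?B js'))" using b'(1) IH by simp
      show "path_end (elem_at js (T ! k)) (map fst (?B js)) lam = elem_at js' (T ! Suc k) lam"
        using ends[OF Suc.prems] b(4) by simp
      show "path_end (elem_at js (T ! k)) (map fst (?B js')) lam = elem_at js' (T ! Suc k) lam"
        using b'(4) IH by simp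
    qed
    have "?B js = ?B js'" by (rule trans[OF b(3)[unfolded eq] b'(3)[symmetric]])
    then show ?case
      using IH initial_Suc[OF js(1) T sub(1) Suc.prems] initial_Suc[OF js'(1) T sub(2) Suc.prems] by simp
  qed
  have le_last: "x \<le> T ! (length T - 1)" if "x \<in> set T" for x
  proof -
    obtain m where "m < length T" "x = T ! m" using \<open>x \<in> set T\<close> by (metis in_set_conv_nth)
    then show ?thesis using T
      by (cases "m = length T - 1") (auto intro!: less_imp_le sorted_wrt_nth_less[of "(<)" T])
  qed
  have "initial js (T ! (length T - 1)) = js" "initial js' (T ! (length T - 1)) = js'"
    using le_last sub by (auto intro!: initial_all)
  then have "js = js'" using initial[of "length T - 1"] T0(2) by simp
  then show "J = J'" using js(2) js'(2) by simp
qed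

lemma gamma_LS_chain:
  assumes J: "J \<in> admissible lam"
  shows "gamma lam J \<in> LS_chains (- lam)"
proof -
  define js T where "js = index_list lam J" and "T = jumps lam J"
  have js: "chain_list js" "set js = J" using admissible_chain_list J by (simp_all add: js_def)
  have T0: "T = 0 # tl T" using jumps_eq(1)[OF J] by (simp add: T_def)
  note T = jumps_eq(2)[OF J, folded T_def] and set_T = jumps_eq(3)[OF J, folded T_def]
  have sub: "chain_t lam ` set js \<subseteq> set T" using set_T js(2) by blast
  have Jsub: "J \<subseteq> chain_index lam" using J by (simp add: admissible_iff)
  have len: "length T = Suc (length (tl T))" using T0 by (metis length_Cons)
  have tl_nth: "tl T ! i = T ! Suc i" for i using T0 by (metis nth_Cons_Suc)
  have pos: "0 < x" if "x \<in> set (tl T)" for x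
    using T T0 that by (metis sorted_wrt.simps(2))
  have step: "orbit_less_at (- lam) (T ! Suc i) (- elem_at js (T ! i) lam) (- elem_at js (T ! Suc i) lam)"
    if i: "Suc i < length T" for i
  proof -
    note b = initial_block[OF js(1) T sub i]
    \<comment> \<open>A nonzero jump is attained on \<open>J\<close>, so its block is nonempty and
      the orbit relation strict.\<close>
    have "T ! Suc i \<in> set (tl T)" using i len tl_nth by (metis Suc_less_eq nth_mem)
    then have "T ! Suc i \<noteq> 0" "T ! Suc i \<in> set T" using pos i by fastforce+
    then have T_mem: "T ! Suc i \<in> chain_t lam ` J" using set_T by blast
    then have "\<exists>j\<in>set js. chain_t lam j = T ! Suc i" using js(2) by auto
    then have "map fst (filter (\<lambda>j. chain_t lam j = T ! Suc i) js) \<noteq> []"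
      by (simp add: filter_empty_conv)
    then show ?thesis
      unfolding b(4)
      using path_orbit_less_at[OF chain_list_minrep[OF chain_list_initial[OF js(1)]]] b(1,2)
      by (simp add: inc_path_def)
  qed
  have rat: "x \<in> \<rat> \<inter> {0<..<1}" if "x \<in> set (tl T)" for x
  proof -
    have "x \<in> set T" using \<open>x \<in> set (tl T)\<close> T0 by (metis list.set_intros(2))
    then have "x \<in> chain_t lam ` J" using set_T pos[OF that] by auto
    then obtain j where "j \<in> J" "x = chain_t lam j" by blast
    then have "j \<in> chain_index lam" using Jsub by blast
    then show ?thesis
      using chain_t_props(2,3)[of j] pos[OF that] \<open>x = chain_t lam j\<close> by simp
  qed
  have sorted: "sorted_wrt (<) (tl T)" using T T0 by (metis sorted_wrt.simps(2))
  have orb: "- elem_at js t lam \<in> orbit (- lam)" for t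
    using mem_orbit elem_at_weyl[OF js(1)] by blast
  let ?m = "map (\<lambda>t. - elem_at js t lam) T"
  have at: "orbit_less_at (- lam) (tl T ! i) (?m ! i) (?m ! Suc i)" if "i < length (tl T)" for i
  proof -
    have "Suc i < length T" using that unfolding len by (rule Suc_mono)
    then show ?thesis using step[of i] by (simp add: tl_nth)
  qed
  then have "\<forall>i<length (tl T). orbit_less (- lam) (?m ! i) (?m ! Suc i)"
    using orbit_less_at_imp_less by blast
  moreover have "length ?m = length (tl T) + 1" by (simp only: length_map len Suc_eq_plus1)
  moreover have "set ?m \<subseteq> orbit (- lam)" using orb by auto
  moreover have "set (tl T) \<subseteq> \<rat> \<inter> {0<..<1}" using rat by blast
  ultimately have "(?m, tl T) \<in> LS_chains (- lam)"
    unfolding LS_chains_def using at sorted by blast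
  then show ?thesis by (simp only: gamma_eq[OF J] js_def T_def)
qed

text \<open>Blocks are appended one by one. The values of \<open>t\<close> are tracked along with
  the points reached, so that the jumps of the final list are exactly \<open>T\<close>; this uses
  that every block after the first is nonempty.\<close>

lemma LS_chain_preimage:
  assumes "(\<mu>s, bs) \<in> LS_chains (- lam)" and T: "T = 0 # bs"
  shows "k < length T \<Longrightarrow> \<exists>js. chain_list js \<and> insert 0 (chain_t lam ` set js) = set (take (Suc k) T) \<and>
    (\<forall>i\<le>k. - elem_at js (T ! i) lam = \<mu>s ! i)"
proof (induction k)
  case 0
  have "\<mu>s ! 0 \<in> orbit (- lam)" using assms(1) by (auto simp: LS_chains_def)
  then obtain as where as: "inc_path id as" "- path_end id as lam = \<mu>s ! 0"
    by (rule first_block_exists)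
  define js where "js = map (\<lambda>a. (a, \<lfloor>0 * ip lam (coroot a)\<rfloor>)) as"
  have "chain_list []" by (simp add: chain_list_def)
  then have js: "chain_list js"
    using chain_list_append_block[of "[]" as 0] as(1) by (simp add: js_def integral_at_def)
  have t: "chain_t lam j = 0" if "j \<in> set js" for j using that by (auto simp: js_def chain_t.simps)
  have "initial js 0 = js" using t by (intro initial_all) simp
  moreover have "map fst js = as" by (simp add: js_def o_def)
  ultimately have "- elem_at js (T ! 0) lam = \<mu>s ! 0" by (simp only: T nth_Cons_0 as(2))
  moreover have "insert 0 (chain_t lam ` set js) = set (take (Suc 0) T)" using t by (auto simp: T)
  ultimately show ?case using js by blast
next
  case (Suc k)
  from Suc.IH[OF Suc_lessD[OF Suc.prems]] obtain js where js: "chain_list js"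
    and ts: "insert 0 (chain_t lam ` set js) = set (take (Suc k) T)"
    and ends: "\<And>i. i \<le> k \<Longrightarrow> - elem_at js (T ! i) lam = \<mu>s ! i" by blast
  have LS: "orbit_less_at (- lam) (bs ! i) (\<mu>s ! i) (\<mu>s ! Suc i)" "0 < bs ! i" "bs ! i < 1"
    if "i < length bs" for i
  proof -
    have "set bs \<subseteq> {0<..<1}" using assms(1) by (auto simp: LS_chains_def)
    then show "0 < bs ! i" "bs ! i < 1" using nth_mem[OF that] by auto
    show "orbit_less_at (- lam) (bs ! i) (\<mu>s ! i) (\<mu>s ! Suc i)"
      using assms(1) that by (auto simp: LS_chains_def)
  qed
  have k: "k < length bs" using Suc.prems T by simp
  define t where "t = bs ! k"
  have Tk: "T ! Suc k = t" by (simp add: T t_def)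
  have "sorted_wrt (<) T"
    using assms(1) by (auto simp: LS_chains_def T)
  then have T_less: "T ! i < T ! j" if "i < j" "j < length T" for i j
    using that by (simp add: sorted_wrt_nth_less)
  have le: "chain_t lam j \<le> T ! k" if "j \<in> set js" for j
  proof -
    have "chain_t lam j \<in> set (take (Suc k) T)" using ts \<open>j \<in> set js\<close> by blast
    then obtain m where "m < Suc k" "m < length T" "chain_t lam j = T ! m"
      by (auto simp: in_set_conv_nth)
    then show ?thesis using T_less[of m k] Suc.prems by (cases "m = k") auto
  qed
  have less: "chain_t lam j < t" if "j \<in> set js" for j
    using le[OF that] T_less[of k "Suc k"] Suc.prems Tk by simp
  have "initial js (T ! k) = js" using le by (intro initial_all) blast
  then have e: "- path_end id (map fst js) lam = \<mu>s ! k" using ends[of k] by simp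
  have t: "0 < t" "t < 1" using LS(2,3)[OF k] by (simp_all add: t_def)
  obtain as where as: "inc_path (path_end id (map fst js)) as" "\<forall>a\<in>set as. integral_at t a"
    "as \<noteq> []" "- path_end (path_end id (map fst js)) as lam = \<mu>s ! Suc k"
    using block_exists[OF chain_list_minrep[OF js]] LS(1)[OF k] e by (metis t_def)
  define ys where "ys = map (\<lambda>a. (a, \<lfloor>t * ip lam (coroot a)\<rfloor>)) as"
  have js': "chain_list (js @ ys)"
    unfolding ys_def
    by (rule chain_list_append_block[OF js as(1,2) _ t(2)]) (use t less in auto)
  have yt: "chain_t lam j = t" if "j \<in> set ys" for j
  proof -
    obtain a where a: "a \<in> set as" "j = (a, \<lfloor>t * ip lam (coroot a)\<rfloor>)" using \<open>j \<in> set ys\<close> ys_def by auto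
    then show ?thesis
      using chain_index_of_root(2)[of a t] inc_path_roots[OF as(1)] as(1,2) t
      unfolding inc_path_def by (metis less_imp_le subsetD)
  qed
  have "- elem_at (js @ ys) (T ! i) lam = \<mu>s ! i" if i: "i \<le> Suc k" for i
  proof (cases "i = Suc k")
    case True
    have "initial (js @ ys) t = js @ ys"
      using less yt by (intro initial_all) (auto intro: less_imp_le)
    moreover have "map fst ys = as" by (simp add: ys_def o_def)
    ultimately show ?thesis using as(4) True Tk by simp
  next
    case False
    then have "T ! i < t" using T_less[of i "Suc k"] Suc.prems i Tk by simp
    then have "initial (js @ ys) (T ! i) = initial js (T ! i)"
      using yt by (simp add: initial_def)
    then show ?thesis using ends[of i] False i by simp
  qed
  moreover have "ys \<noteq> []" using as(3) by (simp add: ys_def)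
  then have "chain_t lam ` set ys = {t}" using yt by (cases ys) auto
  then have "insert 0 (chain_t lam ` set (js @ ys)) = insert t (set (take (Suc k) T))"
    using ts by (simp add: image_Un) blast
  then have "insert 0 (chain_t lam ` set (js @ ys)) = set (take (Suc (Suc k)) T)"
    using take_Suc_conv_app_nth[OF Suc.prems] Tk by simp
  ultimately show ?case using js' by blast
qed

theorem gamma_bij: "bij_betw (gamma lam) (admissible lam) (LS_chains (- lam))"
  unfolding bij_betw_def
proof (intro conjI gamma_inj equalityI subsetI)
  fix x assume "x \<in> gamma lam ` admissible lam"
  then show "x \<in> LS_chains (- lam)" using gamma_LS_chain by blast
next
  fix x assume x: "x \<in> LS_chains (- lam)"
  obtain \<mu>s bs where [simp]: "x = (\<mu>s, bs)" by fastforce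
  define T where "T = 0 # bs"
  have LS: "length \<mu>s = Suc (length bs)" "sorted_wrt (<) T"
    using x by (auto simp: LS_chains_def T_def)
  obtain js where js: "chain_list js" and ts: "insert 0 (chain_t lam ` set js) = set T"
    and ends: "\<And>i. i \<le> length bs \<Longrightarrow> - elem_at js (T ! i) lam = \<mu>s ! i"
    using LS_chain_preimage[of \<mu>s bs T "length bs"] x T_def by auto
  note adm = chain_list_admissible[OF js]
  have "jumps lam (set js) = T"
    unfolding jumps_def ts using LS(2) by (intro sorted_list_of_set.idem_if_sorted_distinct) (auto simp: strict_sorted_iff)
  moreover have "map (\<lambda>t. - elem_at js t lam) T = \<mu>s"
  proof (rule nth_equalityI)
    show "length (map (\<lambda>t. - elem_at js t lam) T) = length \<mu>s" using LS(1) by (simp add: T_def)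
    fix i assume i: "i < length (map (\<lambda>t. - elem_at js t lam) T)"
    then have "i \<le> length bs" by (simp add: T_def)
    then show "map (\<lambda>t. - elem_at js t lam) T ! i = \<mu>s ! i" using ends i by (simp only: nth_map length_map)
  qed
  ultimately have "gamma lam (set js) = x"
    using gamma_eq[OF adm(1)] adm(2) by (simp add: T_def)
  then show "x \<in> gamma lam ` admissible lam" using adm(1) by blast
qed

end

theorem corollary9p5:
  fixes ip :: "'v::real_vector \<Rightarrow> 'v \<Rightarrow> real"
    and simple :: "nat \<Rightarrow> 'v"
    and r :: nat
    and lam :: 'v
  assumes "kac_moody_roots ip simple r"
    and "lam \<in> reflection_data.dominant_weights ip simple r"
  shows "bij_betw (reflection_data.gamma ip simple r lam)
           (reflection_data.admissible ip simple r lam)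
           (reflection_data.LS_chains ip simple r (- lam))"
proof -
  interpret dominant_data ip simple r lam
    using assms by (simp add: dominant_data_def dominant_data_axioms_def)
  show ?thesis by (rule gamma_bij)
qed

end
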